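(* Assume $(\Omega,T)=(\mathbb T^d,\alpha)$, i.e. $T\theta=\theta+\alpha$ on $\mathbb T^d$, let $V\in C^\omega(\mathbb T,\mathbb R)$ be non-constant, let $W\in C^\omega_h(\mathbb T^d,\mathbb R)$ and $E\in\mathbb R$, and write $m=m(E)$. There is $\varepsilon_0=\varepsilon_0(E,V,W)>0$ such that if $|\varepsilon|<\varepsilon_0$, then the canonical center bundle $\boldsymbol{\mathcal M}^c_{V,E,\varepsilon}$ admits a global holomorphic frame $U^\infty_\varepsilon(E,\cdot)$. Consequently, the center cocycle $C^\infty_\varepsilon(E,\cdot)\in C^\omega_h(\mathbb T^d,\mathrm{GL}(2m,\mathbb C))$ is well defined by $$S U^\infty_\varepsilon(E,\theta)=U^\infty_\varepsilon(E,\theta+\alpha)\,C^\infty_\varepsilon(E,\theta).$$ Moreover, $$\|C^\infty_\varepsilon(E,\cdot)-C^\infty_0(E)\|_h=\mathcal O(|\varepsilon|).$$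
   Context: $V$ is identified via $z=e^{2\pi i x}$ with $V(z)=\sum_n\widehat v_n z^n$, analytic in $\mathbb A_h=\{e^{-h}<|z|<e^h\}$; fix $0<\xi<h$. $C^\omega_h(\mathbb T^d,\cdot)$ denotes bounded analytic functions on the complex strip of width $h$ around $\mathbb T^d$, with sup norm $\|\cdot\|_h$. $\mathcal X_\xi=\{u=(u_n)_{n\in\mathbb Z}:\|u\|_\xi=\sum_n|u_n|e^{-\xi|n|}<\infty\}$, $(Su)_n=u_{n+1}$, and $(\mathbf L_{V,\varepsilon W,\alpha,\theta}u)_n=\sum_k\widehat v_k u_{n+k}+\varepsilon W(\theta+n\alpha)u_n$. $\mathcal M_{V,E,\varepsilon}(\theta)=\{u\in\mathcal X_\xi:\mathbf L_{V,\varepsilon W,\alpha,\theta}u=Eu\}$. $2m(E)$ is the (even) number of zeros of $L_E(z)=V(z)-E$ on $|z|=1$ with multiplicity. Choose $e^{-\xi}<r_-<1<r_+<e^\xi$ such that the only zeros of $L_E$ in $r_-\le|z|\le r_+$ lie on $|z|=1$. For $|\varepsilon|$ small, the canonical center bundle has fibers $$\mathcal M^c_{V,E,\varepsilon}(\theta)=\Big\{u\in\mathcal M_{V,E,\varepsilon}(\theta):\ \sup_{n\ge0}r_+^{-n}\|S^nu\|_\xi<\infty,\ \sup_{n\ge0}r_-^{n}\|S^{-n}u\|_\xi<\infty\Big\},$$ the center part of the partially hyperbolic splitting of the shift dynamics $(\theta,u)\mapsto(\theta+\alpha,Su)$ on $\mathcal M_{V,E,\varepsilon}$. The frame is the following explicit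 one. Write $\oint_{\Gamma_c}=\oint_{|z|=r_+}-\oint_{|z|=r_-}$ (both counterclockwise), let $(D_{E,\varepsilon}(z)f)(\theta)=\sum_j\widehat v_jz^jf(\theta+j\alpha)-Ef(\theta)+\varepsilon W(\theta)f(\theta)$, an operator on $C^\omega_h(\mathbb T^d,\mathbb C)$ which is invertible for $|z|=r_\pm$ and $|\varepsilon|$ small, put $g_{E,\varepsilon}(z,\cdot)=D_{E,\varepsilon}(z)^{-1}\mathbf 1$, and $$u^{\infty,p}_{\varepsilon;k}(E,\theta)=\frac1{2\pi i}\oint_{\Gamma_c}z^{k+p}g_{E,\varepsilon}(z,\theta+k\alpha)\,dz,\quad k\in\mathbb Z,\qquad U^\infty_\varepsilon=(u_\varepsilon^{\infty,0},\dots,u_\varepsilon^{\infty,2m-1}).$$ $C_0^\infty(E)$ denotes the center cocycle at $\varepsilon=0$, which is a constant matrix. *)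

theory Defs
  imports
    "HOL-Complex_Analysis.Complex_Analysis"
    "Jordan_Normal_Form.Matrix"
begin

(* Both HOL-Analysis and Jordan_Normal_Form declare an infix dollar for vectors;
   components of Euclidean vectors are therefore written with vec_nth. *)

section \<open>The spaces of bounded analytic functions on the torus\<close>

definition annulus :: "real \<Rightarrow> complex set" where
  "annulus h = {z. exp (- h) < cmod z \<and> cmod z < exp h}"

definition torus_strip :: "real \<Rightarrow> (complex ^ 'd::finite) set" where
  "torus_strip h = {\<theta>. \<forall>j. \<bar>Im (vec_nth \<theta> j)\<bar> < h}"

definition cvec :: "real ^ 'd::finite \<Rightarrow> complex ^ 'd" where
  "cvec x = (\<chi> j. complex_of_real (vec_nth x j))"

definition rot :: "real ^ 'd::finite \<Rightarrow> int \<Rightarrow> complex ^ 'd \<Rightarrow> complex ^ 'd" where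
  "rot \<alpha> n \<theta> = \<theta> + of_int n *s cvec \<alpha>"

text \<open>Holomorphy in several variables: the real Frechet derivative is complex linear.\<close>

definition holo_several :: "(complex ^ 'd::finite \<Rightarrow> complex) \<Rightarrow> (complex ^ 'd) set \<Rightarrow> bool" where
  "holo_several f A \<longleftrightarrow>
     (\<forall>\<theta>\<in>A. \<exists>D. (f has_derivative D) (at \<theta>) \<and> (\<forall>c v. D (c *s v) = c * D v))"

text \<open>Functions on the torus are 1-periodic functions of each coordinate. Requiring them to be
  extensional makes equality in the function space the same as equality on the strip.\<close>

definition C_omega :: "real \<Rightarrow> (complex ^ 'd::finite \<Rightarrow> complex) set" where
  "C_omega h = {f \<in> extensional (torus_strip h).
     holo_several f (torus_strip h) \<and> bounded (f ` torus_strip h) \<and>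
     (\<forall>\<theta>\<in>torus_strip h. \<forall>j. f (\<theta> + axis j 1) = f \<theta>)}"

definition C_omega_GL :: "real \<Rightarrow> nat \<Rightarrow> (complex ^ 'd::finite \<Rightarrow> complex mat) set" where
  "C_omega_GL h N = {C.
     (\<forall>\<theta>\<in>torus_strip h. C \<theta> \<in> carrier_mat N N \<and> invertible_mat (C \<theta>)) \<and>
     (\<forall>i<N. \<forall>j<N. (\<lambda>\<theta>\<in>torus_strip h. C \<theta> $$ (i, j)) \<in> C_omega h)}"

text \<open>The Frobenius norm serves as the norm on matrices of fixed size.\<close>

definition mat_norm :: "complex mat \<Rightarrow> real" where
  "mat_norm A = sqrt (\<Sum>i<dim_row A. \<Sum>j<dim_col A. (cmod (A $$ (i, j)))\<^sup>2)"

definition mat_sup_norm :: "real \<Rightarrow> (complex ^ 'd::finite \<Rightarrow> complex mat) \<Rightarrow> real" where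
  "mat_sup_norm h A = (SUP \<theta>\<in>torus_strip h. mat_norm (A \<theta>))"

section \<open>The weighted sequence space\<close>

definition seq_space :: "real \<Rightarrow> (int \<Rightarrow> complex) set" where
  "seq_space \<xi> = {u. (\<lambda>n. cmod (u n) * exp (- \<xi> * \<bar>real_of_int n\<bar>)) summable_on UNIV}"

definition seq_norm :: "real \<Rightarrow> (int \<Rightarrow> complex) \<Rightarrow> real" where
  "seq_norm \<xi> u = (\<Sum>\<^sub>\<infinity>n. cmod (u n) * exp (- \<xi> * \<bar>real_of_int n\<bar>))"

text \<open>The integer power \<open>S\<^sup>n\<close> of the shift; \<open>S\<close> itself is \<open>shift 1\<close>.\<close>

definition shift :: "int \<Rightarrow> (int \<Rightarrow> complex) \<Rightarrow> int \<Rightarrow> complex" where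
  "shift n u = (\<lambda>k. u (k + n))"

text \<open>Bounded analytic maps from the strip into the Banach space \<open>seq_space \<xi>\<close>: the third
  condition is complex Frechet differentiability with respect to \<open>seq_norm \<xi>\<close>
  (a linear map on a finite-dimensional space being automatically bounded).\<close>

definition C_omega_seq :: "real \<Rightarrow> real \<Rightarrow> (complex ^ 'd::finite \<Rightarrow> int \<Rightarrow> complex) set" where
  "C_omega_seq h \<xi> = {F.
     (\<forall>\<theta>\<in>torus_strip h. F \<theta> \<in> seq_space \<xi>) \<and>
     bdd_above ((\<lambda>\<theta>. seq_norm \<xi> (F \<theta>)) ` torus_strip h) \<and>
     (\<forall>\<theta>\<in>torus_strip h. \<exists>D.
        (\<forall>v. D v \<in> seq_space \<xi>) \<and>
        (\<forall>v w n. D (v + w) n = D v n + D w n) \<and>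
        (\<forall>c v n. D (c *s v) n = c * D v n) \<and>
        (\<forall>e>0. \<exists>\<delta>>0. \<forall>v. norm v < \<delta> \<longrightarrow> \<theta> + v \<in> torus_strip h \<and>
           seq_norm \<xi> (\<lambda>n. F (\<theta> + v) n - F \<theta> n - D v n) \<le> e * norm v)) \<and>
     (\<forall>\<theta>\<in>torus_strip h. \<forall>j. F (\<theta> + axis j 1) = F \<theta>)}"

section \<open>The long-range operator and its center bundle\<close>

text \<open>\<open>V\<close> is viewed as a function of \<open>z = exp (2 \<pi> i x)\<close>; its Fourier coefficients in \<open>x\<close> are
  the coefficients of its Laurent series in \<open>z\<close>.\<close>

definition fourier_coeff :: "(complex \<Rightarrow> complex) \<Rightarrow> int \<Rightarrow> complex" where
  "fourier_coeff V n =
     integral {0..1} (\<lambda>x. V (cis (2 * pi * x)) * cis (- 2 * pi * real_of_int n * x))"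

text \<open>Zeros of \<open>V - E\<close> on the unit circle, counted with multiplicity. For \<open>V\<close> real and
  non-constant on the circle this number is even, hence equal to \<open>2 * half_zeros V E\<close>.\<close>

definition circle_zeros :: "(complex \<Rightarrow> complex) \<Rightarrow> real \<Rightarrow> nat" where
  "circle_zeros V E =
     nat (\<Sum>z | cmod z = 1 \<and> V z = of_real E. zorder (\<lambda>w. V w - of_real E) z)"

definition half_zeros :: "(complex \<Rightarrow> complex) \<Rightarrow> real \<Rightarrow> nat" where
  "half_zeros V E = circle_zeros V E div 2"

definition long_range_op ::
  "(complex \<Rightarrow> complex) \<Rightarrow> (complex ^ 'd::finite \<Rightarrow> complex) \<Rightarrow> real ^ 'd \<Rightarrow> real \<Rightarrow>
     complex ^ 'd \<Rightarrow> (int \<Rightarrow> complex) \<Rightarrow> int \<Rightarrow> complex" where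
  "long_range_op V W \<alpha> \<epsilon> \<theta> u =
     (\<lambda>n. (\<Sum>\<^sub>\<infinity>k. fourier_coeff V k * u (n + k)) + of_real \<epsilon> * W (rot \<alpha> n \<theta>) * u n)"

definition solution_fiber ::
  "real \<Rightarrow> (complex \<Rightarrow> complex) \<Rightarrow> (complex ^ 'd::finite \<Rightarrow> complex) \<Rightarrow> real \<Rightarrow> real ^ 'd \<Rightarrow> real \<Rightarrow>
     complex ^ 'd \<Rightarrow> (int \<Rightarrow> complex) set" where
  "solution_fiber \<xi> V W E \<alpha> \<epsilon> \<theta> =
     {u \<in> seq_space \<xi>. long_range_op V W \<alpha> \<epsilon> \<theta> u = (\<lambda>n. of_real E * u n)}"

definition center_fiber ::
  "real \<Rightarrow> real \<Rightarrow> real \<Rightarrow> (complex \<Rightarrow> complex) \<Rightarrow> (complex ^ 'd::finite \<Rightarrow> complex) \<Rightarrow> real \<Rightarrow>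
     real ^ 'd \<Rightarrow> real \<Rightarrow> complex ^ 'd \<Rightarrow> (int \<Rightarrow> complex) set" where
  "center_fiber \<xi> rm rp V W E \<alpha> \<epsilon> \<theta> =
     {u \<in> solution_fiber \<xi> V W E \<alpha> \<epsilon> \<theta>.
        bdd_above (range (\<lambda>n::nat. rp powi (- int n) * seq_norm \<xi> (shift (int n) u))) \<and>
        bdd_above (range (\<lambda>n::nat. rm ^ n * seq_norm \<xi> (shift (- int n) u)))}"

definition holomorphic_frame ::
  "real \<Rightarrow> real \<Rightarrow> (complex ^ 'd::finite \<Rightarrow> (int \<Rightarrow> complex) set) \<Rightarrow> nat \<Rightarrow>
     (nat \<Rightarrow> complex ^ 'd \<Rightarrow> int \<Rightarrow> complex) \<Rightarrow> bool" where
  "holomorphic_frame h \<xi> B N U \<longleftrightarrow>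
     (\<forall>p<N. U p \<in> C_omega_seq h \<xi>) \<and>
     (\<forall>\<theta>\<in>torus_strip h.
        (\<forall>p<N. U p \<theta> \<in> B \<theta>) \<and>
        (\<forall>u\<in>B \<theta>. \<exists>c. u = (\<lambda>k. \<Sum>p<N. c p * U p \<theta> k)) \<and>
        (\<forall>c. (\<forall>k. (\<Sum>p<N. c p * U p \<theta> k) = 0) \<longrightarrow> (\<forall>p<N. c p = 0)))"

section \<open>The explicit frame and the center cocycle\<close>

definition D_op ::
  "real \<Rightarrow> (complex \<Rightarrow> complex) \<Rightarrow> (complex ^ 'd::finite \<Rightarrow> complex) \<Rightarrow> real \<Rightarrow> real ^ 'd \<Rightarrow> real \<Rightarrow>
     complex \<Rightarrow> (complex ^ 'd \<Rightarrow> complex) \<Rightarrow> complex ^ 'd \<Rightarrow> complex" where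
  "D_op h V W E \<alpha> \<epsilon> z f =
     (\<lambda>\<theta>\<in>torus_strip h.
        (\<Sum>\<^sub>\<infinity>j. fourier_coeff V j * z powi j * f (rot \<alpha> j \<theta>))
        - of_real E * f \<theta> + of_real \<epsilon> * W \<theta> * f \<theta>)"

definition g_fun ::
  "real \<Rightarrow> (complex \<Rightarrow> complex) \<Rightarrow> (complex ^ 'd::finite \<Rightarrow> complex) \<Rightarrow> real \<Rightarrow> real ^ 'd \<Rightarrow> real \<Rightarrow>
     complex \<Rightarrow> complex ^ 'd \<Rightarrow> complex" where
  "g_fun h V W E \<alpha> \<epsilon> z =
     inv_into (C_omega h) (D_op h V W E \<alpha> \<epsilon> z) (\<lambda>\<theta>\<in>torus_strip h. 1)"

definition center_frame ::
  "real \<Rightarrow> real \<Rightarrow> real \<Rightarrow> (complex \<Rightarrow> complex) \<Rightarrow> (complex ^ 'd::finite \<Rightarrow> complex) \<Rightarrow> real \<Rightarrow>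
     real ^ 'd \<Rightarrow> real \<Rightarrow> nat \<Rightarrow> complex ^ 'd \<Rightarrow> int \<Rightarrow> complex" where
  "center_frame h rm rp V W E \<alpha> \<epsilon> p \<theta> k =
     (let F = (\<lambda>z. z powi (k + int p) * g_fun h V W E \<alpha> \<epsilon> z (rot \<alpha> k \<theta>))
      in (contour_integral (circlepath 0 rp) F - contour_integral (circlepath 0 rm) F)
           / (2 * of_real pi * \<i>))"

text \<open>The relation \<open>S U(\<theta>) = U(\<theta> + \<alpha>) C\<close> for a constant matrix \<open>C\<close>, column by column.\<close>

definition cocycle_rel ::
  "real ^ 'd::finite \<Rightarrow> nat \<Rightarrow> (nat \<Rightarrow> complex ^ 'd \<Rightarrow> int \<Rightarrow> complex) \<Rightarrow> complex ^ 'd \<Rightarrow>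
     complex mat \<Rightarrow> bool" where
  "cocycle_rel \<alpha> N U \<theta> C \<longleftrightarrow> C \<in> carrier_mat N N \<and>
     (\<forall>p<N. shift 1 (U p \<theta>) = (\<lambda>k. \<Sum>q<N. U q (rot \<alpha> 1 \<theta>) k * C $$ (q, p)))"

definition center_cocycle ::
  "real \<Rightarrow> real \<Rightarrow> real \<Rightarrow> (complex \<Rightarrow> complex) \<Rightarrow> (complex ^ 'd::finite \<Rightarrow> complex) \<Rightarrow> real \<Rightarrow>
     real ^ 'd \<Rightarrow> real \<Rightarrow> complex ^ 'd \<Rightarrow> complex mat" where
  "center_cocycle h rm rp V W E \<alpha> \<epsilon> \<theta> =
     (THE C. cocycle_rel \<alpha> (2 * half_zeros V E) (center_frame h rm rp V W E \<alpha> \<epsilon>) \<theta> C)"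

end

theory Submission
  imports Defs "Jordan_Normal_Form.Determinant"
begin

text \<open>For \<open>\<rho> = rm\<close> and \<open>\<rho> = rp\<close> the operator \<open>T\<^sub>\<theta>\<close>, that is the long-range operator minus \<open>E\<close>, is
  invertible on sequences of size \<open>O(\<rho>\<^sup>n)\<close>: at \<open>\<epsilon> = 0\<close> the inverse is convolution with the Laurent coefficients
  of \<open>1 / (V - E)\<close> near the circle, and a Neumann series handles small \<open>\<epsilon>\<close>. The Fourier modes \<open>z\<^sup>n\<close> show that
  \<open>D(z)\<close> is invertible and that the frame vector \<open>u\<^sup>p\<close> is the difference of the two inverses applied to the
  unit sequence at \<open>- 1 - p\<close>.

  On sequences decaying like \<open>min (rp\<^sup>n) (rm\<^sup>n)\<close> the operator has a cokernel instead. There \<open>V - E\<close> factors as a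
  polynomial of degree \<open>N\<close> with its zeros on the unit circle times an invertible factor, so division with
  remainder shows that the unit sequences at \<open>- 1, \<dots>, - N\<close> span a complement of the range, again stably in \<open>\<epsilon>\<close>.
  Cutting a center solution in two halves, each half is an inverse applied to an element of this space, and
  the remainder of that element gives the coordinates in the frame. The shift moves the unit sequence by
  one, so the cocycle is a companion matrix whose last column is the remainder of the unit sequence at \<open>- 1 - N\<close>.
  All analytic dependence follows because the series involved converge uniformly.\<close>

section \<open>Laurent series on annuli\<close>

text \<open>Behind the two inverses and the cokernel stands a short exact sequence. Sequences of
  size O(\<open>wmin\<close>) form the intersection, and those of size O(\<open>wmax\<close>) the
  sum, of the classes O(\<open>rm powi n\<close>) and O(\<open>rp powi n\<close>).
  \<open>opT\<close> is bijective on each of these two classes, so its kernel on the sum, which is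
  the center fiber, is isomorphic to its cokernel on the intersection. For \<epsilon> = 0 this
  cokernel consists of the polynomials modulo the product of the z - \<zeta>; division with
  remainder is itself a bounded operation, so a Neumann series carries the same complement over to
  small \<epsilon>. Pointwise weights stand in for the summation norm of the sequence space; both
  describe the same center solutions because exp (- \<xi>) < rm and rp < exp \<xi>. Parameters are
  treated once for all: a property closed under sums, products and uniform limits
  (\<open>uniform_algebra\<close>) passes to every solution constructed, and uniqueness transfers it
  to the objects given by \<open>inv_into\<close>, \<open>SOME\<close> or contour integrals. All
  bounds see W only through its supremum, hence \<epsilon>0 does not depend on \<alpha>.\<close>

definition open_annulus :: "real \<Rightarrow> real \<Rightarrow> complex set" where
  "open_annulus r1 r2 = {z. r1 < cmod z \<and> cmod z < r2}"

definition laurent_coeff :: "(complex \<Rightarrow> complex) \<Rightarrow> real \<Rightarrow> int \<Rightarrow> complex" where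
  "laurent_coeff f r n =
     contour_integral (circlepath 0 r) (\<lambda>w. f w * w powi (- n - 1)) / (2 * of_real pi * \<i>)"

lemma open_open_annulus: "open (open_annulus r1 r2)"
  unfolding open_annulus_def by (intro open_Collect_conj open_Collect_less continuous_intros)

text \<open>Weierstrass M-test: the majorant makes the finite partial sums converge uniformly on the
  circle, where limit and integral may be exchanged.\<close>

lemma has_sum_contour_integral_circlepath:
  fixes F :: "'a \<Rightarrow> complex \<Rightarrow> complex"
  assumes r: "0 < r"
    and cont: "\<And>k. k \<in> A \<Longrightarrow> continuous_on (sphere 0 r) (F k)"
    and bd: "\<And>k z. k \<in> A \<Longrightarrow> z \<in> sphere 0 r \<Longrightarrow> norm (F k z) \<le> M k"
    and M: "M summable_on A"
    and S: "\<And>z. z \<in> sphere 0 r \<Longrightarrow> ((\<lambda>k. F k z) has_sum S z) A"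
  shows "((\<lambda>k. contour_integral (circlepath 0 r) (F k)) has_sum
            contour_integral (circlepath 0 r) S) A"
proof -
  have int: "F k contour_integrable_on circlepath 0 r" if "k \<in> A" for k
    using that r cont by (intro contour_integrable_continuous_circlepath) simp
  have "uniform_limit (sphere 0 r) (\<lambda>X y. \<Sum>x\<in>X. F x y) S (finite_subsets_at_top A)"
    using bd S M by (rule Weierstrass_m_test_general')
  moreover have "\<forall>\<^sub>F X in finite_subsets_at_top A.
      (\<lambda>y. \<Sum>x\<in>X. F x y) contour_integrable_on circlepath 0 r"
    by (rule eventually_finite_subsets_at_top_weakI)
       (auto intro!: contour_integrable_sum int)
  ultimately have *: "((\<lambda>X. contour_integral (circlepath 0 r) (\<lambda>y. \<Sum>x\<in>X. F x y)) \<longlongrightarrow>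
      contour_integral (circlepath 0 r) S) (finite_subsets_at_top A)"
    using r by (intro contour_integral_uniform_limit_circlepath(2)) auto
  have ev: "\<forall>\<^sub>F X in finite_subsets_at_top A. contour_integral (circlepath 0 r) (\<lambda>y. \<Sum>x\<in>X. F x y)
      = (\<Sum>x\<in>X. contour_integral (circlepath 0 r) (F x))"
    by (rule eventually_finite_subsets_at_top_weakI)
       (auto intro!: contour_integral_sum int)
  show ?thesis
    unfolding has_sum_def using * ev by (rule Lim_transform_eventually)
qed

text \<open>Corresponding points of the two circles have the same argument, so the moduli on the
  segment between them are convex combinations of the radii and the linear homotopy never leaves the
  annulus.\<close>

lemma contour_integral_annulus_radius:
  assumes f: "f holomorphic_on open_annulus r1 r2"
    and "0 \<le> r1" "r1 < r" "r < r2" "r1 < r'" "r' < r2"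
  shows "contour_integral (circlepath 0 r) f = contour_integral (circlepath 0 r') f"
proof (rule Cauchy_theorem_homotopic_loops[OF _ open_open_annulus f])
  show "homotopic_loops (open_annulus r1 r2) (circlepath 0 r) (circlepath 0 r')"
  proof (rule homotopic_loops_linear)
    fix t x :: real
    show "closed_segment (circlepath 0 r t) (circlepath 0 r' t) \<subseteq> open_annulus r1 r2"
    proof
      fix y assume "y \<in> closed_segment (circlepath 0 r t) (circlepath 0 r' t)"
      then obtain u where u: "0 \<le> u" "u \<le> 1"
        "y = (1 - u) *\<^sub>R circlepath 0 r t + u *\<^sub>R circlepath 0 r' t"
        unfolding closed_segment_def by auto
      have "y = of_real ((1 - u) * r + u * r') * exp (2 * of_real pi * \<i> * t)"
        by (simp add: u circlepath scaleR_conv_of_real algebra_simps)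
      then have "cmod y = \<bar>(1 - u) * r + u * r'\<bar>"
        by (simp add: norm_mult exp_Euler del: of_real_add of_real_mult of_real_diff)
      moreover have "r1 < (1 - u) * r + u * r'"
        using convex_bound_lt[of "- r" "- r1" "- r'" "1-u" u] assms u by simp
      moreover have "(1 - u) * r + u * r' < r2"
        using convex_bound_lt[of r r2 r' "1-u" u] assms u by simp
      ultimately show "y \<in> open_annulus r1 r2"
        using assms unfolding open_annulus_def by auto
    qed
  qed auto
qed auto

lemma holomorphic_on_powi_annulus [holomorphic_intros]:
  "0 \<le> r1 \<Longrightarrow> (\<lambda>w. w powi n) holomorphic_on open_annulus r1 r2"
  by (auto simp: open_annulus_def intro!: holomorphic_intros)

lemma laurent_coeff_radius:
  assumes "f holomorphic_on open_annulus r1 r2"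
    and "0 \<le> r1" "r1 < r" "r < r2" "r1 < r'" "r' < r2"
  shows "laurent_coeff f r n = laurent_coeff f r' n"
  unfolding laurent_coeff_def
  by (subst contour_integral_annulus_radius[of _ r1 r2 r r'])
     (use assms in \<open>auto intro!: holomorphic_intros\<close>)

lemma laurent_coeff_bound:
  assumes "0 < r" "continuous_on (sphere 0 r) f" "\<And>w. cmod w = r \<Longrightarrow> cmod (f w) \<le> M"
  shows "cmod (laurent_coeff f r n) \<le> M * r powi (- n)"
proof -
  have nz: "w \<noteq> 0" if "cmod w = r" for w
    using that assms by auto
  have "(\<lambda>w. f w * w powi (- n - 1)) contour_integrable_on circlepath 0 r"
    using assms nz by (intro contour_integrable_continuous_circlepath continuous_intros) auto
  moreover have "0 \<le> M"
    using assms(3)[of "of_real r"] assms(1) by (smt (verit) norm_ge_zero norm_of_real)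
  ultimately have "cmod (contour_integral (circlepath 0 r) (\<lambda>w. f w * w powi (- n - 1)))
      \<le> (M * r powi (- n - 1)) * (2 * pi * r)"
    using assms
    by (intro has_contour_integral_bound_circlepath[OF has_contour_integral_integral])
       (auto simp: norm_mult norm_power_int intro!: mult_mono)
  also have "\<dots> = 2 * pi * (M * r powi (- n))"
    using assms(1) by (simp add: power_int_diff)
  finally show ?thesis
    by (simp add: laurent_coeff_def norm_divide norm_mult field_simps)
qed

section \<open>Sums over the integers and decay of Laurent coefficients\<close>

lemma has_sum_nonneg_int:
  assumes "((\<lambda>n::nat. f (int n)) has_sum S) UNIV"
  shows "(f has_sum S) {0..}"
  using assms has_sum_reindex_bij_witness[of UNIV nat int "{0..}" f "\<lambda>n. f (int n)" S S]
  by auto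

lemma has_sum_neg_int:
  assumes "((\<lambda>n::nat. f (- int n - 1)) has_sum S) UNIV"
  shows "(f has_sum S) {..<0}"
  using assms has_sum_reindex_bij_witness[of UNIV "\<lambda>k. nat (- k - 1)" "\<lambda>n. - int n - 1" "{..<0}" f
      "\<lambda>n. f (- int n - 1)" S S]
  by auto

text \<open>The negative half is enumerated as - n - 1, so that 0 is counted once, in the
  nonnegative half.\<close>

lemma has_sum_int:
  fixes f :: "int \<Rightarrow> 'a::topological_comm_monoid_add"
  assumes "((\<lambda>n::nat. f (int n)) has_sum S) UNIV" "((\<lambda>n::nat. f (- int n - 1)) has_sum S') UNIV"
  shows "(f has_sum (S + S')) UNIV"
proof -
  have "(f has_sum (S + S')) ({0..} \<union> {..<0})"
    by (intro has_sum_Un_disjoint has_sum_nonneg_int has_sum_neg_int assms) auto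
  moreover have "{0..} \<union> {..<0} = (UNIV :: int set)" by auto
  ultimately show ?thesis by simp
qed

lemma summable_on_int_geometric:
  assumes "0 \<le> q" "q < (1::real)"
  shows "(\<lambda>n::int. q ^ nat \<bar>n\<bar>) summable_on UNIV"
proof -
  have "(\<lambda>n::nat. q ^ n) summable_on UNIV"
    using assms by (intro norm_summable_imp_summable_on) (simp add: norm_power)
  then obtain S where S: "((\<lambda>n::nat. q ^ n) has_sum S) UNIV"
    unfolding summable_on_def by auto
  have "((\<lambda>n::nat. q * q ^ n) has_sum (q * S)) UNIV"
    using S by (rule has_sum_cmult_right)
  moreover have "nat \<bar>- int n - 1\<bar> = Suc n" for n by simp
  ultimately show ?thesis
    using has_sum_int[of "\<lambda>n. q ^ nat \<bar>n\<bar>" S "q * S"] S unfolding summable_on_def by auto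
qed

lemma continuous_on_sphere_bound:
  fixes f :: "complex \<Rightarrow> complex"
  assumes "continuous_on (sphere 0 r) f"
  shows "\<exists>M>0. \<forall>w. cmod w = r \<longrightarrow> cmod (f w) \<le> M"
proof -
  have "bounded (f ` sphere 0 r)"
    by (intro compact_imp_bounded compact_continuous_image assms) auto
  then obtain M where M: "0 < M" "\<forall>y\<in>f ` sphere 0 r. cmod y \<le> M"
    unfolding bounded_pos by blast
  have "cmod (f w) \<le> M" if "cmod w = r" for w
    using bspec[OF M(2) imageI, of w] that by simp
  with M(1) show ?thesis by blast
qed

text \<open>The coefficients do not depend on the radius, so estimating them on a circle beyond
  \<open>b\<close> and on one inside \<open>a\<close> gives geometric decay at both ends, even
  against the larger of the two weights.\<close>

lemma laurent_coeff_summable: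
  assumes f: "f holomorphic_on open_annulus r1 r2"
    and r: "0 \<le> r1" "r1 < a" "a \<le> b" "b < r2" "r1 < r" "r < r2"
  shows "(\<lambda>n. cmod (laurent_coeff f r n) * max (b powi n) (a powi n)) summable_on UNIV"
proof -
  obtain a' where a': "r1 < a'" "a' < a" using r dense by blast
  obtain b' where b': "b < b'" "b' < r2" using r dense by blast
  \<comment> \<open>The ratio \<open>b / b'\<close> governs n \<ge> 0 and \<open>a' / a\<close>
    governs n < 0.\<close>
  define q where "q = max (b / b') (a' / a)"
  have q: "0 \<le> q" "q < 1" using a' b' r unfolding q_def by (auto simp: le_max_iff_disj)
  have bdd: "\<exists>M\<ge>0. \<forall>n. cmod (laurent_coeff f r n) \<le> M * s powi (- n)" if s: "r1 < s" "s < r2" for s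
  proof -
    have sub: "sphere 0 s \<subseteq> open_annulus r1 r2"
      using s by (auto simp: open_annulus_def)
    have cont: "continuous_on (sphere 0 s) f"
      using f sub holomorphic_on_imp_continuous_on continuous_on_subset by blast
    obtain M where M: "\<And>w. cmod w = s \<Longrightarrow> cmod (f w) \<le> M" "0 < M"
      using continuous_on_sphere_bound[OF cont] by auto
    have "cmod (laurent_coeff f s n) \<le> M * s powi (- n)" for n
      using laurent_coeff_bound[OF _ cont M(1)] r s by simp
    moreover have "laurent_coeff f s n = laurent_coeff f r n" for n
      using laurent_coeff_radius[OF f _ s] r by blast
    ultimately have "\<forall>n. cmod (laurent_coeff f r n) \<le> M * s powi (- n)" by metis
    then show ?thesis using M(2) less_imp_le by blast
  qed
  obtain M where M: "0 \<le> M" "\<And>n. cmod (laurent_coeff f r n) \<le> M * b' powi (- n)"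
    using bdd[of b'] a' b' r by (meson less_trans le_less_trans less_le_trans)
  obtain M' where M': "0 \<le> M'" "\<And>n. cmod (laurent_coeff f r n) \<le> M' * a' powi (- n)"
    using bdd[of a'] a' b' r by (meson less_trans le_less_trans less_le_trans)
  have "(\<lambda>n::int. max M M' * q ^ nat \<bar>n\<bar>) summable_on UNIV"
    by (intro summable_on_cmult_right summable_on_int_geometric q)
  then show ?thesis
  proof (rule summable_on_comparison_test)
    fix n :: int
    show "cmod (laurent_coeff f r n) * max (b powi n) (a powi n) \<le> max M M' * q ^ nat \<bar>n\<bar>"
    proof (cases "0 \<le> n")
      case True
      then obtain k where k: "n = int k" using nonneg_int_cases by blast
      have "max (b powi n) (a powi n) = b ^ k"
        using r power_mono[of a b k] by (simp add: k)
      then have "cmod (laurent_coeff f r n) * max (b powi n) (a powi n)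
          = cmod (laurent_coeff f r n) * b ^ k" by (rule arg_cong)
      also have "\<dots> \<le> M * b' powi (- n) * b ^ k"
        using r by (intro mult_right_mono M(2)) auto
      also have "\<dots> = M * (b / b') ^ k"
        by (simp add: k power_int_minus power_mult_distrib power_inverse divide_inverse)
      also have "\<dots> \<le> max M M' * q ^ k"
        using M(1) b' r by (intro mult_mono power_mono) (auto simp: q_def)
      finally show ?thesis by (simp add: k)
    next
      case False
      then obtain k where k: "n = - int k" by (metis int_cases2 of_nat_0_le_iff)
      have "inverse b ^ k \<le> inverse a ^ k"
        using r by (intro power_mono le_imp_inverse_le) auto
      then have "max (b powi n) (a powi n) = inverse a ^ k"
        by (simp add: k power_int_minus power_inverse)
      then have "cmod (laurent_coeff f r n) * max (b powi n) (a powi n)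
          = cmod (laurent_coeff f r n) * inverse a ^ k" by (rule arg_cong)
      also have "\<dots> \<le> M' * a' powi (- n) * inverse a ^ k"
        using r by (intro mult_right_mono M'(2)) auto
      also have "\<dots> = M' * (a' / a) ^ k"
        by (simp add: k power_int_minus power_mult_distrib power_inverse divide_inverse)
      also have "\<dots> \<le> max M M' * q ^ k"
        using M'(1) a' r by (intro mult_mono power_mono) (auto simp: q_def)
      finally show ?thesis by (simp add: k)
    qed
    show "0 \<le> cmod (laurent_coeff f r n) * max (b powi n) (a powi n)"
      using r by (intro mult_nonneg_nonneg norm_ge_zero max.coboundedI1 zero_le_power_int) auto
  qed
qed

section \<open>The Cauchy kernel and the Laurent expansion\<close>

lemma has_sum_geometric_complex:
  fixes q :: complex
  assumes "cmod q < 1"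
  shows "((\<lambda>n::nat. q ^ n) has_sum 1 / (1 - q)) UNIV"
  using assms by (intro norm_summable_imp_has_sum geometric_sums) (auto simp: norm_power)

lemma has_sum_cauchy_kernel_outer:
  assumes "cmod z < cmod w"
  shows "((\<lambda>n. z powi n * w powi (- n - 1)) has_sum 1 / (w - z)) {0..}"
proof (rule has_sum_nonneg_int)
  have w: "w \<noteq> 0" using assms by auto
  have "((\<lambda>n::nat. 1 / w * (z / w) ^ n) has_sum (1 / w * (1 / (1 - z / w)))) UNIV"
    using assms w by (intro has_sum_cmult_right has_sum_geometric_complex) (simp add: norm_divide)
  moreover have "1 / w * (1 / (1 - z / w)) = 1 / (w - z)"
    using w by (simp add: field_simps)
  moreover have "1 / w * (z / w) ^ n = z powi int n * w powi (- int n - 1)" for n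
    using w by (simp add: power_int_diff power_int_minus field_simps)
  ultimately show "((\<lambda>n::nat. z powi int n * w powi (- int n - 1)) has_sum 1 / (w - z)) UNIV"
    by simp
qed

lemma has_sum_cauchy_kernel_inner:
  assumes "cmod w < cmod z" "w \<noteq> 0"
  shows "((\<lambda>n. z powi n * w powi (- n - 1)) has_sum - 1 / (w - z)) {..<0}"
proof (rule has_sum_neg_int)
  have z: "z \<noteq> 0" using assms by auto
  have "((\<lambda>n::nat. 1 / z * (w / z) ^ n) has_sum (1 / z * (1 / (1 - w / z)))) UNIV"
    using assms z by (intro has_sum_cmult_right has_sum_geometric_complex) (simp add: norm_divide)
  moreover have "w - z \<noteq> 0" using assms by auto
  then have "1 / z * (1 / (1 - w / z)) = - 1 / (w - z)"
    using z by (simp add: divide_simps)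
  moreover have "1 / z * (w / z) ^ n = z powi (- int n - 1) * w powi (- (- int n - 1) - 1)" for n
    using z by (simp add: power_int_diff power_int_minus field_simps)
  ultimately show "((\<lambda>n::nat. z powi (- int n - 1) * w powi (- (- int n - 1) - 1)) has_sum - 1 / (w - z)) UNIV"
    by simp
qed

text \<open>The difference quotient \<open>g\<close> extends holomorphically over \<open>z\<close>,
  so its integrals over the two circles agree. Splitting off f z leaves the integral of 1 / (w - z),
  which is 2 pi i on the circle enclosing \<open>z\<close> and 0 on the other.\<close>

lemma cauchy_integral_formula_annulus:
  assumes f: "f holomorphic_on open_annulus r1 r2"
    and r: "0 \<le> r1" "r1 < r" "r < cmod z" "cmod z < R" "R < r2"
  shows "2 * of_real pi * \<i> * f z = contour_integral (circlepath 0 R) (\<lambda>w. f w / (w - z))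
           - contour_integral (circlepath 0 r) (\<lambda>w. f w / (w - z))"
proof -
  let ?A = "open_annulus r1 r2"
  define g where "g = (\<lambda>w. if w = z then deriv f z else (f w - f z) / (w - z))"
  have g: "g holomorphic_on ?A"
    unfolding g_def by (intro pole_lemma_open f open_open_annulus)
  have eq: "contour_integral (circlepath 0 s) g = contour_integral (circlepath 0 s) (\<lambda>w. f w / (w - z))
      - f z * contour_integral (circlepath 0 s) (\<lambda>w. 1 / (w - z))"
    if s: "r1 < s" "s < r2" "s \<noteq> cmod z" for s
  proof -
    have sub: "sphere 0 s \<subseteq> ?A" using s by (auto simp: open_annulus_def)
    have cf: "continuous_on (sphere 0 s) f"
      using f sub holomorphic_on_imp_continuous_on continuous_on_subset by blast
    have nz: "w - z \<noteq> 0" if "w \<in> sphere 0 s" for w using that s by auto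
    have s0: "0 < s" using s r by simp
    have 1: "(\<lambda>w. f w / (w - z)) contour_integrable_on circlepath 0 s"
      using s0 cf nz by (intro contour_integrable_continuous_circlepath continuous_intros) auto
    have 2: "(\<lambda>w. 1 / (w - z)) contour_integrable_on circlepath 0 s"
      using s0 nz by (intro contour_integrable_continuous_circlepath continuous_intros) auto
    have "contour_integral (circlepath 0 s) g
        = contour_integral (circlepath 0 s) (\<lambda>w. f w / (w - z) - f z * (1 / (w - z)))"
      using nz s0 by (intro contour_integral_cong) (auto simp: g_def diff_divide_distrib)
    also have "\<dots> = contour_integral (circlepath 0 s) (\<lambda>w. f w / (w - z))
      - contour_integral (circlepath 0 s) (\<lambda>w. f z * (1 / (w - z)))"
      by (intro contour_integral_diff 1 contour_integrable_lmul 2)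
    finally show ?thesis using contour_integral_lmul[OF 2, of "f z"] by simp
  qed
  have "((\<lambda>w. 1 / (w - z)) has_contour_integral (2 * of_real pi * \<i> * 1)) (circlepath 0 R)"
    using r by (intro Cauchy_integral_circlepath) (auto intro!: continuous_intros holomorphic_intros)
  then have R: "contour_integral (circlepath 0 R) (\<lambda>w. 1 / (w - z)) = 2 * of_real pi * \<i>"
    using contour_integral_unique by fastforce
  have "((\<lambda>w. 1 / (w - z)) has_contour_integral 0) (circlepath 0 r)"
    using r by (intro Cauchy_theorem_convex_simple[of _ "ball 0 (cmod z)"])
       (auto intro!: continuous_intros holomorphic_intros)
  then have r0: "contour_integral (circlepath 0 r) (\<lambda>w. 1 / (w - z)) = 0"
    using contour_integral_unique by fastforce
  have "contour_integral (circlepath 0 R) g = contour_integral (circlepath 0 r) g"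
    using r by (intro contour_integral_annulus_radius[OF g]) auto
  then show ?thesis
    using eq[of R] eq[of r] R r0 r by (simp add: algebra_simps)
qed

text \<open>The Cauchy kernel is expanded in powers of z / w on the outer circle and of w / z on the
  inner one; integration term by term yields the terms with n \<ge> 0 and with n < 0.\<close>

lemma laurent_series:
  assumes f: "f holomorphic_on open_annulus r1 r2"
    and r: "0 \<le> r1" "r1 < s" "s < r2" and z: "z \<in> open_annulus r1 r2"
  shows "((\<lambda>n. laurent_coeff f s n * z powi n) has_sum f z) UNIV"
proof -
  obtain r where r': "r1 < r" "r < cmod z" using z dense unfolding open_annulus_def by auto
  obtain R where R: "cmod z < R" "R < r2" using z dense unfolding open_annulus_def by auto
  have part: "((\<lambda>n. contour_integral (circlepath 0 q) (\<lambda>w. f w * (z powi n * w powi (- n - 1))))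
      has_sum contour_integral (circlepath 0 q) (\<lambda>w. f w * K w)) A"
    if q: "r1 < q" "q < r2" and A: "(\<lambda>n. (cmod z / q) powi n) summable_on A"
      and K: "\<And>w. cmod w = q \<Longrightarrow> ((\<lambda>n. z powi n * w powi (- n - 1)) has_sum K w) A" for q K A
  proof -
    have sub: "sphere 0 q \<subseteq> open_annulus r1 r2" using q by (auto simp: open_annulus_def)
    have cf: "continuous_on (sphere 0 q) f"
      using f sub holomorphic_on_imp_continuous_on continuous_on_subset by blast
    obtain M where M: "\<And>w. cmod w = q \<Longrightarrow> cmod (f w) \<le> M" "0 < M"
      using continuous_on_sphere_bound[OF cf] by auto
    have q0: "0 < q" using q r by simp
    show ?thesis
    proof (rule has_sum_contour_integral_circlepath[OF q0])
      show "continuous_on (sphere 0 q) (\<lambda>w. f w * (z powi n * w powi (- n - 1)))" for n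
        using q0 by (intro continuous_intros cf) auto
      show "norm (f w * (z powi n * w powi (- n - 1))) \<le> M / q * (cmod z / q) powi n"
        if "w \<in> sphere 0 q" for w n
      proof -
        have nw: "cmod w powi (- n - 1) = 1 / (q * q powi n)"
          using that q0 by (simp add: power_int_diff power_int_minus divide_inverse)
        have "norm (f w * (z powi n * w powi (- n - 1))) = cmod (f w) * (1 / q * (cmod z / q) powi n)"
          unfolding norm_mult norm_power_int nw by (simp only: power_int_divide_distrib times_divide_times_eq mult_1_left mult_1_right
            times_divide_eq_right times_divide_eq_left divide_divide_eq_left mult_ac)
        also have "\<dots> \<le> M * (1 / q * (cmod z / q) powi n)"
          using that M q0 by (intro mult_right_mono) auto
        finally show ?thesis by simp
      qed
      show "(\<lambda>n. M / q * (cmod z / q) powi n) summable_on A"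
        by (intro summable_on_cmult_right A)
      show "((\<lambda>n. f w * (z powi n * w powi (- n - 1))) has_sum f w * K w) A"
        if "w \<in> sphere 0 q" for w
        using that by (intro has_sum_cmult_right K) auto
    qed
  qed
  \<comment> \<open>The circles of radius \<open>R\<close> and \<open>r\<close> depend on
    \<open>z\<close>; moving each integral to the fixed radius \<open>s\<close> makes the
    coefficients independent of it.\<close>
  have coeff: "contour_integral (circlepath 0 q) (\<lambda>w. f w * (z powi n * w powi (- n - 1)))
      = 2 * of_real pi * \<i> * (laurent_coeff f s n * z powi n)" if q: "r1 < q" "q < r2" for q n
  proof -
    have sub: "sphere 0 q \<subseteq> open_annulus r1 r2" using q by (auto simp: open_annulus_def)
    have cf: "continuous_on (sphere 0 q) f"
      using f sub holomorphic_on_imp_continuous_on continuous_on_subset by blast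
    have q0: "0 < q" using q r by simp
    have "(\<lambda>w. f w * w powi (- n - 1)) contour_integrable_on circlepath 0 q"
      using q0 by (intro contour_integrable_continuous_circlepath continuous_intros)
        (auto intro: continuous_on_subset[OF cf])
    then have "contour_integral (circlepath 0 q) (\<lambda>w. z powi n * (f w * w powi (- n - 1)))
        = z powi n * contour_integral (circlepath 0 q) (\<lambda>w. f w * w powi (- n - 1))"
      by (rule contour_integral_lmul)
    also have "\<dots> = 2 * of_real pi * \<i> * (laurent_coeff f q n * z powi n)"
      by (simp add: laurent_coeff_def)
    also have "laurent_coeff f q n = laurent_coeff f s n"
      by (rule laurent_coeff_radius[OF f]) (use q r in auto)
    finally show ?thesis by (simp add: mult_ac)
  qed
  have zR: "0 \<le> cmod z / R" "cmod z / R < 1" using r r' R by auto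
  have "((\<lambda>n. (cmod z / R) ^ n) has_sum 1 / (1 - cmod z / R)) (UNIV :: nat set)"
    using zR by (intro norm_summable_imp_has_sum geometric_sums) (auto simp: norm_power)
  then have sR: "(\<lambda>n. (cmod z / R) powi n) summable_on {0..}"
    unfolding summable_on_def by (intro exI[of _ "1 / (1 - cmod z / R)"] has_sum_nonneg_int) simp
  have "0 < cmod z" using r r' by linarith
  then have rz: "0 < r / cmod z \<and> r / cmod z < 1" using r r' by simp
  have "((\<lambda>n. r / cmod z * (r / cmod z) ^ n) has_sum r / cmod z * (1 / (1 - r / cmod z))) (UNIV :: nat set)"
    using rz by (intro has_sum_cmult_right norm_summable_imp_has_sum geometric_sums) (auto simp: norm_power)
  moreover have "r / cmod z * (r / cmod z) ^ n = (cmod z / r) powi (- int n - 1)" for n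
    using r r' by (simp add: power_int_diff power_int_minus field_simps)
  ultimately have sr: "(\<lambda>n. (cmod z / r) powi n) summable_on {..<0}"
    unfolding summable_on_def
    by (intro exI[of _ "r / cmod z * (1 / (1 - r / cmod z))"] has_sum_neg_int) simp
  have "((\<lambda>n. contour_integral (circlepath 0 R) (\<lambda>w. f w * (z powi n * w powi (- n - 1))))
      has_sum contour_integral (circlepath 0 R) (\<lambda>w. f w * (1 / (w - z)))) {0..}"
    using r r' R by (intro part sR has_sum_cauchy_kernel_outer) auto
  moreover have "((\<lambda>n. contour_integral (circlepath 0 r) (\<lambda>w. f w * (z powi n * w powi (- n - 1))))
      has_sum contour_integral (circlepath 0 r) (\<lambda>w. f w * (- 1 / (w - z)))) {..<0}"
    using r r' R by (intro part sr has_sum_cauchy_kernel_inner) auto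
  ultimately have "((\<lambda>n. 2 * of_real pi * \<i> * (laurent_coeff f s n * z powi n))
      has_sum contour_integral (circlepath 0 R) (\<lambda>w. f w * (1 / (w - z)))
        + contour_integral (circlepath 0 r) (\<lambda>w. f w * (- 1 / (w - z)))) ({0..} \<union> {..<0})"
    using coeff r r' R by (intro has_sum_Un_disjoint) auto
  moreover have "{0..} \<union> {..<0} = (UNIV :: int set)" by auto
  moreover have "contour_integral (circlepath 0 r) (\<lambda>w. f w * (- 1 / (w - z)))
      = - contour_integral (circlepath 0 r) (\<lambda>w. f w / (w - z))"
    using contour_integral_neg[of "circlepath 0 r" "\<lambda>w. f w / (w - z)"] by simp
  ultimately have "((\<lambda>n. 2 * of_real pi * \<i> * (laurent_coeff f s n * z powi n))
      has_sum 2 * of_real pi * \<i> * f z) UNIV"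
    using cauchy_integral_formula_annulus[OF f, of r z R] r r' R by simp
  from has_sum_cmult_right[OF this, of "1 / (2 * of_real pi * \<i>)"] show ?thesis by simp
qed

section \<open>Coefficients of powers and products, and Fourier coefficients\<close>

lemma contour_integral_powi:
  assumes "0 < r"
  shows "contour_integral (circlepath 0 r) (\<lambda>w. w powi n) = (if n = - 1 then 2 * of_real pi * \<i> else 0)"
proof (cases "n = - 1")
  case True
  have "((\<lambda>w. 1 / (w - 0)) has_contour_integral (2 * of_real pi * \<i> * 1)) (circlepath 0 r)"
    using assms by (intro Cauchy_integral_circlepath) (auto intro!: continuous_intros holomorphic_intros)
  then show ?thesis
    using contour_integral_unique True by (fastforce simp: power_int_minus inverse_eq_divide)
next
  case False
  have "((\<lambda>w. w powi n) has_contour_integral 0) (circlepath 0 r)"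
  proof (rule Cauchy_theorem_primitive[of "- {0}" "\<lambda>w. w powi (n + 1) / of_int (n + 1)"])
    fix x :: complex assume "x \<in> - {0}"
    then have x: "x \<noteq> 0" by simp
    have n: "of_int (n + 1) \<noteq> (0 :: complex)" using False by (simp only: of_int_eq_0_iff)
    have "((\<lambda>w. w powi (n + 1)) has_field_derivative of_int (n + 1) * x powi (n + 1 - 1) * 1) (at x within - {0})"
      by (rule DERIV_power_int[OF DERIV_ident]) (use x in simp)
    from DERIV_cdivide[OF this, of "of_int (n + 1)"]
    show "((\<lambda>w. w powi (n + 1) / of_int (n + 1)) has_field_derivative x powi n) (at x within - {0})"
      using n by (simp del: of_int_add)
  qed (use assms in auto)
  then show ?thesis using contour_integral_unique False by fastforce
qed

text \<open>Only \<open>f\<close> is expanded; \<open>g\<close> stays under the integral, so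
  continuity on the circle is all that is asked of it.\<close>

lemma laurent_coeff_mult:
  assumes f: "f holomorphic_on open_annulus r1 r2" and g: "continuous_on (sphere 0 r) g"
    and r: "0 \<le> r1" "r1 < r" "r < r2"
  shows "((\<lambda>k. laurent_coeff f r k * laurent_coeff g r (n - k)) has_sum
            laurent_coeff (\<lambda>z. f z * g z) r n) UNIV"
proof -
  have r0: "0 < r" using r by simp
  obtain M where M: "\<And>w. cmod w = r \<Longrightarrow> cmod (g w) \<le> M" "0 < M"
    using continuous_on_sphere_bound[OF g] by auto
  have sm: "(\<lambda>k. cmod (laurent_coeff f r k) * r powi k) summable_on UNIV"
    using laurent_coeff_summable[OF f, of r r r] r by simp
  have "((\<lambda>k. contour_integral (circlepath 0 r)
        (\<lambda>z. laurent_coeff f r k * (g z * z powi (- (n - k) - 1)))) has_sum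
      contour_integral (circlepath 0 r) (\<lambda>z. f z * g z * z powi (- n - 1))) UNIV"
  proof (rule has_sum_contour_integral_circlepath[OF r0])
    show "continuous_on (sphere 0 r) (\<lambda>z. laurent_coeff f r k * (g z * z powi (- (n - k) - 1)))" for k
      using r0 by (intro continuous_intros g) auto
    show "(\<lambda>k. M * r powi (- n - 1) * (cmod (laurent_coeff f r k) * r powi k)) summable_on UNIV"
      by (intro summable_on_cmult_right sm)
    show "norm (laurent_coeff f r k * (g z * z powi (- (n - k) - 1)))
        \<le> M * r powi (- n - 1) * (cmod (laurent_coeff f r k) * r powi k)" if "z \<in> sphere 0 r" for k z
    proof -
      have "r powi (- (n - k) - 1) = r powi ((- n - 1) + k)" by (rule arg_cong[where f = "\<lambda>j. r powi j"]) simp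
      also have "\<dots> = r powi (- n - 1) * r powi k" using r0 by (intro power_int_add) auto
      finally have e: "cmod z powi (- (n - k) - 1) = r powi (- n - 1) * r powi k" using that by simp
      have "norm (laurent_coeff f r k * (g z * z powi (- (n - k) - 1)))
          = cmod (g z) * (r powi (- n - 1) * (cmod (laurent_coeff f r k) * r powi k))"
        unfolding norm_mult norm_power_int e by (simp only: mult_ac)
      also have "\<dots> \<le> M * (r powi (- n - 1) * (cmod (laurent_coeff f r k) * r powi k))"
        using that M r0 by (intro mult_right_mono) auto
      finally show ?thesis by simp
    qed
    show "((\<lambda>k. laurent_coeff f r k * (g z * z powi (- (n - k) - 1))) has_sum
        f z * g z * z powi (- n - 1)) UNIV" if "z \<in> sphere 0 r" for z
    proof -
      have z: "cmod z = r" "z \<noteq> 0" using that r0 by auto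
      have "((\<lambda>k. laurent_coeff f r k * z powi k * (g z * z powi (- n - 1))) has_sum
          f z * (g z * z powi (- n - 1))) UNIV"
        using z r by (intro has_sum_cmult_left laurent_series[OF f]) (auto simp: open_annulus_def)
      moreover have "z powi k * z powi (- n - 1) = z powi (- (n - k) - 1)" for k
      proof -
        have "z powi (- (n - k) - 1) = z powi (k + (- n - 1))" by (rule arg_cong[where f = "\<lambda>j. z powi j"]) simp
        also have "\<dots> = z powi k * z powi (- n - 1)" using z by (intro power_int_add) auto
        finally show ?thesis by simp
      qed
      then have "laurent_coeff f r k * z powi k * (g z * z powi (- n - 1))
          = laurent_coeff f r k * (g z * z powi (- (n - k) - 1))" for k
        by (simp only: mult_ac flip: \<open>\<And>k. z powi k * z powi (- n - 1) = z powi (- (n - k) - 1)\<close>)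
      ultimately show ?thesis by (simp only: mult.assoc)
    qed
  qed
  moreover have "contour_integral (circlepath 0 r)
      (\<lambda>z. laurent_coeff f r k * (g z * z powi (- (n - k) - 1)))
      = 2 * of_real pi * \<i> * (laurent_coeff f r k * laurent_coeff g r (n - k))" for k
  proof -
    have "(\<lambda>z. g z * z powi (- (n - k) - 1)) contour_integrable_on circlepath 0 r"
      using r0 by (intro contour_integrable_continuous_circlepath continuous_intros)
        (auto intro: continuous_on_subset[OF g])
    from contour_integral_lmul[OF this, of "laurent_coeff f r k"] show ?thesis
      unfolding laurent_coeff_def[of g] by simp
  qed
  ultimately have "((\<lambda>k. 2 * of_real pi * \<i> * (laurent_coeff f r k * laurent_coeff g r (n - k)))
      has_sum 2 * of_real pi * \<i> * laurent_coeff (\<lambda>z. f z * g z) r n) UNIV"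
    by (simp add: laurent_coeff_def[of "\<lambda>z. f z * g z"])
  from has_sum_cmult_right[OF this, of "1 / (2 * of_real pi * \<i>)"] show ?thesis by simp
qed

lemma laurent_coeff_const:
  assumes "0 < r"
  shows "laurent_coeff (\<lambda>_. c) r n = (if n = 0 then c else 0)"
proof -
  have "(\<lambda>w. w powi (- n - 1)) contour_integrable_on circlepath 0 r"
    using assms by (intro contour_integrable_continuous_circlepath continuous_intros) auto
  from contour_integral_lmul[OF this, of c] contour_integral_powi[OF assms, of "- n - 1"]
  show ?thesis by (simp add: laurent_coeff_def)
qed

text \<open>Substituting w = exp (2 pi i x) gives dw = 2 pi i w dx, and this factor w cancels the
  extra - 1 in the exponent.\<close>

lemma fourier_coeff_eq_laurent_coeff:
  "fourier_coeff V n = laurent_coeff V 1 n"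
proof -
  have "contour_integral (circlepath 0 1) (\<lambda>w. V w * w powi (- n - 1))
      = integral {0..1} (\<lambda>x. 2 * of_real pi * \<i> * (V (cis (2 * pi * x)) * cis (- 2 * pi * real_of_int n * x)))"
    unfolding contour_integral_integral
  proof (rule integral_cong)
    fix x :: real
    have c: "circlepath 0 1 x = cis (2 * pi * x)"
      by (simp add: circlepath cis_conv_exp mult_ac)
    have "cis (2 * pi * x) powi (- n - 1) * cis (2 * pi * x) = cis (2 * pi * x) powi (- n)"
      by (simp add: power_int_diff)
    also have "\<dots> = cis (- 2 * pi * real_of_int n * x)"
      by (simp add: cis_power_int mult_ac)
    finally have e: "cis (2 * pi * x) powi (- n - 1) * cis (2 * pi * x) = cis (- 2 * pi * real_of_int n * x)" .
    show "V (circlepath 0 1 x) * circlepath 0 1 x powi (- n - 1) * vector_derivative (circlepath 0 1) (at x)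
        = 2 * of_real pi * \<i> * (V (cis (2 * pi * x)) * cis (- 2 * pi * real_of_int n * x))"
      unfolding c vector_derivative_circlepath e[symmetric]
      by (simp add: cis_conv_exp mult_ac)
  qed
  then show ?thesis
    unfolding laurent_coeff_def fourier_coeff_def by simp
qed

section \<open>Convolution operators and their perturbations on weighted sequence spaces\<close>

definition wbdd :: "(int \<Rightarrow> real) \<Rightarrow> real \<Rightarrow> (int \<Rightarrow> complex) \<Rightarrow> bool" where
  "wbdd w B y \<longleftrightarrow> (\<forall>n. cmod (y n) \<le> B * w n)"

text \<open>\<open>M k\<close> bounds the norm of the shift by \<open>k\<close> on sequences
  weighted by \<open>w\<close>, so that \<open>conv a\<close> has norm at most the sum of |a k| M
  k.\<close>

definition moderate :: "(int \<Rightarrow> real) \<Rightarrow> (int \<Rightarrow> real) \<Rightarrow> bool" where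
  "moderate M w \<longleftrightarrow> (\<forall>n. 0 < w n) \<and> (\<forall>n k. w (n + k) \<le> M k * w n)"

text \<open>A correlation in sign: on y n = z powi n it multiplies by the symbol, the sum of a k * z
  powi k, and composition multiplies symbols.\<close>

definition conv :: "(int \<Rightarrow> complex) \<Rightarrow> (int \<Rightarrow> complex) \<Rightarrow> int \<Rightarrow> complex" where
  "conv a y n = (\<Sum>\<^sub>\<infinity>k. a k * y (n + k))"

text \<open>Operators are total functions on all sequences. Linearity and the bound are required
  only on sequences of finite weighted norm; elsewhere an infinite sum may take its default
  value.\<close>

definition bounded_op ::
  "(int \<Rightarrow> real) \<Rightarrow> real \<Rightarrow> ((int \<Rightarrow> complex) \<Rightarrow> int \<Rightarrow> complex) \<Rightarrow> bool" where
  "bounded_op w K R \<longleftrightarrow> 0 \<le> K \<and>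
     (\<forall>f B. wbdd w B f \<longrightarrow> wbdd w (K * B) (R f)) \<and>
     (\<forall>f g B B'. wbdd w B f \<longrightarrow> wbdd w B' g \<longrightarrow> R (\<lambda>n. f n + g n) = (\<lambda>n. R f n + R g n)) \<and>
     (\<forall>c f B. wbdd w B f \<longrightarrow> R (\<lambda>n. c * f n) = (\<lambda>n. c * R f n))"

section \<open>Weighted bounds and bounded operators\<close>

lemma wbddD: "wbdd w B y \<Longrightarrow> cmod (y n) \<le> B * w n"
  by (simp add: wbdd_def)

lemma moderate_pos: "moderate M w \<Longrightarrow> 0 < w n"
  by (simp add: moderate_def)

lemma moderate_le: "moderate M w \<Longrightarrow> w (n + k) \<le> M k * w n"
  by (simp add: moderate_def)

lemma moderate_multiplier_pos:
  assumes "moderate M w"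
  shows "0 < M k"
proof -
  have "0 < w (0 + k)" "0 < w 0" using assms by (auto simp: moderate_def)
  moreover have "w (0 + k) \<le> M k * w 0" using assms by (rule moderate_le)
  ultimately show ?thesis by (smt (verit) mult_nonpos_nonneg)
qed

lemma wbdd_nonneg:
  assumes "0 < w n" "wbdd w B y"
  shows "0 \<le> B"
proof -
  have "0 \<le> B * w n" using wbddD[OF assms(2), of n] norm_ge_zero order_trans by blast
  then show ?thesis using assms(1) by (simp add: zero_le_mult_iff)
qed

lemma wbdd_add: "wbdd w B f \<Longrightarrow> wbdd w B' g \<Longrightarrow> wbdd w (B + B') (\<lambda>n. f n + g n)"
  unfolding wbdd_def by (auto simp: algebra_simps intro: order_trans[OF norm_triangle_ineq] add_mono)

lemma wbdd_diff: "wbdd w B f \<Longrightarrow> wbdd w B' g \<Longrightarrow> wbdd w (B + B') (\<lambda>n. f n - g n)"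
  unfolding wbdd_def by (auto simp: algebra_simps intro: order_trans[OF norm_triangle_ineq4] add_mono)

lemma wbdd_mult:
  assumes "\<And>n. cmod (b n) \<le> \<beta>" "0 \<le> \<beta>" "wbdd w B f"
  shows "wbdd w (\<beta> * B) (\<lambda>n. b n * f n)"
  unfolding wbdd_def
proof
  fix n
  have "cmod (b n * f n) \<le> \<beta> * (B * w n)"
    unfolding norm_mult by (intro mult_mono assms wbddD) auto
  then show "cmod (b n * f n) \<le> \<beta> * B * w n" by (simp add: mult.assoc)
qed

lemma wbdd_cmult: "wbdd w B f \<Longrightarrow> wbdd w (cmod c * B) (\<lambda>n. c * f n)"
  by (rule wbdd_mult) auto

lemma wbdd_mono:
  assumes "wbdd w B f" "B \<le> B'" "\<And>n. 0 \<le> w n"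
  shows "wbdd w B' f"
  unfolding wbdd_def
  using assms by (meson mult_right_mono order_trans wbddD)

lemma wbdd_zero: "(\<And>n. 0 \<le> w n) \<Longrightarrow> 0 \<le> B \<Longrightarrow> wbdd w B (\<lambda>_. 0)"
  by (simp add: wbdd_def)

lemma wbdd_sum:
  assumes "\<And>i. i \<in> I \<Longrightarrow> wbdd w (B i) (f i)"
  shows "wbdd w (\<Sum>i\<in>I. B i) (\<lambda>n. \<Sum>i\<in>I. f i n)"
  unfolding wbdd_def sum_distrib_right
  using assms by (auto intro!: sum_norm_le wbddD)

lemma wbdd_weight_mono:
  assumes "wbdd w B f" "0 \<le> B" "\<And>n. w n \<le> w' n"
  shows "wbdd w' B f"
  unfolding wbdd_def using assms by (meson mult_left_mono order_trans wbddD)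

lemma bounded_opD:
  assumes "bounded_op w K R"
  shows "0 \<le> K"
    and "wbdd w B f \<Longrightarrow> wbdd w (K * B) (R f)"
    and "wbdd w B f \<Longrightarrow> wbdd w B' g \<Longrightarrow> R (\<lambda>n. f n + g n) = (\<lambda>n. R f n + R g n)"
    and "wbdd w B f \<Longrightarrow> R (\<lambda>n. c * f n) = (\<lambda>n. c * R f n)"
  using assms unfolding bounded_op_def by blast+

lemma bounded_op_diff:
  assumes "bounded_op w K R" "wbdd w B f" "wbdd w B' g"
  shows "R (\<lambda>n. f n - g n) = (\<lambda>n. R f n - R g n)"
proof -
  have "R (\<lambda>n. f n + (- 1) * g n) = (\<lambda>n. R f n + R (\<lambda>n. (- 1) * g n) n)"
    by (rule bounded_opD(3)[OF assms(1,2) wbdd_cmult[OF assms(3)]])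
  also have "R (\<lambda>n. (- 1) * g n) = (\<lambda>n. (- 1) * R g n)"
    by (rule bounded_opD(4)[OF assms(1,3)])
  finally show ?thesis by simp
qed

lemma bounded_op_zero:
  assumes "bounded_op w K R" "\<And>n. 0 \<le> w n"
  shows "R (\<lambda>_. 0) = (\<lambda>_. 0)"
  using bounded_opD(4)[OF assms(1) wbdd_zero[of w 0], of 0] assms(2) by simp

lemma bounded_op_sum:
  assumes R: "bounded_op w K R" and w: "\<And>n. 0 \<le> w n"
    and f: "\<And>i. i \<in> I \<Longrightarrow> wbdd w (B i) (f i)"
  shows "R (\<lambda>n. \<Sum>i\<in>I. f i n) = (\<lambda>n. \<Sum>i\<in>I. R (f i) n)"
  using f
proof (induction I rule: infinite_finite_induct)
  case (insert i I)
  have "R (\<lambda>n. f i n + (\<Sum>i\<in>I. f i n)) = (\<lambda>n. R (f i) n + R (\<lambda>n. \<Sum>i\<in>I. f i n) n)"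
    by (rule bounded_opD(3)[OF R]) (use insert in \<open>auto intro!: wbdd_sum\<close>)
  with insert show ?case by simp
qed (use bounded_op_zero[OF R w] in auto)

lemma bounded_op_comp:
  assumes "bounded_op w K R" "bounded_op w K' R'"
  shows "bounded_op w (K * K') (\<lambda>f. R (R' f))"
  unfolding bounded_op_def
proof (intro conjI allI impI)
  show "0 \<le> K * K'" using assms[THEN bounded_opD(1)] by simp
  show "wbdd w (K * K' * B) (R (R' f))" if "wbdd w B f" for f B
    using bounded_opD(2)[OF assms(1) bounded_opD(2)[OF assms(2) that]] by (simp add: mult.assoc)
  show "R (R' (\<lambda>n. f n + g n)) = (\<lambda>n. R (R' f) n + R (R' g) n)"
    if "wbdd w B f" "wbdd w B' g" for f g B B'
    unfolding bounded_opD(3)[OF assms(2) that]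
    by (rule bounded_opD(3)[OF assms(1) bounded_opD(2)[OF assms(2) that(1)] bounded_opD(2)[OF assms(2) that(2)]])
  show "R (R' (\<lambda>n. c * f n)) = (\<lambda>n. c * R (R' f) n)" if "wbdd w B f" for c f B
    unfolding bounded_opD(4)[OF assms(2) that]
    by (rule bounded_opD(4)[OF assms(1) bounded_opD(2)[OF assms(2) that]])
qed

text \<open>Feeding a bound for \<open>y\<close> back into the equation improves it by the factor K
  * \<beta> < 1, so the bound tends to 0.\<close>

lemma perturbed_op_unique:
  assumes R: "bounded_op w K R" and w: "\<And>n. 0 \<le> w n"
    and b: "\<And>n. cmod (b n) \<le> \<beta>" "0 \<le> \<beta>" "K * \<beta> < 1"
    and y: "wbdd w B y" "y = R (\<lambda>n. b n * y n)"
  shows "y = (\<lambda>_. 0)"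
proof
  fix n
  have K: "0 \<le> K" using R by (rule bounded_opD)
  have "wbdd w ((K * \<beta>) ^ j * B) y" for j
  proof (induction j)
    case (Suc j)
    have "wbdd w (K * (\<beta> * ((K * \<beta>) ^ j * B))) (R (\<lambda>n. b n * y n))"
      by (intro bounded_opD(2)[OF R] wbdd_mult b Suc)
    then show ?case using y(2) by (simp add: mult_ac)
  qed (use y in simp)
  then have "cmod (y n) \<le> (K * \<beta>) ^ j * B * w n" for j by (rule wbddD)
  moreover have "(\<lambda>j. (K * \<beta>) ^ j * B * w n) \<longlonglongrightarrow> 0 * B * w n"
    using K b by (intro tendsto_intros LIMSEQ_power_zero) simp
  ultimately have "cmod (y n) \<le> 0"
    by (intro LIMSEQ_le_const[of "\<lambda>j. (K * \<beta>) ^ j * B * w n"]) auto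
  then show "y n = 0" by simp
qed

text \<open>\<open>P\<close> is a kind of regular dependence on a parameter: bounded analyticity on
  the torus strip, continuity on a circle, or the trivial property when a single sequence is
  treated. The two limit axioms serve unconditional sums over the integers and Neumann series.
  Limits are uniform on \<open>X\<close> only, so \<open>P\<close> cannot see values outside
  \<open>X\<close>.\<close>

locale uniform_algebra =
  fixes X :: "'x set" and P :: "('x \<Rightarrow> complex) \<Rightarrow> bool"
  assumes const: "P (\<lambda>_. c)"
    and add: "P f \<Longrightarrow> P g \<Longrightarrow> P (\<lambda>x. f x + g x)"
    and mult: "P f \<Longrightarrow> P g \<Longrightarrow> P (\<lambda>x. f x * g x)"
    and closed_limit: "\<And>(F :: int set filter) f. F \<noteq> bot \<Longrightarrow> (\<And>A. P (f A)) \<Longrightarrow> uniform_limit X f g F \<Longrightarrow> P g"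
    and closed_limit_seq: "\<And>f. (\<And>j::nat. P (f j)) \<Longrightarrow> uniform_limit X f g sequentially \<Longrightarrow> P g"
begin

definition family :: "(int \<Rightarrow> real) \<Rightarrow> real \<Rightarrow> ('x \<Rightarrow> int \<Rightarrow> complex) \<Rightarrow> bool" where
  "family w B f \<longleftrightarrow> (\<forall>n. P (\<lambda>x. f x n)) \<and> (\<forall>x\<in>X. wbdd w B (f x))"

definition preserves :: "(int \<Rightarrow> real) \<Rightarrow> ((int \<Rightarrow> complex) \<Rightarrow> int \<Rightarrow> complex) \<Rightarrow> bool" where
  "preserves w R \<longleftrightarrow> (\<forall>B f. family w B f \<longrightarrow> (\<forall>n. P (\<lambda>x. R (f x) n)))"

lemma sum: "(\<And>i. i \<in> I \<Longrightarrow> P (f i)) \<Longrightarrow> P (\<lambda>x. \<Sum>i\<in>I. f i x)"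
  by (induction I rule: infinite_finite_induct) (auto intro: const add)

lemma infsum:
  fixes f :: "int \<Rightarrow> 'x \<Rightarrow> complex"
  assumes "\<And>k. P (f k)" "\<And>k x. x \<in> X \<Longrightarrow> cmod (f k x) \<le> M k" "M summable_on UNIV"
  shows "P (\<lambda>x. \<Sum>\<^sub>\<infinity>k. f k x)"
proof (rule closed_limit)
  show "P (\<lambda>x. \<Sum>k\<in>A. f k x)" for A
    by (intro sum assms(1))
  show "uniform_limit X (\<lambda>A x. \<Sum>k\<in>A. f k x) (\<lambda>x. \<Sum>\<^sub>\<infinity>k. f k x) (finite_subsets_at_top UNIV)"
    by (rule Weierstrass_m_test_general[OF assms(2,3)])
qed simp

lemma cong:
  assumes "P f" "\<And>x. x \<in> X \<Longrightarrow> f x = g x"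
  shows "P g"
proof (rule closed_limit_seq)
  show "uniform_limit X (\<lambda>_::nat. f) g sequentially"
    using assms(2) by (intro uniform_limitI) auto
qed (rule assms(1))

lemma family_op:
  assumes "bounded_op w K R" "preserves w R" "family w B f"
  shows "family w (K * B) (\<lambda>x. R (f x))"
  using assms unfolding family_def preserves_def by (blast intro: bounded_opD(2))

lemma preserves_comp:
  assumes "preserves w R" "bounded_op w K R'" "preserves w R'"
  shows "preserves w (\<lambda>f. R (R' f))"
  using assms(1) family_op[OF assms(2,3)] unfolding preserves_def by blast

text \<open>Neumann series for y = R (f + b y). Relative to the weight its terms shrink by the
  factor K * \<beta>, uniformly in the parameter, so the sum inherits \<open>P\<close>.\<close>

lemma perturbed_op_solution:
  assumes R: "bounded_op w K R" "preserves w R" and w: "\<And>n. 0 \<le> w n"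
    and b: "\<And>n. P (\<lambda>x. b x n)" "\<And>x n. x \<in> X \<Longrightarrow> cmod (b x n) \<le> \<beta>" "0 \<le> \<beta>" "K * \<beta> < 1"
    and f: "family w B f" "0 \<le> B"
  shows "\<exists>y. family w (K * B / (1 - K * \<beta>)) y \<and> (\<forall>x\<in>X. y x = R (\<lambda>n. f x n + b x n * y x n))"
proof -
  define q where "q = K * \<beta>"
  have K: "0 \<le> K" using R(1) by (rule bounded_opD)
  have q: "0 \<le> q" "q < 1" using K b by (auto simp: q_def)
  define z where "z = rec_nat (\<lambda>x. R (f x)) (\<lambda>_ z x. R (\<lambda>n. b x n * z x n))"
  have z0: "z 0 = (\<lambda>x. R (f x))" and zS: "z (Suc j) = (\<lambda>x. R (\<lambda>n. b x n * z j x n))" for j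
    by (simp_all add: z_def)
  have z: "family w (q ^ j * (K * B)) (z j)" for j
  proof (induction j)
    case 0
    then show ?case using family_op[OF R f(1)] by (simp add: z0)
  next
    case (Suc j)
    have "family w (\<beta> * (q ^ j * (K * B))) (\<lambda>x n. b x n * z j x n)"
      using Suc b unfolding family_def by (auto intro!: mult wbdd_mult)
    from family_op[OF R this] show ?case by (simp add: zS q_def mult_ac)
  qed
  define y where "y = (\<lambda>x n. \<Sum>j. z j x n)"
  have zn: "cmod (z j x n) \<le> q ^ j * (K * B * w n)" if "x \<in> X" for j x n
    using z[of j] that wbddD[of w "q ^ j * (K * B)" "z j x" n] unfolding family_def by (simp add: mult.assoc)
  have sm: "summable (\<lambda>j. q ^ j * C)" for C
    using q by (intro summable_mult2 summable_geometric) simp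
  have szn: "summable (\<lambda>j. z j x n)" if "x \<in> X" for x n
    using summable_comparison_test'[OF sm zn[OF that]] .
  have tail: "cmod (y x n - (\<Sum>j<J. z j x n)) \<le> q ^ J * (K * B / (1 - q)) * w n" if x: "x \<in> X" for x n J
  proof -
    have "y x n - (\<Sum>j<J. z j x n) = (\<Sum>j. z (j + J) x n)"
      unfolding y_def using suminf_minus_initial_segment[OF szn[OF x]] by simp
    also have "cmod \<dots> \<le> (\<Sum>j. q ^ j * (q ^ J * (K * B * w n)))"
    proof (rule norm_suminf_le[OF _ sm])
      show "cmod (z (j + J) x n) \<le> q ^ j * (q ^ J * (K * B * w n))" for j
        using zn[OF x, of "j + J" n] by (simp add: power_add mult_ac)
    qed
    also have "\<dots> = 1 / (1 - q) * (q ^ J * (K * B * w n))"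
      using q suminf_mult2[OF summable_geometric[of q], of "q ^ J * (K * B * w n)"]
      by (simp add: suminf_geometric)
    finally show ?thesis by (simp add: mult_ac)
  qed
  have yb: "wbdd w (K * B / (1 - q)) (y x)" if x: "x \<in> X" for x
    using tail[OF x, of _ 0] by (simp add: wbdd_def)
  have yP: "P (\<lambda>x. y x n)" for n
  proof (rule closed_limit_seq)
    show "P (\<lambda>x. \<Sum>j<J. z j x n)" for J
      using z by (intro sum) (auto simp: family_def)
    show "uniform_limit X (\<lambda>J x. \<Sum>j<J. z j x n) (\<lambda>x. y x n) sequentially"
      unfolding y_def by (rule Weierstrass_m_test[OF zn sm])
  qed
  \<comment> \<open>Linearity of \<open>R\<close> covers finite sums only, so the equation is tested
    on a partial sum. The defect is a tail of the series and \<open>R\<close> applied to a tail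
    times \<open>b\<close>, both O(q ^ J).\<close>
  have "y x = R (\<lambda>n. f x n + b x n * y x n)" if x: "x \<in> X" for x
  proof
    fix n
    have zb: "wbdd w (q ^ j * (K * B)) (z j x)" for j using z[of j] x by (simp add: family_def)
    have fb: "wbdd w B (f x)" using f x by (simp add: family_def)
    have bzb: "wbdd w (\<beta> * (q ^ j * (K * B))) (\<lambda>n. b x n * z j x n)" for j
      using b x by (intro wbdd_mult zb) auto
    have "cmod (y x n - R (\<lambda>n. f x n + b x n * y x n) n)
        \<le> q ^ J * ((q + K * \<beta>) * (K * B / (1 - q)) * w n)" for J
    proof -
      define t where "t = (\<lambda>n. y x n - (\<Sum>j<J. z j x n))"
      have t: "wbdd w (q ^ J * (K * B / (1 - q))) t"
        using tail[OF x] by (simp add: t_def wbdd_def)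
      have sb: "wbdd w (\<Sum>j<J. \<beta> * (q ^ j * (K * B))) (\<lambda>n. \<Sum>j<J. b x n * z j x n)"
        by (intro wbdd_sum bzb)
      have bt: "wbdd w (\<beta> * (q ^ J * (K * B / (1 - q)))) (\<lambda>n. b x n * t n)"
        using b x t by (intro wbdd_mult) auto
      have e0: "(\<lambda>n. f x n + b x n * y x n) = (\<lambda>n. f x n + ((\<Sum>j<J. b x n * z j x n) + b x n * t n))"
        by (simp add: t_def algebra_simps sum_distrib_left)
      have e1: "R (\<lambda>n. f x n + ((\<Sum>j<J. b x n * z j x n) + b x n * t n)) = (\<lambda>n. R (f x) n + R (\<lambda>n. (\<Sum>j<J. b x n * z j x n) + b x n * t n) n)"
        by (rule bounded_opD(3)[OF R(1) fb wbdd_add[OF sb bt]])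
      have e2: "R (\<lambda>n. (\<Sum>j<J. b x n * z j x n) + b x n * t n)
          = (\<lambda>n. R (\<lambda>n. (\<Sum>j<J. b x n * z j x n)) n + R (\<lambda>n. b x n * t n) n)"
        by (rule bounded_opD(3)[OF R(1) sb bt])
      have e3: "R (\<lambda>n. (\<Sum>j<J. b x n * z j x n)) = (\<lambda>n. \<Sum>j<J. z (Suc j) x n)"
        unfolding zS by (rule bounded_op_sum[OF R(1) w bzb])
      have "R (\<lambda>n. f x n + b x n * y x n) n = (\<Sum>j<Suc J. z j x n) + R (\<lambda>n. b x n * t n) n"
        unfolding e0 e1 e2 e3 sum.lessThan_Suc_shift z0 by (simp only: add.assoc)
      then have "cmod (y x n - R (\<lambda>n. f x n + b x n * y x n) n)
          = cmod ((y x n - (\<Sum>j<Suc J. z j x n)) - R (\<lambda>n. b x n * t n) n)"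
        by (simp only: diff_diff_eq)
      also have "\<dots> \<le> q ^ Suc J * (K * B / (1 - q)) * w n + K * (\<beta> * (q ^ J * (K * B / (1 - q)))) * w n"
        by (intro order_trans[OF norm_triangle_ineq4] add_mono tail x wbddD[OF bounded_opD(2)[OF R(1) bt]])
      also have "\<dots> = q ^ J * ((q + K * \<beta>) * (K * B / (1 - q)) * w n)"
        by (simp add: distrib_left distrib_right add_divide_distrib mult_ac)
      finally show ?thesis .
    qed
    moreover have "(\<lambda>J. q ^ J * ((q + K * \<beta>) * (K * B / (1 - q)) * w n)) \<longlonglongrightarrow> 0 * ((q + K * \<beta>) * (K * B / (1 - q)) * w n)"
      using q by (intro tendsto_intros LIMSEQ_power_zero) simp
    ultimately have "cmod (y x n - R (\<lambda>n. f x n + b x n * y x n) n) \<le> 0"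
      by (intro LIMSEQ_le_const[of "\<lambda>J. q ^ J * ((q + K * \<beta>) * (K * B / (1 - q)) * w n)"]) auto
    then show "y x n = R (\<lambda>n. f x n + b x n * y x n) n" by simp
  qed
  then show ?thesis
    using yb yP unfolding family_def q_def by blast
qed

end

section \<open>Convolutions as bounded operators\<close>

lemma conv_term_bound:
  assumes w: "moderate M w" and y: "wbdd w B y"
  shows "cmod (a k * y (n + k)) \<le> B * w n * (cmod (a k) * M k)"
proof -
  have B: "0 \<le> B" using wbdd_nonneg[OF moderate_pos[OF w, of 0] y] .
  have "cmod (y (n + k)) \<le> B * (M k * w n)"
    using wbddD[OF y, of "n + k"] mult_left_mono[OF moderate_le[OF w, of n k] B] by simp
  from mult_left_mono[OF this, of "cmod (a k)"] show ?thesis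
    by (simp add: norm_mult mult_ac)
qed

lemma conv_abs_summable:
  assumes w: "moderate M w" and a: "(\<lambda>k. cmod (a k) * M k) summable_on UNIV" and y: "wbdd w B y"
  shows "Infinite_Sum.abs_summable_on (\<lambda>k. a k * y (n + k)) UNIV"
  using summable_on_cmult_right[OF a, of "B * w n"]
  by (rule summable_on_comparison_test) (use conv_term_bound[OF w y] in auto)

lemma conv_has_sum:
  assumes w: "moderate M w" and a: "(\<lambda>k. cmod (a k) * M k) summable_on UNIV" and y: "wbdd w B y"
  shows "((\<lambda>k. a k * y (n + k)) has_sum conv a y n) UNIV"
  unfolding conv_def by (rule has_sum_infsum[OF abs_summable_summable[OF conv_abs_summable[OF assms]]])

lemma conv_bounded_op:
  assumes w: "moderate M w" and a: "(\<lambda>k. cmod (a k) * M k) summable_on UNIV"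
  shows "bounded_op w (\<Sum>\<^sub>\<infinity>k. cmod (a k) * M k) (conv a)"
  unfolding bounded_op_def
proof (intro conjI allI impI)
  show "0 \<le> (\<Sum>\<^sub>\<infinity>k. cmod (a k) * M k)"
    using moderate_multiplier_pos[OF w] by (intro infsum_nonneg) (simp add: less_imp_le)
next
  fix f B assume f: "wbdd w B f"
  have "cmod (conv a f n) \<le> (\<Sum>\<^sub>\<infinity>k. B * w n * (cmod (a k) * M k))" for n
    unfolding conv_def
    by (rule order_trans[OF norm_infsum_bound[OF conv_abs_summable[OF w a f]]])
      (intro infsum_mono conv_abs_summable[OF w a f] summable_on_cmult_right a conv_term_bound[OF w f])
  then show "wbdd w ((\<Sum>\<^sub>\<infinity>k. cmod (a k) * M k) * B) (conv a f)"
    unfolding wbdd_def infsum_cmult_right' by (simp add: mult_ac)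
next
  fix f g B B' assume "wbdd w B f" "wbdd w B' g"
  then show "conv a (\<lambda>n. f n + g n) = (\<lambda>n. conv a f n + conv a g n)"
    unfolding conv_def distrib_left
    by (intro ext infsum_add) (rule abs_summable_summable, erule conv_abs_summable[OF w a])+
next
  fix c f B assume "wbdd w B f"
  show "conv a (\<lambda>n. c * f n) = (\<lambda>n. c * conv a f n)"
    unfolding conv_def mult.left_commute[of "a _"] by (simp add: infsum_cmult_right')
qed

lemma (in uniform_algebra) conv_preserves:
  assumes w: "moderate M w" and a: "(\<lambda>k. cmod (a k) * M k) summable_on UNIV"
  shows "preserves w (conv a)"
  unfolding preserves_def conv_def
proof (intro allI impI)
  fix B f n assume f: "family w B f"
  show "P (\<lambda>x. \<Sum>\<^sub>\<infinity>k. a k * f x (n + k))"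
  proof (rule infsum)
    show "P (\<lambda>x. a k * f x (n + k))" for k
      using f unfolding family_def by (intro mult const) auto
    show "cmod (a k * f x (n + k)) \<le> B * w n * (cmod (a k) * M k)" if "x \<in> X" for k x
      using f that unfolding family_def by (intro conv_term_bound[OF w]) auto
  qed (intro summable_on_cmult_right a)
qed

text \<open>Fubini after the substitution m = j + k; the double series is absolutely summable
  because the shift bound \<open>M\<close> may be used twice, once for \<open>j\<close> and once for
  \<open>k\<close>.\<close>

lemma conv_conv:
  assumes w: "moderate M w" and a: "(\<lambda>k. cmod (a k) * M k) summable_on UNIV"
    and b: "(\<lambda>k. cmod (b k) * M k) summable_on UNIV" and y: "wbdd w B y"
    and c: "\<And>m. ((\<lambda>j. b j * a (m - j)) has_sum c m) UNIV"
  shows "conv b (conv a y) = conv c y"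
proof
  fix n
  define F where "F = (\<lambda>(j, k). b j * (a k * y (n + j + k)))"
  have M: "0 < M k" for k using moderate_multiplier_pos[OF w] .
  have "(\<lambda>(j, k). (cmod (b j) * M j) * (cmod (a k) * M k)) summable_on UNIV \<times> UNIV"
  proof (rule summable_on_SigmaI)
    show "((\<lambda>k. (\<lambda>(j, k). (cmod (b j) * M j) * (cmod (a k) * M k)) (j, k)) has_sum
        cmod (b j) * M j * (\<Sum>\<^sub>\<infinity>k. cmod (a k) * M k)) UNIV" for j
      using has_sum_cmult_right[OF has_sum_infsum[OF a]] by simp
    show "(\<lambda>j. cmod (b j) * M j * (\<Sum>\<^sub>\<infinity>k. cmod (a k) * M k)) summable_on UNIV"
      by (intro summable_on_cmult_left b)
  qed (use M in \<open>auto intro!: mult_nonneg_nonneg simp: less_imp_le\<close>)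
  then have "(\<lambda>p. B * w n * ((\<lambda>(j, k). (cmod (b j) * M j) * (cmod (a k) * M k)) p)) summable_on UNIV \<times> UNIV"
    by (rule summable_on_cmult_right)
  then have F: "Infinite_Sum.abs_summable_on F (UNIV \<times> UNIV)"
  proof (rule summable_on_comparison_test)
    fix p :: "int \<times> int"
    obtain j k where p: "p = (j, k)" by fastforce
    have "cmod (a k * y (n + j + k)) \<le> B * w (n + j) * (cmod (a k) * M k)"
      by (rule conv_term_bound[OF w y])
    also have "\<dots> \<le> B * (M j * w n) * (cmod (a k) * M k)"
      using wbdd_nonneg[OF moderate_pos[OF w, of 0] y] M[of k]
      by (intro mult_right_mono mult_left_mono moderate_le[OF w]) auto
    finally show "norm (F p) \<le> B * w n * ((\<lambda>(j, k). (cmod (b j) * M j) * (cmod (a k) * M k)) p)"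
      using mult_left_mono[of _ _ "cmod (b j)"] by (fastforce simp: F_def p norm_mult mult_ac)
  qed auto
  define G where "G = (\<lambda>(j, m). b j * a (m - j) * y (n + m))"
  have bij: "bij_betw (\<lambda>(j, m). (j, m - j)) (UNIV \<times> UNIV) (UNIV \<times> UNIV :: (int \<times> int) set)"
    by (rule bij_betwI[where g = "\<lambda>(j, k). (j, j + k)"]) auto
  have GF: "G p = F ((\<lambda>(j, m). (j, m - j)) p)" for p
    by (auto simp: F_def G_def split: prod.split)
  have G: "Infinite_Sum.abs_summable_on G (UNIV \<times> UNIV)"
    unfolding GF by (subst summable_on_reindex_bij_betw[OF bij, of "\<lambda>p. norm (F p)"]) (rule F)
  have "conv b (conv a y) n = (\<Sum>\<^sub>\<infinity>j. \<Sum>\<^sub>\<infinity>k. F (j, k))"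
    by (simp add: conv_def F_def infsum_cmult_right' add.assoc)
  also have "\<dots> = infsum F (UNIV \<times> UNIV)"
    using infsum_Sigma'_banach[of "\<lambda>j k. F (j, k)" UNIV "\<lambda>_. UNIV"] abs_summable_summable[OF F] by simp
  also have "\<dots> = infsum G (UNIV \<times> UNIV)"
    unfolding GF by (rule infsum_reindex_bij_betw[OF bij, symmetric])
  also have "\<dots> = (\<Sum>\<^sub>\<infinity>j. \<Sum>\<^sub>\<infinity>m. G (j, m))"
    using infsum_Sigma'_banach[of "\<lambda>j k. G (j, k)" UNIV "\<lambda>_. UNIV"] abs_summable_summable[OF G] by simp
  also have "\<dots> = (\<Sum>\<^sub>\<infinity>m. \<Sum>\<^sub>\<infinity>j. G (j, m))"
    using infsum_swap_banach[of "\<lambda>j m. G (j, m)" UNIV UNIV] abs_summable_summable[OF G] by simp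
  also have "\<dots> = conv c y n"
    unfolding conv_def G_def using infsumI[OF c] by (simp add: infsum_cmult_left')
  finally show "conv b (conv a y) n = conv c y n" .
qed

lemma conv_delta: "conv (\<lambda>n. if n = 0 then 1 else 0) y = y"
proof
  fix n
  have "((\<lambda>k. (if k = 0 then 1 else 0) * y (n + k)) has_sum y n) UNIV"
    by (rule has_sum_finite_neutralI[of "{0}"]) auto
  then show "conv (\<lambda>n. if n = 0 then 1 else 0) y n = y n"
    unfolding conv_def by (simp add: infsumI)
qed

section \<open>Division with remainder by the zeros on the unit circle\<close>

definition delta :: "int \<Rightarrow> int \<Rightarrow> complex" where
  "delta a n = (if n = a then 1 else 0)"

text \<open>For rm < 1 < rp this weight grows in both directions, while \<open>wmin\<close> decays
  in both. It also serves as the shift bound \<open>M\<close> for both of them.\<close>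

definition wmax :: "real \<Rightarrow> real \<Rightarrow> int \<Rightarrow> real" where
  "wmax rm rp n = max (rp powi n) (rm powi n)"

definition wmin :: "real \<Rightarrow> real \<Rightarrow> int \<Rightarrow> real" where
  "wmin rm rp n = min (rp powi n) (rm powi n)"

definition sdiff :: "complex \<Rightarrow> (int \<Rightarrow> complex) \<Rightarrow> int \<Rightarrow> complex" where
  "sdiff \<zeta> y n = y (n + 1) - \<zeta> * y n"

text \<open>The Laurent coefficients of 1 / (z - \<zeta>) for |z| < |\<zeta>|;
  \<open>root_inv_outer\<close> has those for |z| > |\<zeta>|. They invert the symbol z - \<zeta> of
  \<open>sdiff \<zeta>\<close>.\<close>

definition root_inv_inner :: "complex \<Rightarrow> int \<Rightarrow> complex" where
  "root_inv_inner \<zeta> k = (if 0 \<le> k then - (\<zeta> powi (- k - 1)) else 0)"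

definition root_inv_outer :: "complex \<Rightarrow> int \<Rightarrow> complex" where
  "root_inv_outer \<zeta> k = (if k < 0 then \<zeta> powi (- k - 1) else 0)"

text \<open>\<open>root_quot \<zeta> f\<close> solves \<open>y (n + 1) - \<zeta> * y n = f n\<close> by summing \<open>f\<close> from the end that \<open>n\<close> lies on; the mismatch
  between the two sums at \<open>0\<close> is \<open>root_eval \<zeta> f\<close>, the value of \<open>\<Sum>n. f n * z powi (- n - 1)\<close> at \<open>z = \<zeta>\<close>.\<close>

definition root_quot :: "complex \<Rightarrow> (int \<Rightarrow> complex) \<Rightarrow> int \<Rightarrow> complex" where
  "root_quot \<zeta> f n = (if 0 \<le> n then conv (root_inv_inner \<zeta>) f n else conv (root_inv_outer \<zeta>) f n)"

definition root_eval :: "complex \<Rightarrow> (int \<Rightarrow> complex) \<Rightarrow> complex" where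
  "root_eval \<zeta> f = conv (root_inv_outer \<zeta>) f 0 - conv (root_inv_inner \<zeta>) f 0"

text \<open>Read f as the series of f n * z powi (- n - 1). Then \<open>sdiff \<zeta>\<close> is
  multiplication by z - \<zeta>, \<open>delta (- 1 - int p)\<close> is z ^ p, and this function
  gives the coefficients of the remainder on division by the product of all z - \<zeta>. The head
  root contributes the value of the quotient at \<zeta> times the product over the tail, whose
  coefficients are read off from \<open>foldr sdiff \<zeta>s (delta (- 1))\<close>.\<close>

fun remainder :: "complex list \<Rightarrow> (int \<Rightarrow> complex) \<Rightarrow> nat \<Rightarrow> complex" where
  "remainder [] f p = 0"
| "remainder (\<zeta> # \<zeta>s) f p =
     (if p < length \<zeta>s then remainder \<zeta>s f p else 0)
       + root_eval \<zeta> (foldr root_quot \<zeta>s f) * foldr sdiff \<zeta>s (delta (- 1)) (- 1 - int p)"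

lemma delta_wbdd: "(\<And>n. 0 < w n) \<Longrightarrow> wbdd w (1 / w a) (delta a)"
  unfolding wbdd_def delta_def by (auto simp: less_imp_le less_imp_neq[symmetric])

lemma moderate_powi:
  assumes "0 < r"
  shows "moderate (\<lambda>k. r powi k) (\<lambda>n. r powi n)"
  using assms unfolding moderate_def by (auto simp: power_int_add)

lemma wmin_nonneg_index: "0 < rm \<Longrightarrow> rm < 1 \<Longrightarrow> 1 < rp \<Longrightarrow> 0 \<le> n \<Longrightarrow> wmin rm rp n = rm powi n"
  unfolding wmin_def by (intro min_absorb2 power_int_mono) auto

lemma wmin_neg_index:
  assumes "0 < rm" "rm < 1" "1 < rp" "n < 0"
  shows "wmin rm rp n = rp powi n"
proof -
  have "inverse rp powi (- n) \<le> inverse rm powi (- n)"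
    using assms by (intro power_int_mono) (auto simp: le_imp_inverse_le)
  then show ?thesis
    unfolding wmin_def by (simp add: power_int_minus power_int_inverse)
qed

lemma wmax_nonneg_index: "0 < rm \<Longrightarrow> rm < 1 \<Longrightarrow> 1 < rp \<Longrightarrow> 0 \<le> n \<Longrightarrow> wmax rm rp n = rp powi n"
  unfolding wmax_def by (intro max_absorb1 power_int_mono) auto

lemma wmax_neg_index:
  assumes "0 < rm" "rm < 1" "1 < rp" "n < 0"
  shows "wmax rm rp n = rm powi n"
proof -
  have "inverse rp powi (- n) \<le> inverse rm powi (- n)"
    using assms by (intro power_int_mono) (auto simp: le_imp_inverse_le)
  then show ?thesis
    unfolding wmax_def by (simp add: power_int_minus power_int_inverse)
qed

section \<open>The weights belonging to the two circles\<close>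

locale radii =
  fixes rm rp :: real
  assumes rm: "0 < rm" "rm < 1" and rp: "1 < rp"
begin

abbreviation "wn \<equiv> wmin rm rp"
abbreviation "wx \<equiv> wmax rm rp"
abbreviation "wi \<equiv> \<lambda>n::int. rm powi n"
abbreviation "wo \<equiv> \<lambda>n::int. rp powi n"

lemma rp_pos: "0 < rp" using rp by simp

lemma wn_pos: "0 < wn n" using rm rp by (simp add: wmin_def)

lemma wx_pos: "0 < wx n" using rm rp by (simp add: wmax_def less_max_iff_disj)

lemma moderate_wn: "moderate wx wn"
  unfolding moderate_def
proof (intro conjI allI wn_pos)
  fix n k
  show "wn (n + k) \<le> wx k * wn n"
  proof (cases "rp powi n \<le> rm powi n")
    case True
    have "wn (n + k) \<le> rp powi k * rp powi n"
      using rp unfolding wmin_def by (intro min.coboundedI1) (simp add: power_int_add mult.commute)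
    also have "\<dots> \<le> wx k * rp powi n"
      using rp unfolding wmax_def by (intro mult_right_mono) auto
    finally show ?thesis using True by (simp add: wmin_def min_absorb1)
  next
    case False
    have "wn (n + k) \<le> rm powi k * rm powi n"
      using rm unfolding wmin_def by (intro min.coboundedI2) (simp add: power_int_add mult.commute)
    also have "\<dots> \<le> wx k * rm powi n"
      using rm unfolding wmax_def by (intro mult_right_mono) auto
    finally show ?thesis using False by (simp add: wmin_def min_absorb2)
  qed
qed

lemma moderate_wx: "moderate wx wx"
  unfolding moderate_def
proof (intro conjI allI wx_pos)
  fix n k
  have "rp powi n * rp powi k \<le> wx n * wx k"
    using rp wx_pos by (intro mult_mono) (auto simp: wmax_def less_imp_le)
  moreover have "rm powi n * rm powi k \<le> wx n * wx k"
    using rm wx_pos by (intro mult_mono) (auto simp: wmax_def less_imp_le)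
  ultimately have "rp powi (n + k) \<le> wx k * wx n" "rm powi (n + k) \<le> wx k * wx n"
    using rm rp by (simp_all add: power_int_add mult.commute)
  then show "wx (n + k) \<le> wx k * wx n" by (simp add: wmax_def)
qed

lemma wn_le: "wn n \<le> wi n" "wn n \<le> wo n" by (simp_all add: wmin_def)

lemma wx_ge: "wi n \<le> wx n" "wo n \<le> wx n" by (simp_all add: wmax_def)

lemma wbdd_wn_nonneg: "wbdd wn B f \<Longrightarrow> 0 \<le> B"
  by (rule wbdd_nonneg[where w = wn and n = 0, OF wn_pos])

lemma wbdd_wnD: "wbdd wn B f \<Longrightarrow> wbdd wi B f" "wbdd wn B f \<Longrightarrow> wbdd wo B f"
  by (rule wbdd_weight_mono, assumption, erule wbdd_wn_nonneg, rule wn_le)+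

lemma wbdd_wnI: "wbdd wi B f \<Longrightarrow> wbdd wo B' f \<Longrightarrow> wbdd wn (max B B') f"
proof -
  assume a: "wbdd wi B f" "wbdd wo B' f"
  have "cmod (f n) \<le> max B B' * wi n" for n
    by (rule order_trans[OF wbddD[OF a(1)]]) (use rm in \<open>auto intro: mult_right_mono\<close>)
  moreover have "cmod (f n) \<le> max B B' * wo n" for n
    by (rule order_trans[OF wbddD[OF a(2)]]) (use rp in \<open>auto intro: mult_right_mono\<close>)
  ultimately show "wbdd wn (max B B') f"
    unfolding wbdd_def wmin_def by (simp add: min_def)
qed

lemma root_inv_inner_summable:
  assumes "cmod \<zeta> = 1"
  shows "(\<lambda>k. cmod (root_inv_inner \<zeta> k) * wi k) summable_on UNIV"
proof -
  have "cmod (root_inv_inner \<zeta> k) * wi k = (if 0 \<le> k then rm ^ nat \<bar>k\<bar> else 0)" for k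
    by (simp add: root_inv_inner_def norm_power_int assms) (simp add: power_int_def)
  then show ?thesis
    using rm by (intro summable_on_comparison_test[OF summable_on_int_geometric[of rm]]) auto
qed

lemma root_inv_outer_summable:
  assumes "cmod \<zeta> = 1"
  shows "(\<lambda>k. cmod (root_inv_outer \<zeta> k) * wo k) summable_on UNIV"
proof -
  have "cmod (root_inv_outer \<zeta> k) * wo k = (if k < 0 then inverse rp ^ nat \<bar>k\<bar> else 0)" for k
    by (simp add: root_inv_outer_def norm_power_int assms) (simp add: power_int_def)
  then show ?thesis
    using rp by (intro summable_on_comparison_test[OF summable_on_int_geometric[of "inverse rp"]])
      (auto simp: inverse_less_1_iff)
qed

lemmas mod_i = moderate_powi[OF rm(1)]
lemmas mod_o = moderate_powi[OF rp_pos]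

section \<open>Division by one root and by a list of roots\<close>

lemma sdiff_conv:
  assumes w: "moderate M w" and c: "(\<lambda>k. cmod (c k) * M k) summable_on UNIV" and f: "wbdd w B f"
  shows "sdiff \<zeta> (conv c f) = conv (\<lambda>k. c (k - 1) - \<zeta> * c k) f"
proof
  fix n
  have "((\<lambda>k. c k * f (n + 1 + k)) has_sum conv c f (n + 1)) UNIV"
    by (rule conv_has_sum[OF w c f])
  then have "((\<lambda>k. c (k - 1) * f (n + k)) has_sum conv c f (n + 1)) UNIV"
    using has_sum_reindex_bij_witness[of UNIV "\<lambda>k. k + 1" "\<lambda>k. k - 1" UNIV "\<lambda>k. c k * f (n + 1 + k)"
        "\<lambda>k. c (k - 1) * f (n + k)"] by (auto simp: add.commute)
  moreover have "((\<lambda>k. (- \<zeta>) * (c k * f (n + k))) has_sum (- \<zeta>) * conv c f n) UNIV"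
    by (intro has_sum_cmult_right conv_has_sum[OF w c f])
  ultimately have "((\<lambda>k. c (k - 1) * f (n + k) + (- \<zeta>) * (c k * f (n + k))) has_sum
      conv c f (n + 1) + (- \<zeta>) * conv c f n) UNIV"
    by (rule has_sum_add)
  moreover have "c (k - 1) * f (n + k) + (- \<zeta>) * (c k * f (n + k)) = (c (k - 1) - \<zeta> * c k) * f (n + k)" for k
    by (simp add: algebra_simps)
  ultimately show "sdiff \<zeta> (conv c f) n = conv (\<lambda>k. c (k - 1) - \<zeta> * c k) f n"
    unfolding conv_def[of "\<lambda>k. c (k - 1) - \<zeta> * c k"] sdiff_def by (simp add: infsumI)
qed

lemma sdiff_root_inv_inner:
  assumes "cmod \<zeta> = 1" "wbdd wi B f"
  shows "sdiff \<zeta> (conv (root_inv_inner \<zeta>) f) = f"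
proof -
  have z: "\<zeta> \<noteq> 0" using assms by auto
  have "root_inv_inner \<zeta> (k - 1) - \<zeta> * root_inv_inner \<zeta> k = (if k = 0 then 1 else 0)" for k
    using z by (auto simp: root_inv_inner_def power_int_diff power_int_minus)
  then show ?thesis
    using sdiff_conv[OF mod_i root_inv_inner_summable[OF assms(1)] assms(2), of \<zeta>] conv_delta[of f] by simp
qed

lemma sdiff_root_inv_outer:
  assumes "cmod \<zeta> = 1" "wbdd wo B f"
  shows "sdiff \<zeta> (conv (root_inv_outer \<zeta>) f) = f"
proof -
  have z: "\<zeta> \<noteq> 0" using assms by auto
  have "root_inv_outer \<zeta> (k - 1) - \<zeta> * root_inv_outer \<zeta> k = (if k = 0 then 1 else 0)" for k
    using z by (auto simp: root_inv_outer_def power_int_diff power_int_minus)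
  then show ?thesis
    using sdiff_conv[OF mod_o root_inv_outer_summable[OF assms(1)] assms(2), of \<zeta>] conv_delta[of f] by simp
qed

text \<open>Both one-sided sums solve the first-order equation. Gluing them disturbs it only at n =
  - 1, where the values at 0 and - 1 come from different sums, and the defect there is
  \<open>root_eval\<close>.\<close>

lemma root_quot_identity:
  assumes "cmod \<zeta> = 1" "wbdd wn B f"
  shows "f n = sdiff \<zeta> (root_quot \<zeta> f) n + root_eval \<zeta> f * delta (- 1) n"
proof -
  have i: "sdiff \<zeta> (conv (root_inv_inner \<zeta>) f) n = f n"
    using sdiff_root_inv_inner[OF assms(1) wbdd_wnD(1)[OF assms(2)]] by simp
  have o: "sdiff \<zeta> (conv (root_inv_outer \<zeta>) f) n = f n"
    using sdiff_root_inv_outer[OF assms(1) wbdd_wnD(2)[OF assms(2)]] by simp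
  consider "0 \<le> n" | "n = - 1" | "n < - 1" by linarith
  then show ?thesis
    using i o by cases (auto simp: sdiff_def root_quot_def delta_def root_eval_def algebra_simps)
qed

definition root_bound :: "complex \<Rightarrow> real" where
  "root_bound \<zeta> = max (\<Sum>\<^sub>\<infinity>k. cmod (root_inv_inner \<zeta> k) * wi k) (\<Sum>\<^sub>\<infinity>k. cmod (root_inv_outer \<zeta> k) * wo k)"

lemmas conv_inner_op = conv_bounded_op[OF mod_i root_inv_inner_summable]
lemmas conv_outer_op = conv_bounded_op[OF mod_o root_inv_outer_summable]

text \<open>\<open>wmin\<close> is \<open>rm powi n\<close> for n \<ge> 0 and
  \<open>rp powi n\<close> for n < 0, which is on each side the weight for which the convolution
  used there is bounded.\<close>

lemma root_quot_bounded_op: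
  assumes z: "cmod \<zeta> = 1"
  shows "bounded_op wn (root_bound \<zeta>) (root_quot \<zeta>)"
  unfolding bounded_op_def
proof (intro conjI allI impI)
  show "0 \<le> root_bound \<zeta>"
    using bounded_opD(1)[OF conv_inner_op[OF z]] by (simp add: root_bound_def)
next
  fix f B assume f: "wbdd wn B f"
  have B: "0 \<le> B" by (rule wbdd_wn_nonneg[OF f])
  show "wbdd wn (root_bound \<zeta> * B) (root_quot \<zeta> f)"
    unfolding wbdd_def
  proof
    fix n
    show "cmod (root_quot \<zeta> f n) \<le> root_bound \<zeta> * B * wn n"
    proof (cases "0 \<le> n")
      case True
      have "cmod (conv (root_inv_inner \<zeta>) f n) \<le> (\<Sum>\<^sub>\<infinity>k. cmod (root_inv_inner \<zeta> k) * wi k) * B * wi n"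
        by (rule wbddD[OF bounded_opD(2)[OF conv_inner_op[OF z] wbdd_wnD(1)[OF f]]])
      also have "\<dots> \<le> root_bound \<zeta> * B * wi n"
        using B rm by (intro mult_right_mono) (auto simp: root_bound_def)
      finally show ?thesis using True rm rp by (simp add: root_quot_def wmin_nonneg_index)
    next
      case False
      have "cmod (conv (root_inv_outer \<zeta>) f n) \<le> (\<Sum>\<^sub>\<infinity>k. cmod (root_inv_outer \<zeta> k) * wo k) * B * wo n"
        by (rule wbddD[OF bounded_opD(2)[OF conv_outer_op[OF z] wbdd_wnD(2)[OF f]]])
      also have "\<dots> \<le> root_bound \<zeta> * B * wo n"
        using B rp by (intro mult_right_mono) (auto simp: root_bound_def)
      finally show ?thesis using False rm rp by (simp add: root_quot_def wmin_neg_index)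
    qed
  qed
next
  fix f g B B' assume fg: "wbdd wn B f" "wbdd wn B' g"
  show "root_quot \<zeta> (\<lambda>n. f n + g n) = (\<lambda>n. root_quot \<zeta> f n + root_quot \<zeta> g n)"
    unfolding root_quot_def[abs_def]
      bounded_opD(3)[OF conv_inner_op[OF z] wbdd_wnD(1)[OF fg(1)] wbdd_wnD(1)[OF fg(2)]]
      bounded_opD(3)[OF conv_outer_op[OF z] wbdd_wnD(2)[OF fg(1)] wbdd_wnD(2)[OF fg(2)]] by auto
next
  fix c f B assume f: "wbdd wn B f"
  show "root_quot \<zeta> (\<lambda>n. c * f n) = (\<lambda>n. c * root_quot \<zeta> f n)"
    unfolding root_quot_def[abs_def]
      bounded_opD(4)[OF conv_inner_op[OF z] wbdd_wnD(1)[OF f]]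
      bounded_opD(4)[OF conv_outer_op[OF z] wbdd_wnD(2)[OF f]] by auto
qed

lemma root_eval_add:
  assumes z: "cmod \<zeta> = 1" and f: "wbdd wn B f" "wbdd wn B' g"
  shows "root_eval \<zeta> (\<lambda>n. f n + g n) = root_eval \<zeta> f + root_eval \<zeta> g"
  unfolding root_eval_def
    bounded_opD(3)[OF conv_inner_op[OF z] wbdd_wnD(1)[OF f(1)] wbdd_wnD(1)[OF f(2)]]
    bounded_opD(3)[OF conv_outer_op[OF z] wbdd_wnD(2)[OF f(1)] wbdd_wnD(2)[OF f(2)]] by simp

lemma root_eval_bound:
  assumes z: "cmod \<zeta> = 1" and f: "wbdd wn B f"
  shows "cmod (root_eval \<zeta> f) \<le> 2 * root_bound \<zeta> * B"
proof -
  have B: "0 \<le> B" by (rule wbdd_wn_nonneg[OF f])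
  have "cmod (conv (root_inv_inner \<zeta>) f 0) \<le> (\<Sum>\<^sub>\<infinity>k. cmod (root_inv_inner \<zeta> k) * wi k) * B * wi 0"
    by (rule wbddD[OF bounded_opD(2)[OF conv_inner_op[OF z] wbdd_wnD(1)[OF f]]])
  also have "\<dots> \<le> root_bound \<zeta> * B * wi 0"
    using B rm by (intro mult_right_mono) (auto simp: root_bound_def)
  finally have 1: "cmod (conv (root_inv_inner \<zeta>) f 0) \<le> root_bound \<zeta> * B" by simp
  have "cmod (conv (root_inv_outer \<zeta>) f 0) \<le> (\<Sum>\<^sub>\<infinity>k. cmod (root_inv_outer \<zeta> k) * wo k) * B * wo 0"
    by (rule wbddD[OF bounded_opD(2)[OF conv_outer_op[OF z] wbdd_wnD(2)[OF f]]])
  also have "\<dots> \<le> root_bound \<zeta> * B * wo 0"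
    using B rp by (intro mult_right_mono) (auto simp: root_bound_def)
  finally have 2: "cmod (conv (root_inv_outer \<zeta>) f 0) \<le> root_bound \<zeta> * B" by simp
  have "cmod (root_eval \<zeta> f) \<le> cmod (conv (root_inv_outer \<zeta>) f 0) + cmod (conv (root_inv_inner \<zeta>) f 0)"
    unfolding root_eval_def by (rule norm_triangle_ineq4)
  with 1 2 show ?thesis by simp
qed

lemma quot_bounded_op:
  assumes "\<forall>\<zeta>\<in>set \<zeta>s. cmod \<zeta> = 1"
  shows "bounded_op wn (\<Prod>\<zeta>\<leftarrow>\<zeta>s. root_bound \<zeta>) (foldr root_quot \<zeta>s)"
  using assms
proof (induction \<zeta>s)
  case Nil
  show ?case by (simp add: bounded_op_def)
next
  case (Cons \<zeta> \<zeta>s)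
  then show ?case
    using bounded_op_comp[OF root_quot_bounded_op[of \<zeta>] Cons.IH] by (simp add: o_def)
qed

lemma sdiff_add: "sdiff \<zeta> (\<lambda>n. f n + g n) = (\<lambda>n. sdiff \<zeta> f n + sdiff \<zeta> g n)"
  by (auto simp: sdiff_def algebra_simps)

lemma sdiff_cmult: "sdiff \<zeta> (\<lambda>n. c * f n) = (\<lambda>n. c * sdiff \<zeta> f n)"
  by (auto simp: sdiff_def algebra_simps)

lemma foldr_sdiff_add: "foldr sdiff \<zeta>s (\<lambda>n. f n + g n) = (\<lambda>n. foldr sdiff \<zeta>s f n + foldr sdiff \<zeta>s g n)"
  by (induction \<zeta>s) (auto simp: sdiff_add)

lemma foldr_sdiff_cmult: "foldr sdiff \<zeta>s (\<lambda>n. c * f n) = (\<lambda>n. c * foldr sdiff \<zeta>s f n)"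
  by (induction \<zeta>s) (auto simp: sdiff_cmult)

lemma foldr_sdiff_commute: "foldr sdiff \<zeta>s (sdiff \<zeta> y) = sdiff \<zeta> (foldr sdiff \<zeta>s y)"
proof (induction \<zeta>s)
  case (Cons a \<zeta>s)
  have "sdiff a (sdiff \<zeta> z) = sdiff \<zeta> (sdiff a z)" for z
    by (auto simp: sdiff_def algebra_simps)
  then show ?case by (simp add: Cons)
qed simp

text \<open>These are the coefficients of the monic polynomial with roots \<open>\<zeta>s\<close>,
  with that of z ^ p stored at - 1 - p: only degrees up to \<open>length \<zeta>s\<close> occur, and
  the top coefficient is 1.\<close>

lemma foldr_sdiff_delta:
  "n < - 1 - int (length \<zeta>s) \<or> - 1 < n \<Longrightarrow> foldr sdiff \<zeta>s (delta (- 1)) n = 0"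
  "foldr sdiff \<zeta>s (delta (- 1)) (- 1 - int (length \<zeta>s)) = 1"
proof (induction \<zeta>s arbitrary: n)
  case Nil
  { case 1 then show ?case by (auto simp: delta_def) }
  { case 2 then show ?case by (auto simp: delta_def) }
next
  case (Cons \<zeta> \<zeta>s)
  { case 1 then show ?case using Cons.IH(1)[of n] Cons.IH(1)[of "n + 1"] by (auto simp: sdiff_def) }
  { case 2 show ?case using Cons.IH(1)[of "- 2 - int (length \<zeta>s)"] Cons.IH(2) by (auto simp: sdiff_def) }
qed

lemma delta_expansion:
  assumes "\<And>n. n < - int N \<or> - 1 < n \<Longrightarrow> e n = 0"
  shows "e n = (\<Sum>p<N. e (- 1 - int p) * delta (- 1 - int p) n)"
proof (cases "- int N \<le> n \<and> n \<le> - 1")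
  case True
  define q where "q = nat (- 1 - n)"
  have q: "q < N" "n = - 1 - int q" using True by (auto simp: q_def)
  have "(\<Sum>p<N. e (- 1 - int p) * delta (- 1 - int p) n) = (\<Sum>p<N. if p = q then e (- 1 - int p) else 0)"
    by (intro sum.cong) (auto simp: delta_def q)
  with q show ?thesis by simp
next
  case False
  then have "delta (- 1 - int p) n = 0" if "p < N" for p using that by (auto simp: delta_def)
  with False assms[of n] show ?thesis by (auto simp: not_le)
qed

text \<open>Dividing the quotient by one more root leaves a constant. Multiplied back by the roots
  already divided out, it becomes a polynomial of degree \<open>length \<zeta>s\<close> and
  lengthens the remainder by one coefficient.\<close>

lemma division_identity:
  assumes "\<forall>\<zeta>\<in>set \<zeta>s. cmod \<zeta> = 1" "wbdd wn B f"
  shows "f n = foldr sdiff \<zeta>s (foldr root_quot \<zeta>s f) n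
           + (\<Sum>p<length \<zeta>s. remainder \<zeta>s f p * delta (- 1 - int p) n)"
  using assms(1)
proof (induction \<zeta>s arbitrary: n)
  case (Cons \<zeta> \<zeta>s)
  define y where "y = foldr root_quot \<zeta>s f"
  define c where "c = root_eval \<zeta> y"
  define e where "e = foldr sdiff \<zeta>s (delta (- 1))"
  have y: "wbdd wn ((\<Prod>\<zeta>\<leftarrow>\<zeta>s. root_bound \<zeta>) * B) y"
    using bounded_opD(2)[OF quot_bounded_op assms(2)] Cons.prems unfolding y_def by simp
  have "y = (\<lambda>n. sdiff \<zeta> (root_quot \<zeta> y) n + c * delta (- 1) n)"
    using root_quot_identity[OF _ y, of \<zeta>] Cons.prems unfolding c_def by auto
  then have "foldr sdiff \<zeta>s y = foldr sdiff \<zeta>s (\<lambda>n. sdiff \<zeta> (root_quot \<zeta> y) n + c * delta (- 1) n)"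
    by (rule arg_cong)
  also have "\<dots> = (\<lambda>n. sdiff \<zeta> (foldr sdiff \<zeta>s (root_quot \<zeta> y)) n + c * e n)"
    unfolding foldr_sdiff_add foldr_sdiff_cmult e_def by (simp add: foldr_sdiff_commute)
  finally have 1: "foldr sdiff \<zeta>s y n = sdiff \<zeta> (foldr sdiff \<zeta>s (root_quot \<zeta> y)) n + c * e n"
    by simp
  have 2: "e n = (\<Sum>p<Suc (length \<zeta>s). e (- 1 - int p) * delta (- 1 - int p) n)"
    using foldr_sdiff_delta(1)[of _ \<zeta>s] unfolding e_def by (intro delta_expansion) auto
  have "remainder (\<zeta> # \<zeta>s) f p * delta (- 1 - int p) n
      = (if p < length \<zeta>s then remainder \<zeta>s f p else 0) * delta (- 1 - int p) n
        + c * (e (- 1 - int p) * delta (- 1 - int p) n)" for p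
    by (simp only: remainder.simps e_def c_def y_def distrib_right mult.assoc)
  then have "(\<Sum>p<Suc (length \<zeta>s). remainder (\<zeta> # \<zeta>s) f p * delta (- 1 - int p) n)
      = (\<Sum>p<Suc (length \<zeta>s). (if p < length \<zeta>s then remainder \<zeta>s f p else 0) * delta (- 1 - int p) n)
        + c * (\<Sum>p<Suc (length \<zeta>s). e (- 1 - int p) * delta (- 1 - int p) n)"
    by (simp only: sum.distrib sum_distrib_left)
  also have "(\<Sum>p<Suc (length \<zeta>s). (if p < length \<zeta>s then remainder \<zeta>s f p else 0) * delta (- 1 - int p) n)
      = (\<Sum>p<length \<zeta>s. remainder \<zeta>s f p * delta (- 1 - int p) n)"
    by simp
  finally have 3: "(\<Sum>p<Suc (length \<zeta>s). remainder (\<zeta> # \<zeta>s) f p * delta (- 1 - int p) n)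
      = (\<Sum>p<length \<zeta>s. remainder \<zeta>s f p * delta (- 1 - int p) n) + c * e n"
    by (simp only: 2[symmetric])
  have "f n = foldr sdiff \<zeta>s y n + (\<Sum>p<length \<zeta>s. remainder \<zeta>s f p * delta (- 1 - int p) n)"
    using Cons.IH[of n] Cons.prems by (simp add: y_def)
  also have "\<dots> = sdiff \<zeta> (foldr sdiff \<zeta>s (root_quot \<zeta> y)) n
      + (\<Sum>p<Suc (length \<zeta>s). remainder (\<zeta> # \<zeta>s) f p * delta (- 1 - int p) n)"
    by (simp only: 1 3 add_ac)
  finally show ?case by (simp only: y_def foldr.simps o_apply list.size add_0_right add_Suc_right)
qed simp

lemma sdiff_wbdd:
  assumes "moderate M w" "wbdd w B y"
  shows "wbdd w ((M 1 + cmod \<zeta>) * B) (sdiff \<zeta> y)"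
  unfolding wbdd_def
proof
  fix n
  have B: "0 \<le> B" by (rule wbdd_nonneg[OF moderate_pos[OF assms(1), of 0] assms(2)])
  have "cmod (sdiff \<zeta> y n) \<le> cmod (y (n + 1)) + cmod \<zeta> * cmod (y n)"
    unfolding sdiff_def norm_mult[symmetric] by (rule norm_triangle_ineq4)
  also have "\<dots> \<le> B * (M 1 * w n) + cmod \<zeta> * (B * w n)"
    using B by (intro add_mono mult_left_mono wbddD[OF assms(2)]
        order_trans[OF wbddD[OF assms(2)]] moderate_le[OF assms(1)]) auto
  finally show "cmod (sdiff \<zeta> y n) \<le> (M 1 + cmod \<zeta>) * B * w n" by (simp add: algebra_simps)
qed

text \<open>Since |\<zeta>| = 1, a solution has constant modulus on n \<ge> 0 and on n < 0, which is
  compatible with decay in both directions only if it is 0.\<close>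

lemma sdiff_root_unique:
  assumes z: "cmod \<zeta> = 1" and y: "wbdd wn B y" and eq: "\<And>n. sdiff \<zeta> y n + c * delta (- 1) n = 0"
  shows "y = (\<lambda>_. 0)" "c = 0"
proof -
  have up: "cmod (y (int j)) = cmod (y 0)" for j
  proof (induction j)
    case (Suc j)
    have "y (int j + 1) = \<zeta> * y (int j)" using eq[of "int j"] by (simp add: sdiff_def delta_def)
    then have "cmod (y (1 + int j)) = cmod (y (int j))" using z by (simp add: norm_mult add.commute)
    with Suc show ?case by simp
  qed simp
  have dn: "cmod (y (- 1 - int j)) = cmod (y (- 1))" for j
  proof (induction j)
    case (Suc j)
    have "y (- 1 - int (Suc j) + 1) = \<zeta> * y (- 1 - int (Suc j))"
      using eq[of "- 1 - int (Suc j)"] by (simp add: sdiff_def delta_def)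
    moreover have "- 1 - int (Suc j) + 1 = - 1 - int j" by simp
    ultimately have "cmod (y (- 1 - int j)) = cmod (y (- 1 - int (Suc j)))" using z by (simp add: norm_mult)
    with Suc show ?case by simp
  qed simp
  have "cmod (y 0) \<le> B * rm ^ j" for j
    using wbddD[OF wbdd_wnD(1)[OF y], of "int j"] up[of j] by simp
  moreover have "(\<lambda>j. B * rm ^ j) \<longlonglongrightarrow> B * 0"
    using rm by (intro tendsto_intros LIMSEQ_power_zero) simp
  ultimately have "cmod (y 0) \<le> 0" by (intro LIMSEQ_le_const[of "\<lambda>j. B * rm ^ j"]) auto
  then have y0: "y (int j) = 0" for j using up[of j] by simp
  have "cmod (y (- 1)) \<le> B * inverse rp * inverse rp ^ j" for j
    using wbddD[OF wbdd_wnD(2)[OF y], of "- 1 - int j"] dn[of j] rp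
    by (simp add: power_int_diff power_int_minus divide_inverse power_inverse mult.assoc)
  moreover have "(\<lambda>j. B * inverse rp * inverse rp ^ j) \<longlonglongrightarrow> B * inverse rp * 0"
    using rp by (intro tendsto_intros LIMSEQ_power_zero) (simp add: inverse_less_1_iff)
  ultimately have "cmod (y (- 1)) \<le> 0"
    by (intro LIMSEQ_le_const[of "\<lambda>j. B * inverse rp * inverse rp ^ j"]) auto
  then have y1: "y (- 1 - int j) = 0" for j using dn[of j] by simp
  show y: "y = (\<lambda>_. 0)"
  proof
    fix n show "y n = 0"
      using y0[of "nat n"] y1[of "nat (- 1 - n)"] by (cases "0 \<le> n") auto
  qed
  then show "c = 0" using eq[of "- 1"] by (simp add: sdiff_def delta_def)
qed

text \<open>The top monomial is replaced by the monic product over the tail minus its lower terms.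
  Then \<open>c N\<close> plays the part of the constant remainder at the head root, and what is
  left is the claim for the tail with coefficients corrected by the lower terms.\<close>

lemma division_unique:
  assumes "\<forall>\<zeta>\<in>set \<zeta>s. cmod \<zeta> = 1" "wbdd wn B y"
    "\<And>n. foldr sdiff \<zeta>s y n + (\<Sum>p<length \<zeta>s. c p * delta (- 1 - int p) n) = 0"
  shows "y = (\<lambda>_. 0) \<and> (\<forall>p<length \<zeta>s. c p = 0)"
  using assms
proof (induction \<zeta>s arbitrary: y c B)
  case (Cons \<zeta> \<zeta>s)
  define N where "N = length \<zeta>s"
  define e where "e = foldr sdiff \<zeta>s (delta (- 1))"
  define y' where "y' = (\<lambda>n. sdiff \<zeta> y n + c N * delta (- 1) n)"
  have y': "wbdd wn ((wx 1 + cmod \<zeta>) * B + cmod (c N) * (1 / wn (- 1))) y'"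
    unfolding y'_def
    by (intro wbdd_add sdiff_wbdd[OF moderate_wn Cons.prems(2)] wbdd_cmult delta_wbdd wn_pos)
  have e: "e n = (\<Sum>p<N. e (- 1 - int p) * delta (- 1 - int p) n) + delta (- 1 - int N) n" for n
    using foldr_sdiff_delta(1)[of _ \<zeta>s] foldr_sdiff_delta(2)[of \<zeta>s]
      delta_expansion[of "Suc N" e n] unfolding e_def N_def by auto
  have "foldr sdiff \<zeta>s y' n + (\<Sum>p<N. (c p - c N * e (- 1 - int p)) * delta (- 1 - int p) n) = 0" for n
  proof -
    have "foldr sdiff \<zeta>s y' n = foldr sdiff (\<zeta> # \<zeta>s) y n + c N * e n"
      unfolding y'_def foldr_sdiff_add foldr_sdiff_cmult foldr_sdiff_commute e_def by simp
    also have "c N * e n = c N * (\<Sum>p<N. e (- 1 - int p) * delta (- 1 - int p) n)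
        + c N * delta (- 1 - int N) n"
      by (subst e) (simp add: distrib_left)
    finally have 1: "foldr sdiff \<zeta>s y' n = foldr sdiff (\<zeta> # \<zeta>s) y n
        + (c N * (\<Sum>p<N. e (- 1 - int p) * delta (- 1 - int p) n) + c N * delta (- 1 - int N) n)" .
    have 2: "(\<Sum>p<N. (c p - c N * e (- 1 - int p)) * delta (- 1 - int p) n)
        = (\<Sum>p<N. c p * delta (- 1 - int p) n) - c N * (\<Sum>p<N. e (- 1 - int p) * delta (- 1 - int p) n)"
      by (simp add: left_diff_distrib sum_subtractf sum_distrib_left mult.assoc)
    have 3: "foldr sdiff (\<zeta> # \<zeta>s) y n + ((\<Sum>p<N. c p * delta (- 1 - int p) n) + c N * delta (- 1 - int N) n) = 0"
      using Cons.prems(3)[of n] by (simp add: N_def)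
    show ?thesis
      unfolding 1 2 by (rule trans[OF _ 3]) simp
  qed
  from Cons.IH[OF _ y' this[unfolded N_def]] Cons.prems(1)
  have IH: "y' = (\<lambda>_. 0)" "\<forall>p<N. c p - c N * e (- 1 - int p) = 0" by (auto simp: N_def)
  have "y = (\<lambda>_. 0)" "c N = 0"
    using sdiff_root_unique[OF _ Cons.prems(2), of \<zeta> "c N"] Cons.prems(1) IH(1)
    unfolding y'_def by (auto simp: fun_eq_iff)
  with IH(2) show ?case by (auto simp: N_def less_Suc_eq)
qed (simp add: fun_eq_iff)

end

text \<open>Convolving with the inverse symbol \<open>r\<close> from the left turns conv v y = b y
  into the fixed point equation y = conv r (b y).\<close>

lemma inverse_perturbed_unique:
  assumes w: "moderate M w" and v: "(\<lambda>k. cmod (v k) * M k) summable_on UNIV"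
    and r: "(\<lambda>k. cmod (r k) * M k) summable_on UNIV"
    and rv: "\<And>m. ((\<lambda>j. r j * v (m - j)) has_sum (if m = 0 then 1 else 0)) UNIV"
    and b: "\<And>n. cmod (b n) \<le> \<beta>" "0 \<le> \<beta>" "(\<Sum>\<^sub>\<infinity>k. cmod (r k) * M k) * \<beta> < 1"
    and y: "wbdd w B y" "\<And>n. conv v y n - b n * y n = 0"
  shows "y = (\<lambda>_. 0)"
proof (rule perturbed_op_unique[OF conv_bounded_op[OF w r] _ b y(1)])
  have "y = conv r (conv v y)"
    using conv_conv[OF w v r y(1) rv] conv_delta by simp
  also have "conv v y = (\<lambda>n. b n * y n)" using y(2) by (simp add: fun_eq_iff)
  finally show "y = conv r (\<lambda>n. b n * y n)" .
qed (use moderate_pos[OF w] in \<open>simp add: less_imp_le\<close>)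

lemma (in uniform_algebra) diff:
  assumes "P f" "P g"
  shows "P (\<lambda>x. f x - g x)"
  using add[OF assms(1) mult[OF const[of "- 1"] assms(2)]] by simp

text \<open>Here \<open>r\<close> acts as a right inverse: \<open>conv v\<close> is applied to the
  Neumann solution of y = conv r (f + b y).\<close>

lemma (in uniform_algebra) inverse_perturbed_solution:
  assumes w: "moderate M w" and v: "(\<lambda>k. cmod (v k) * M k) summable_on UNIV"
    and r: "(\<lambda>k. cmod (r k) * M k) summable_on UNIV"
    and vr: "\<And>m. ((\<lambda>j. v j * r (m - j)) has_sum (if m = 0 then 1 else 0)) UNIV"
    and b: "\<And>n. P (\<lambda>x. b x n)" "\<And>x n. x \<in> X \<Longrightarrow> cmod (b x n) \<le> \<beta>" "0 \<le> \<beta>"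
      "(\<Sum>\<^sub>\<infinity>k. cmod (r k) * M k) * \<beta> < 1"
    and f: "family w B f" "0 \<le> B"
  shows "\<exists>y B'. family w B' y \<and> (\<forall>x\<in>X. \<forall>n. conv v (y x) n - b x n * y x n = f x n)"
proof -
  have w0: "0 \<le> w n" for n using moderate_pos[OF w] less_imp_le by blast
  obtain y where y: "family w ((\<Sum>\<^sub>\<infinity>k. cmod (r k) * M k) * B / (1 - (\<Sum>\<^sub>\<infinity>k. cmod (r k) * M k) * \<beta>)) y"
    and eq: "\<And>x. x \<in> X \<Longrightarrow> y x = conv r (\<lambda>n. f x n + b x n * y x n)"
    using perturbed_op_solution[where b = b, OF conv_bounded_op[OF w r] conv_preserves[OF w r] w0 b f] by blast
  have "conv v (y x) n - b x n * y x n = f x n" if x: "x \<in> X" for x n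
  proof -
    have "wbdd w (B + \<beta> * ((\<Sum>\<^sub>\<infinity>k. cmod (r k) * M k) * B / (1 - (\<Sum>\<^sub>\<infinity>k. cmod (r k) * M k) * \<beta>)))
        (\<lambda>n. f x n + b x n * y x n)"
      using f(1) y x b by (intro wbdd_add wbdd_mult) (auto simp: family_def)
    from conv_conv[OF w r v this vr] have "conv v (y x) = (\<lambda>n. f x n + b x n * y x n)"
      unfolding eq[OF x, symmetric] by (simp add: conv_delta)
    then show ?thesis by simp
  qed
  with y show ?thesis by blast
qed

context radii
begin

section \<open>Linearity, bound and parameter dependence of the remainder\<close>

lemma remainder_add:
  assumes "\<forall>\<zeta>\<in>set \<zeta>s. cmod \<zeta> = 1" "wbdd wn B f" "wbdd wn B' g"
  shows "remainder \<zeta>s (\<lambda>n. f n + g n) p = remainder \<zeta>s f p + remainder \<zeta>s g p"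
  using assms(1)
proof (induction \<zeta>s)
  case (Cons \<zeta> \<zeta>s)
  note Q = quot_bounded_op[of \<zeta>s]
  have Q': "bounded_op wn (\<Prod>\<zeta>\<leftarrow>\<zeta>s. root_bound \<zeta>) (foldr root_quot \<zeta>s)"
    using Cons.prems by (intro Q) simp
  show ?case
    using Cons root_eval_add[OF _ bounded_opD(2)[OF Q' assms(2)] bounded_opD(2)[OF Q' assms(3)], of \<zeta>]
    by (simp add: bounded_opD(3)[OF Q' assms(2,3)] algebra_simps)
qed simp

text \<open>The constant is uniform in the sequence and in the index; it yields the O(|\<epsilon>|)
  estimate for the last column of the cocycle.\<close>

lemma remainder_bound:
  assumes "\<forall>\<zeta>\<in>set \<zeta>s. cmod \<zeta> = 1"
  shows "\<exists>K\<ge>0. \<forall>f B p. wbdd wn B f \<longrightarrow> cmod (remainder \<zeta>s f p) \<le> K * B"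
  using assms
proof (induction \<zeta>s)
  case Nil
  show ?case by (intro exI[of _ 0]) simp
next
  case (Cons \<zeta> \<zeta>s)
  then obtain K where K: "0 \<le> K" "\<And>f B p. wbdd wn B f \<Longrightarrow> cmod (remainder \<zeta>s f p) \<le> K * B" by auto
  define e where "e = foldr sdiff \<zeta>s (delta (- 1))"
  define Q where "Q = (\<Prod>\<zeta>\<leftarrow>\<zeta>s. root_bound \<zeta>)"
  define S where "S = (\<Sum>p\<le>length \<zeta>s. cmod (e (- 1 - int p)))"
  have e: "cmod (e (- 1 - int p)) \<le> S" for p
  proof (cases "p \<le> length \<zeta>s")
    case True
    then show ?thesis unfolding S_def by (intro member_le_sum) auto
  next
    case False
    then have "e (- 1 - int p) = 0" unfolding e_def by (intro foldr_sdiff_delta(1)) auto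
    then show ?thesis unfolding S_def by (simp add: sum_nonneg)
  qed
  have Q: "bounded_op wn Q (foldr root_quot \<zeta>s)"
    unfolding Q_def using Cons.prems by (intro quot_bounded_op) simp
  have z: "cmod \<zeta> = 1" using Cons.prems by simp
  have S0: "0 \<le> S" unfolding S_def by (intro sum_nonneg) simp
  have rb: "0 \<le> root_bound \<zeta>" by (rule bounded_opD(1)[OF root_quot_bounded_op[OF z]])
  have "cmod (remainder (\<zeta> # \<zeta>s) f p) \<le> (K + 2 * root_bound \<zeta> * Q * S) * B" if f: "wbdd wn B f" for f B p
  proof -
    have B: "0 \<le> B" by (rule wbdd_wn_nonneg[OF f])
    have "cmod (remainder (\<zeta> # \<zeta>s) f p) \<le> K * B + (2 * root_bound \<zeta> * (Q * B)) * S"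
      unfolding remainder.simps
    proof (rule order_trans[OF norm_triangle_ineq], rule add_mono)
      show "cmod (if p < length \<zeta>s then remainder \<zeta>s f p else 0) \<le> K * B"
        using K(2)[OF f, of p] K(1) B by auto
      show "cmod (root_eval \<zeta> (foldr root_quot \<zeta>s f) * foldr sdiff \<zeta>s (delta (- 1)) (- 1 - int p))
          \<le> 2 * root_bound \<zeta> * (Q * B) * S"
        unfolding norm_mult e_def[symmetric]
        using bounded_opD(1)[OF Q] B rb
        by (intro mult_mono root_eval_bound[OF z] bounded_opD(2)[OF Q f] e) auto
    qed
    then show ?thesis by (simp add: algebra_simps)
  qed
  moreover have "0 \<le> K + 2 * root_bound \<zeta> * Q * S"
    using K(1) rb bounded_opD(1)[OF Q] S0 by simp
  ultimately show ?case by blast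
qed

end

locale radii_algebra = radii rm rp + uniform_algebra X P
  for rm rp :: real and X :: "'x set" and P
begin

lemma family_wnD: "family wn B f \<Longrightarrow> family wi B f" "family wn B f \<Longrightarrow> family wo B f"
  using wbdd_wnD unfolding family_def by blast+

lemma root_quot_preserves:
  assumes "cmod \<zeta> = 1"
  shows "preserves wn (root_quot \<zeta>)"
  unfolding preserves_def
proof (intro allI impI)
  fix B f n assume "family wn B f"
  then have "P (\<lambda>x. conv (root_inv_inner \<zeta>) (f x) n)" "P (\<lambda>x. conv (root_inv_outer \<zeta>) (f x) n)"
    using conv_preserves[OF mod_i root_inv_inner_summable[OF assms]] family_wnD
      conv_preserves[OF mod_o root_inv_outer_summable[OF assms]] unfolding preserves_def by blast+
  then show "P (\<lambda>x. root_quot \<zeta> (f x) n)"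
    by (cases "0 \<le> n") (simp_all add: root_quot_def)
qed

lemma quot_preserves:
  assumes "\<forall>\<zeta>\<in>set \<zeta>s. cmod \<zeta> = 1"
  shows "preserves wn (foldr root_quot \<zeta>s)"
  using assms
proof (induction \<zeta>s)
  case Nil
  show ?case by (auto simp: preserves_def family_def)
next
  case (Cons \<zeta> \<zeta>s)
  then show ?case
    using preserves_comp[OF root_quot_preserves[of \<zeta>] quot_bounded_op[of \<zeta>s] Cons.IH]
    by (simp add: o_def)
qed

lemma remainder_preserves:
  assumes "\<forall>\<zeta>\<in>set \<zeta>s. cmod \<zeta> = 1" "family wn B f"
  shows "P (\<lambda>x. remainder \<zeta>s (f x) p)"
  using assms(1)
proof (induction \<zeta>s)
  case Nil
  show ?case by (simp add: const)
next
  case (Cons \<zeta> \<zeta>s)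
  then have IH: "P (\<lambda>x. if p < length \<zeta>s then remainder \<zeta>s (f x) p else 0)"
    by (cases "p < length \<zeta>s") (simp_all add: const)
  have z: "cmod \<zeta> = 1" and zs: "\<forall>\<zeta>\<in>set \<zeta>s. cmod \<zeta> = 1" using Cons.prems by auto
  have fam: "family wn ((\<Prod>\<zeta>\<leftarrow>\<zeta>s. root_bound \<zeta>) * B) (\<lambda>x. foldr root_quot \<zeta>s (f x))"
    by (rule family_op[OF quot_bounded_op[OF zs] quot_preserves[OF zs] assms(2)])
  have "P (\<lambda>x. root_eval \<zeta> (foldr root_quot \<zeta>s (f x)))"
    unfolding root_eval_def
    using conv_preserves[OF mod_i root_inv_inner_summable[OF z]]
      conv_preserves[OF mod_o root_inv_outer_summable[OF z]] family_wnD[OF fam]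
    unfolding preserves_def by (intro diff) blast+
  then show ?case
    unfolding remainder.simps by (intro add IH mult const)
qed

end

text \<open>V - E in terms of sequences: \<open>v\<close> holds its Laurent coefficients,
  \<open>h\<close> and \<open>hinv\<close> those of the zero-free factor and its reciprocal,
  \<open>ri\<close> and \<open>ro\<close> those of 1 / (V - E) on the circles of radius
  \<open>rm\<close> and \<open>rp\<close>. The last two invert the same \<open>v\<close> and differ
  by the contribution of the zeros between the circles.\<close>

locale symbol = radii rm rp for rm rp +
  fixes v h hinv ri ro :: "int \<Rightarrow> complex" and \<zeta>s :: "complex list"
  assumes roots: "\<forall>\<zeta>\<in>set \<zeta>s. cmod \<zeta> = 1"
    and v_summable: "(\<lambda>k. cmod (v k) * wx k) summable_on UNIV"
    and h_summable: "(\<lambda>k. cmod (h k) * wx k) summable_on UNIV"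
    and hinv_summable: "(\<lambda>k. cmod (hinv k) * wx k) summable_on UNIV"
    and ri_summable: "(\<lambda>k. cmod (ri k) * wi k) summable_on UNIV"
    and ro_summable: "(\<lambda>k. cmod (ro k) * wo k) summable_on UNIV"
    and conv_v: "\<And>y B. wbdd wn B y \<Longrightarrow> conv v y = foldr sdiff \<zeta>s (conv h y)"
    and h_hinv: "\<And>m. ((\<lambda>j. h j * hinv (m - j)) has_sum (if m = 0 then 1 else 0)) UNIV"
    and hinv_h: "\<And>m. ((\<lambda>j. hinv j * h (m - j)) has_sum (if m = 0 then 1 else 0)) UNIV"
    and v_ri: "\<And>m. ((\<lambda>j. v j * ri (m - j)) has_sum (if m = 0 then 1 else 0)) UNIV"
    and ri_v: "\<And>m. ((\<lambda>j. ri j * v (m - j)) has_sum (if m = 0 then 1 else 0)) UNIV"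
    and v_ro: "\<And>m. ((\<lambda>j. v j * ro (m - j)) has_sum (if m = 0 then 1 else 0)) UNIV"
    and ro_v: "\<And>m. ((\<lambda>j. ro j * v (m - j)) has_sum (if m = 0 then 1 else 0)) UNIV"
begin

abbreviation "N \<equiv> length \<zeta>s"

definition quot :: "(int \<Rightarrow> complex) \<Rightarrow> int \<Rightarrow> complex" where
  "quot f = conv hinv (foldr root_quot \<zeta>s f)"

definition quot_bound :: real where
  "quot_bound = (\<Sum>\<^sub>\<infinity>k. cmod (hinv k) * wx k) * (\<Prod>\<zeta>\<leftarrow>\<zeta>s. root_bound \<zeta>)"

definition bound_i :: real where "bound_i = (\<Sum>\<^sub>\<infinity>k. cmod (ri k) * wi k)"
definition bound_o :: real where "bound_o = (\<Sum>\<^sub>\<infinity>k. cmod (ro k) * wo k)"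

lemma quot_bounded: "bounded_op wn quot_bound quot"
  unfolding quot_def[abs_def] quot_bound_def
  by (intro bounded_op_comp conv_bounded_op[OF moderate_wn hinv_summable] quot_bounded_op roots)

lemma v_summable_i: "(\<lambda>k. cmod (v k) * wi k) summable_on UNIV"
  by (rule summable_on_comparison_test[OF v_summable]) (use rm in \<open>auto simp: wmax_def intro!: mult_left_mono\<close>)

lemma v_summable_o: "(\<lambda>k. cmod (v k) * wo k) summable_on UNIV"
  by (rule summable_on_comparison_test[OF v_summable]) (use rp in \<open>auto simp: wmax_def intro!: mult_left_mono\<close>)

lemma quot_identity:
  assumes "wbdd wn B f"
  shows "f n = conv v (quot f) n + (\<Sum>p<N. remainder \<zeta>s f p * delta (- 1 - int p) n)"
proof -
  have q: "wbdd wn ((\<Prod>\<zeta>\<leftarrow>\<zeta>s. root_bound \<zeta>) * B) (foldr root_quot \<zeta>s f)"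
    by (rule bounded_opD(2)[OF quot_bounded_op[OF roots] assms])
  have "conv h (quot f) = foldr root_quot \<zeta>s f"
    unfolding quot_def
    using conv_conv[OF moderate_wn hinv_summable h_summable q h_hinv] conv_delta by simp
  then show ?thesis
    using division_identity[OF roots assms, of n] conv_v[OF bounded_opD(2)[OF quot_bounded assms]] by simp
qed

lemma quot_unique:
  assumes y: "wbdd wn B y" and eq: "\<And>n. conv v y n + (\<Sum>p<N. c p * delta (- 1 - int p) n) = 0"
  shows "y = (\<lambda>_. 0) \<and> (\<forall>p<N. c p = 0)"
proof -
  have "conv h y = (\<lambda>_. 0) \<and> (\<forall>p<N. c p = 0)"
    using eq unfolding conv_v[OF y]
    by (rule division_unique[OF roots bounded_opD(2)[OF conv_bounded_op[OF moderate_wn h_summable] y]])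
  moreover have "conv hinv (conv h y) = y"
    using conv_conv[OF moderate_wn h_summable hinv_summable y hinv_h] conv_delta by simp
  ultimately show ?thesis by (auto simp: conv_def)
qed

text \<open>The term b y is itself divided: its quotient is absorbed into \<open>y'\<close> and its
  remainder into \<open>c'\<close>. Uniqueness without perturbation then gives y = quot (b y), and
  the contraction argument applies.\<close>

lemma perturbed_quot_unique:
  assumes b: "\<And>n. cmod (b n) \<le> \<beta>" "0 \<le> \<beta>" "quot_bound * \<beta> < 1"
    and y: "wbdd wn B y" "\<And>n. conv v y n - b n * y n + (\<Sum>p<N. c p * delta (- 1 - int p) n) = 0"
  shows "y = (\<lambda>_. 0) \<and> (\<forall>p<N. c p = 0)"
proof -
  have bdy: "wbdd wn (\<beta> * B) (\<lambda>n. b n * y n)" by (rule wbdd_mult[OF b(1,2) y(1)])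
  define y' where "y' = (\<lambda>n. y n - quot (\<lambda>n. b n * y n) n)"
  define c' where "c' p = c p - remainder \<zeta>s (\<lambda>n. b n * y n) p" for p
  have qy: "wbdd wn (quot_bound * (\<beta> * B)) (quot (\<lambda>n. b n * y n))"
    by (rule bounded_opD(2)[OF quot_bounded bdy])
  have y': "wbdd wn (B + quot_bound * (\<beta> * B)) y'"
    unfolding y'_def by (intro wbdd_diff y qy)
  have "conv v y' n + (\<Sum>p<N. c' p * delta (- 1 - int p) n) = 0" for n
  proof -
    have 1: "conv v y' n = conv v y n - conv v (quot (\<lambda>n. b n * y n)) n"
      unfolding y'_def bounded_op_diff[OF conv_bounded_op[OF moderate_wn v_summable] y(1) qy] ..
    have 2: "(\<Sum>p<N. c' p * delta (- 1 - int p) n) = (\<Sum>p<N. c p * delta (- 1 - int p) n)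
        - (\<Sum>p<N. remainder \<zeta>s (\<lambda>n. b n * y n) p * delta (- 1 - int p) n)"
      by (simp add: c'_def left_diff_distrib sum_subtractf)
    have "conv v y' n + (\<Sum>p<N. c' p * delta (- 1 - int p) n)
        = (conv v y n - b n * y n + (\<Sum>p<N. c p * delta (- 1 - int p) n))
          + (b n * y n - (conv v (quot (\<lambda>n. b n * y n)) n
              + (\<Sum>p<N. remainder \<zeta>s (\<lambda>n. b n * y n) p * delta (- 1 - int p) n)))"
      unfolding 1 2 by simp
    then show ?thesis using quot_identity[OF bdy, of n] y(2)[of n] by simp
  qed
  from quot_unique[OF y' this] have q: "y' = (\<lambda>_. 0)" by blast
  have "y = quot (\<lambda>n. b n * y n)"
  proof
    fix n
    have "y' n = 0" unfolding q(1) ..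
    then show "y n = quot (\<lambda>n. b n * y n) n"
      unfolding y'_def by (rule eq_iff_diff_eq_0[THEN iffD2])
  qed
  then have "y = (\<lambda>_. 0)"
    by (rule perturbed_op_unique[OF quot_bounded _ b y(1), rotated]) (rule less_imp_le[OF wn_pos])
  moreover have "c p = 0" if "p < N" for p
  proof -
    have "(\<Sum>q<N. c q * delta (- 1 - int q) (- 1 - int p)) = (\<Sum>q<N. if q = p then c q else 0)"
      by (intro sum.cong) (auto simp: delta_def)
    then show ?thesis using y(2)[of "- 1 - int p"] that calculation by (simp add: conv_def)
  qed
  ultimately show ?thesis by blast
qed

end

locale symbol_algebra = symbol rm rp v h hinv ri ro \<zeta>s + uniform_algebra X P
  for rm rp v h hinv ri ro \<zeta>s and X :: "'x set" and P
begin

sublocale radii_algebra by unfold_locales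

lemma quot_preserves': "preserves wn quot"
  unfolding quot_def[abs_def]
  by (rule preserves_comp[OF conv_preserves[OF moderate_wn hinv_summable] quot_bounded_op[OF roots] quot_preserves[OF roots]])

text \<open>Fixed point y = quot (f + b y): applying \<open>conv v\<close> returns f + b y up to its
  remainder, and this remainder inherits the regularity of f + b y in the parameter.\<close>

lemma perturbed_quot_solution:
  assumes b: "\<And>n. P (\<lambda>x. b x n)" "\<And>x n. x \<in> X \<Longrightarrow> cmod (b x n) \<le> \<beta>" "0 \<le> \<beta>" "quot_bound * \<beta> < 1"
    and f: "family wn B f" "0 \<le> B"
  shows "\<exists>y. family wn (quot_bound * B / (1 - quot_bound * \<beta>)) y \<and>
    (\<forall>p. P (\<lambda>x. remainder \<zeta>s (\<lambda>n. f x n + b x n * y x n) p)) \<and>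
    (\<forall>x\<in>X. \<forall>n. conv v (y x) n - b x n * y x n
        + (\<Sum>p<N. remainder \<zeta>s (\<lambda>n. f x n + b x n * y x n) p * delta (- 1 - int p) n) = f x n)"
proof -
  have w0: "0 \<le> wn n" for n using wn_pos[of n] by simp
  obtain y where y: "family wn (quot_bound * B / (1 - quot_bound * \<beta>)) y"
    and eq: "\<And>x. x \<in> X \<Longrightarrow> y x = quot (\<lambda>n. f x n + b x n * y x n)"
    using perturbed_op_solution[where b = b, OF quot_bounded quot_preserves' w0 b f] by blast
  have fam: "family wn (B + \<beta> * (quot_bound * B / (1 - quot_bound * \<beta>))) (\<lambda>x n. f x n + b x n * y x n)"
    unfolding family_def
  proof (intro conjI allI ballI)
    show "P (\<lambda>x. f x n + b x n * y x n)" for n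
      using f(1) y b(1) by (intro add mult) (auto simp: family_def)
    show "wbdd wn (B + \<beta> * (quot_bound * B / (1 - quot_bound * \<beta>))) (\<lambda>n. f x n + b x n * y x n)"
      if "x \<in> X" for x
      by (intro wbdd_add wbdd_mult b that) (use f(1) y that in \<open>auto simp: family_def\<close>)
  qed
  show ?thesis
  proof (intro exI conjI allI ballI)
    show "family wn (quot_bound * B / (1 - quot_bound * \<beta>)) y" by (rule y)
    show "P (\<lambda>x. remainder \<zeta>s (\<lambda>n. f x n + b x n * y x n) p)" for p
      by (rule remainder_preserves[OF roots fam])
    show "conv v (y x) n - b x n * y x n
        + (\<Sum>p<N. remainder \<zeta>s (\<lambda>n. f x n + b x n * y x n) p * delta (- 1 - int p) n) = f x n"
      if x: "x \<in> X" for x n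
    proof -
      have wb: "wbdd wn (B + \<beta> * (quot_bound * B / (1 - quot_bound * \<beta>))) (\<lambda>n. f x n + b x n * y x n)"
        using fam x by (simp add: family_def)
      show ?thesis using quot_identity[OF wb, of n] unfolding eq[OF x, symmetric] by (simp add: algebra_simps)
    qed
  qed
qed

end

section \<open>Center solutions of the perturbed operator\<close>

text \<open>Makes the lemmas on parametrised solutions available for a single sequence.\<close>

lemma trivial_uniform_algebra: "uniform_algebra (UNIV :: unit set) (\<lambda>_. True)"
  by unfold_locales auto

context symbol
begin

definition opT :: "(int \<Rightarrow> complex) \<Rightarrow> (int \<Rightarrow> complex) \<Rightarrow> int \<Rightarrow> complex" where
  "opT b y n = conv v y n - b n * y n"

text \<open>One smallness condition for the three Neumann series: those in the classes of the inner
  and the outer circle, and that for division on doubly decaying sequences.\<close>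

definition small_bound :: "real \<Rightarrow> bool" where
  "small_bound \<beta> \<longleftrightarrow> 0 \<le> \<beta> \<and> bound_i * \<beta> < 1 \<and> bound_o * \<beta> < 1 \<and> quot_bound * \<beta> < 1"

definition small :: "(int \<Rightarrow> complex) \<Rightarrow> bool" where
  "small b \<longleftrightarrow> (\<exists>\<beta>. small_bound \<beta> \<and> (\<forall>n. cmod (b n) \<le> \<beta>))"

definition wb :: "(int \<Rightarrow> real) \<Rightarrow> (int \<Rightarrow> complex) \<Rightarrow> bool" where
  "wb w y \<longleftrightarrow> (\<exists>B. wbdd w B y)"

lemma wb_wbdd: "wbdd w B y \<Longrightarrow> wb w y"
  by (auto simp: wb_def)

lemma wb_add: "wb w f \<Longrightarrow> wb w g \<Longrightarrow> wb w (\<lambda>n. f n + g n)"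
  unfolding wb_def using wbdd_add by blast

lemma wb_diff: "wb w f \<Longrightarrow> wb w g \<Longrightarrow> wb w (\<lambda>n. f n - g n)"
  unfolding wb_def using wbdd_diff by blast

lemma wb_cmult: "wb w f \<Longrightarrow> wb w (\<lambda>n. c * f n)"
  unfolding wb_def using wbdd_cmult by blast

lemma wb_sum: "(\<And>n. 0 < w n) \<Longrightarrow> (\<And>i. i \<in> I \<Longrightarrow> wb w (f i)) \<Longrightarrow> wb w (\<lambda>n. \<Sum>i\<in>I. f i n)"
proof (induction I rule: infinite_finite_induct)
  case (insert i I)
  then show ?case using wb_add[of w "f i" "\<lambda>n. \<Sum>i\<in>I. f i n"] by simp
qed (auto intro!: wb_wbdd wbdd_zero[of w 0] simp: less_imp_le)

lemma wi_pos: "0 < wi n" using rm by simp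
lemma wo_pos: "0 < wo n" using rp by simp

lemma wb_wx: "wb wi y \<Longrightarrow> wb wx y" "wb wo y \<Longrightarrow> wb wx y"
proof -
  assume "wb wi y"
  then obtain B where B: "wbdd wi B y" by (auto simp: wb_def)
  have "0 \<le> B" by (rule wbdd_nonneg[where w = wi and n = 0, OF wi_pos B])
  from wbdd_weight_mono[OF B this wx_ge(1)] show "wb wx y" by (rule wb_wbdd)
next
  assume "wb wo y"
  then obtain B where B: "wbdd wo B y" by (auto simp: wb_def)
  have "0 \<le> B" by (rule wbdd_nonneg[where w = wo and n = 0, OF wo_pos B])
  from wbdd_weight_mono[OF B this wx_ge(2)] show "wb wx y" by (rule wb_wbdd)
qed

lemma wb_wn: "wb wn y \<longleftrightarrow> wb wi y \<and> wb wo y"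
  unfolding wb_def using wbdd_wnD wbdd_wnI by blast

lemma wb_delta: "wb wn (delta a)" "wb wi (delta a)" "wb wo (delta a)"
proof -
  show "wb wn (delta a)" by (rule wb_wbdd[OF delta_wbdd[where w = wn, OF wn_pos]])
  then show "wb wi (delta a)" "wb wo (delta a)" by (simp_all add: wb_wn)
qed

lemmas conv_v_op = conv_bounded_op[OF moderate_wx v_summable]

lemma opT_add:
  assumes "wb wx f" "wb wx g"
  shows "opT b (\<lambda>n. f n + g n) = (\<lambda>n. opT b f n + opT b g n)"
proof -
  obtain B B' where "wbdd wx B f" "wbdd wx B' g" using assms by (auto simp: wb_def)
  from bounded_opD(3)[OF conv_v_op this] show ?thesis
    by (simp add: opT_def[abs_def] algebra_simps)
qed

lemma opT_cmult:
  assumes "wb wx f"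
  shows "opT b (\<lambda>n. c * f n) = (\<lambda>n. c * opT b f n)"
proof -
  obtain B where "wbdd wx B f" using assms by (auto simp: wb_def)
  from bounded_opD(4)[OF conv_v_op this] show ?thesis
    by (simp add: opT_def[abs_def] algebra_simps)
qed

lemma opT_diff:
  assumes "wb wx f" "wb wx g"
  shows "opT b (\<lambda>n. f n - g n) = (\<lambda>n. opT b f n - opT b g n)"
proof -
  obtain B B' where "wbdd wx B f" "wbdd wx B' g" using assms by (auto simp: wb_def)
  from bounded_op_diff[OF conv_v_op this] show ?thesis
    by (simp add: opT_def[abs_def] algebra_simps)
qed

lemma opT_sum:
  assumes "\<And>i. i \<in> I \<Longrightarrow> wb wx (f i)"
  shows "opT b (\<lambda>n. \<Sum>i\<in>I. f i n) = (\<lambda>n. \<Sum>i\<in>I. opT b (f i) n)"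
  using assms
proof (induction I rule: infinite_finite_induct)
  case (insert i I)
  then show ?case using opT_add[OF _ wb_sum[OF wx_pos], of "f i" I f b] by simp
qed (auto simp: opT_def conv_def)

lemma opT_wb:
  assumes b: "small b" and w: "moderate M w" and v: "(\<lambda>k. cmod (v k) * M k) summable_on UNIV" and y: "wb w y"
  shows "wb w (opT b y)"
proof -
  obtain B where B: "wbdd w B y" using y by (auto simp: wb_def)
  obtain \<beta> where \<beta>: "0 \<le> \<beta>" "\<And>n. cmod (b n) \<le> \<beta>" using b by (auto simp: small_def small_bound_def)
  show ?thesis
    unfolding opT_def[abs_def]
    by (rule wb_wbdd[OF wbdd_diff[OF bounded_opD(2)[OF conv_bounded_op[OF w v] B] wbdd_mult[OF \<beta>(2,1) B]]])
qed

lemma opT_unique_i: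
  assumes "small b" "wb wi y" "\<And>n. opT b y n = 0"
  shows "y = (\<lambda>_. 0)"
proof -
  obtain \<beta> where \<beta>: "0 \<le> \<beta>" "\<And>n. cmod (b n) \<le> \<beta>" "bound_i * \<beta> < 1"
    using assms(1) by (auto simp: small_def small_bound_def)
  obtain B where B: "wbdd wi B y" using assms by (auto simp: wb_def)
  show ?thesis
    by (rule inverse_perturbed_unique[where b = b, OF mod_i v_summable_i ri_summable ri_v \<beta>(2,1) \<beta>(3)[unfolded bound_i_def] B])
      (use assms(3) in \<open>simp add: opT_def\<close>)
qed

lemma opT_unique_o:
  assumes "small b" "wb wo y" "\<And>n. opT b y n = 0"
  shows "y = (\<lambda>_. 0)"
proof -
  obtain \<beta> where \<beta>: "0 \<le> \<beta>" "\<And>n. cmod (b n) \<le> \<beta>" "bound_o * \<beta> < 1"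
    using assms(1) by (auto simp: small_def small_bound_def)
  obtain B where B: "wbdd wo B y" using assms by (auto simp: wb_def)
  show ?thesis
    by (rule inverse_perturbed_unique[where b = b, OF mod_o v_summable_o ro_summable ro_v \<beta>(2,1) \<beta>(3)[unfolded bound_o_def] B])
      (use assms(3) in \<open>simp add: opT_def\<close>)
qed

lemma opT_eq_i:
  assumes "small b" "wb wi y" "wb wi z" "opT b y = opT b z"
  shows "y = z"
proof -
  have "(\<lambda>n. y n - z n) = (\<lambda>_. 0)"
    using assms opT_diff[of y z b] wb_wx by (intro opT_unique_i[OF assms(1)] wb_diff) auto
  then show ?thesis by (simp add: fun_eq_iff)
qed

lemma opT_eq_o:
  assumes "small b" "wb wo y" "wb wo z" "opT b y = opT b z"
  shows "y = z"
proof -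
  have "(\<lambda>n. y n - z n) = (\<lambda>_. 0)"
    using assms opT_diff[of y z b] wb_wx by (intro opT_unique_o[OF assms(1)] wb_diff) auto
  then show ?thesis by (simp add: fun_eq_iff)
qed

lemma opT_unique_n:
  assumes "small b" "wb wn y" "\<And>n. opT b y n + (\<Sum>p<N. c p * delta (- 1 - int p) n) = 0"
  shows "y = (\<lambda>_. 0) \<and> (\<forall>p<N. c p = 0)"
proof -
  obtain \<beta> where \<beta>: "0 \<le> \<beta>" "\<And>n. cmod (b n) \<le> \<beta>" "quot_bound * \<beta> < 1"
    using assms(1) by (auto simp: small_def small_bound_def)
  obtain B where B: "wbdd wn B y" using assms by (auto simp: wb_def)
  show ?thesis
    by (rule perturbed_quot_unique[where b = b, OF \<beta>(2,1,3) B]) (use assms(3) in \<open>simp add: opT_def\<close>)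
qed

lemma opT_solution_i:
  assumes "small b" "wb wi f"
  shows "\<exists>y. wb wi y \<and> opT b y = f"
proof -
  interpret uniform_algebra "UNIV :: unit set" "\<lambda>_. True" by (rule trivial_uniform_algebra)
  obtain \<beta> where \<beta>: "0 \<le> \<beta>" "\<And>n. cmod (b n) \<le> \<beta>" "bound_i * \<beta> < 1"
    using assms(1) by (auto simp: small_def small_bound_def)
  obtain B where B: "wbdd wi B f" using assms by (auto simp: wb_def)
  have B0: "0 \<le> B" by (rule wbdd_nonneg[where w = wi and n = 0, OF wi_pos B])
  have "\<exists>y B'. family wi B' y \<and> (\<forall>x\<in>UNIV. \<forall>n. conv v (y x) n - b n * y x n = f n)"
    by (rule inverse_perturbed_solution[OF mod_i v_summable_i ri_summable v_ri, where b = "\<lambda>_. b" and f = "\<lambda>_. f" and B = B])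
      (use \<beta> B B0 in \<open>auto simp: family_def bound_i_def\<close>)
  then show ?thesis
    unfolding opT_def wb_def family_def by (auto simp: fun_eq_iff)
qed

lemma opT_solution_o:
  assumes "small b" "wb wo f"
  shows "\<exists>y. wb wo y \<and> opT b y = f"
proof -
  interpret uniform_algebra "UNIV :: unit set" "\<lambda>_. True" by (rule trivial_uniform_algebra)
  obtain \<beta> where \<beta>: "0 \<le> \<beta>" "\<And>n. cmod (b n) \<le> \<beta>" "bound_o * \<beta> < 1"
    using assms(1) by (auto simp: small_def small_bound_def)
  obtain B where B: "wbdd wo B f" using assms by (auto simp: wb_def)
  have B0: "0 \<le> B" by (rule wbdd_nonneg[where w = wo and n = 0, OF wo_pos B])
  have "\<exists>y B'. family wo B' y \<and> (\<forall>x\<in>UNIV. \<forall>n. conv v (y x) n - b n * y x n = f n)"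
    by (rule inverse_perturbed_solution[OF mod_o v_summable_o ro_summable v_ro, where b = "\<lambda>_. b" and f = "\<lambda>_. f" and B = B])
      (use \<beta> B B0 in \<open>auto simp: family_def bound_o_def\<close>)
  then show ?thesis
    unfolding opT_def wb_def family_def by (auto simp: fun_eq_iff)
qed

lemma opT_solution_n:
  assumes "small b" "wb wn f"
  shows "\<exists>y c. wb wn y \<and> (\<forall>n. opT b y n + (\<Sum>p<N. c p * delta (- 1 - int p) n) = f n)"
proof -
  interpret symbol_algebra rm rp v h hinv ri ro \<zeta>s "UNIV :: unit set" "\<lambda>_. True"
    by (intro symbol_algebra.intro trivial_uniform_algebra) unfold_locales
  obtain \<beta> where \<beta>: "0 \<le> \<beta>" "\<And>n. cmod (b n) \<le> \<beta>" "quot_bound * \<beta> < 1"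
    using assms(1) by (auto simp: small_def small_bound_def)
  obtain B where B: "wbdd wn B f" using assms by (auto simp: wb_def)
  have B0: "0 \<le> B" by (rule wbdd_wn_nonneg[OF B])
  have "\<exists>y. family wn (quot_bound * B / (1 - quot_bound * \<beta>)) y \<and>
    (\<forall>p. True) \<and>
    (\<forall>x\<in>UNIV. \<forall>n. conv v (y x) n - b n * y x n
        + (\<Sum>p<N. remainder \<zeta>s (\<lambda>n. f n + b n * y x n) p * delta (- 1 - int p) n) = f n)"
    using perturbed_quot_solution[where b = "\<lambda>_. b" and f = "\<lambda>_. f" and B = B and \<beta> = \<beta>] \<beta> B B0
    by (simp add: family_def)
  then show ?thesis
    unfolding opT_def wb_def family_def by blast
qed

text \<open>The Green function with source at \<open>a\<close> in the growth class of the inner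
  circle; for small \<open>b\<close> the choice is forced by \<open>opT_eq_i\<close>.\<close>

definition green_i :: "(int \<Rightarrow> complex) \<Rightarrow> int \<Rightarrow> int \<Rightarrow> complex" where
  "green_i b a = (SOME y. wb wi y \<and> opT b y = delta a)"

definition green_o :: "(int \<Rightarrow> complex) \<Rightarrow> int \<Rightarrow> int \<Rightarrow> complex" where
  "green_o b a = (SOME y. wb wo y \<and> opT b y = delta a)"

text \<open>Both Green functions have the same source, which cancels in the difference and leaves,
  for small \<open>b\<close>, a homogeneous solution of size O(\<open>wmax\<close>).\<close>

definition mode :: "(int \<Rightarrow> complex) \<Rightarrow> int \<Rightarrow> int \<Rightarrow> complex" where
  "mode b a n = green_o b a n - green_i b a n"

definition center :: "(int \<Rightarrow> complex) \<Rightarrow> (int \<Rightarrow> complex) set" where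
  "center b = {u. wb wx u \<and> opT b u = (\<lambda>_. 0)}"

lemma green_i: assumes "small b" shows "wb wi (green_i b a)" "opT b (green_i b a) = delta a"
  using someI_ex[OF opT_solution_i[OF assms wb_delta(2)]] unfolding green_i_def by blast+

lemma green_o: assumes "small b" shows "wb wo (green_o b a)" "opT b (green_o b a) = delta a"
  using someI_ex[OF opT_solution_o[OF assms wb_delta(3)]] unfolding green_o_def by blast+

lemma green_i_eqI: "small b \<Longrightarrow> wb wi y \<Longrightarrow> opT b y = delta a \<Longrightarrow> green_i b a = y"
  using opT_eq_i green_i by metis

lemma green_o_eqI: "small b \<Longrightarrow> wb wo y \<Longrightarrow> opT b y = delta a \<Longrightarrow> green_o b a = y"
  using opT_eq_o green_o by metis

lemma green_o_sum:
  assumes b: "small b"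
  shows "wb wo (\<lambda>n. \<Sum>p\<in>I. c p * green_o b (a p) n)"
    and "opT b (\<lambda>n. \<Sum>p\<in>I. c p * green_o b (a p) n) = (\<lambda>n. \<Sum>p\<in>I. c p * delta (a p) n)"
proof -
  have x: "wb wx (green_o b k)" for k by (rule wb_wx(2)[OF green_o(1)[OF b]])
  show "wb wo (\<lambda>n. \<Sum>p\<in>I. c p * green_o b (a p) n)"
    by (intro wb_sum wo_pos wb_cmult green_o b)
  show "opT b (\<lambda>n. \<Sum>p\<in>I. c p * green_o b (a p) n) = (\<lambda>n. \<Sum>p\<in>I. c p * delta (a p) n)"
    by (subst opT_sum) (auto intro!: wb_cmult x simp: opT_cmult[OF x] green_o(2)[OF b])
qed

lemma green_i_sum:
  assumes b: "small b"
  shows "wb wi (\<lambda>n. \<Sum>p\<in>I. c p * green_i b (a p) n)"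
    and "opT b (\<lambda>n. \<Sum>p\<in>I. c p * green_i b (a p) n) = (\<lambda>n. \<Sum>p\<in>I. c p * delta (a p) n)"
proof -
  have x: "wb wx (green_i b k)" for k by (rule wb_wx(1)[OF green_i(1)[OF b]])
  show "wb wi (\<lambda>n. \<Sum>p\<in>I. c p * green_i b (a p) n)"
    by (intro wb_sum wi_pos wb_cmult green_i b)
  show "opT b (\<lambda>n. \<Sum>p\<in>I. c p * green_i b (a p) n) = (\<lambda>n. \<Sum>p\<in>I. c p * delta (a p) n)"
    by (subst opT_sum) (auto intro!: wb_cmult x simp: opT_cmult[OF x] green_i(2)[OF b])
qed

lemma mode_center: "small b \<Longrightarrow> mode b a \<in> center b"
  unfolding center_def mode_def[abs_def]
  using green_i green_o opT_diff[of "green_o b a" "green_i b a" b] wb_wx by (auto intro!: wb_diff)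

text \<open>Cut a center solution \<open>u\<close> into its two halves \<open>u = up + un\<close>. Then \<open>opT b up = - opT b un\<close> decays in both
  directions, so it has a quotient and a remainder there, and the coefficients of the remainder are
  the coordinates of \<open>u\<close>.\<close>

lemma mode_span:
  assumes b: "small b" and u: "u \<in> center b"
  shows "\<exists>c. u = (\<lambda>k. \<Sum>p<N. c p * mode b (- 1 - int p) k)"
proof -
  define up where "up n = (if 0 \<le> n then u n else 0)" for n :: int
  define un where "un n = (if 0 \<le> n then 0 else u n)" for n :: int
  obtain B where B: "wbdd wx B u" using u by (auto simp: center_def wb_def)
  have B0: "0 \<le> B" by (rule wbdd_nonneg[where w = wx and n = 0, OF wx_pos B])
  have "cmod (up n) \<le> B * wo n" for n
    using wbddD[OF B, of n] B0 rm rp by (auto simp: up_def wmax_nonneg_index)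
  then have up: "wb wo up" by (intro wb_wbdd[of _ B]) (simp add: wbdd_def)
  have "cmod (un n) \<le> B * wi n" for n
    using wbddD[OF B, of n] B0 rm rp by (auto simp: un_def wmax_neg_index)
  then have un: "wb wi un" by (intro wb_wbdd[of _ B]) (simp add: wbdd_def)
  have u_split: "u = (\<lambda>n. up n + un n)" by (auto simp: up_def un_def)
  have "opT b u = (\<lambda>n. opT b up n + opT b un n)"
    by (subst u_split) (intro opT_add wb_wx up un)
  moreover have "opT b u = (\<lambda>_. 0)" using u by (simp add: center_def)
  ultimately have T: "opT b up n + opT b un n = 0" for n by metis
  define f where "f = opT b up"
  have "wb wo f" unfolding f_def by (rule opT_wb[OF b mod_o v_summable_o up])
  moreover have "f = (\<lambda>n. (- 1) * opT b un n)"
    using T by (auto simp: f_def eq_neg_iff_add_eq_0)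
  then have "wb wi f" using wb_cmult[OF opT_wb[OF b mod_i v_summable_i un], of "- 1"] by simp
  ultimately have "wb wn f" by (simp add: wb_wn)
  then obtain y c where y: "wb wn y" and yc: "\<And>n. opT b y n + (\<Sum>p<N. c p * delta (- 1 - int p) n) = f n"
    using opT_solution_n[OF b] by blast
  define so where "so = (\<lambda>n. \<Sum>p<N. c p * green_o b (- 1 - int p) n)"
  define si where "si = (\<lambda>n. \<Sum>p<N. c p * green_i b (- 1 - int p) n)"
  have yi: "wb wi y" and yo: "wb wo y" using y by (auto simp: wb_wn)
  have so: "wb wo so" and Tso: "opT b so = (\<lambda>n. \<Sum>p<N. c p * delta (- 1 - int p) n)"
    unfolding so_def by (rule green_o_sum[OF b])+
  have si: "wb wi si" and Tsi: "opT b si = (\<lambda>n. \<Sum>p<N. c p * delta (- 1 - int p) n)"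
    unfolding si_def by (rule green_i_sum[OF b])+
  \<comment> \<open>Each half is identified by uniqueness in its own class. The quotient
    \<open>y\<close> lies in both classes and enters the two halves with opposite signs, so it
    cancels in their sum.\<close>
  have "up = (\<lambda>n. y n + so n)"
  proof (rule opT_eq_o[OF b up wb_add[OF yo so]])
    show "opT b up = opT b (\<lambda>n. y n + so n)"
      unfolding opT_add[OF wb_wx(2)[OF yo] wb_wx(2)[OF so]] Tso yc f_def ..
  qed
  moreover have "(\<lambda>n. (- 1) * un n) = (\<lambda>n. y n + si n)"
  proof (rule opT_eq_i[OF b wb_cmult[OF un] wb_add[OF yi si]])
    show "opT b (\<lambda>n. (- 1) * un n) = opT b (\<lambda>n. y n + si n)"
      unfolding opT_add[OF wb_wx(1)[OF yi] wb_wx(1)[OF si]] Tsi yc opT_cmult[OF wb_wx(1)[OF un]]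
      using \<open>f = (\<lambda>n. (- 1) * opT b un n)\<close> by simp
  qed
  ultimately have "up n = y n + so n" "- un n = y n + si n" for n by (metis, metis mult_minus1)
  then have "u n = so n - si n" for n
    using fun_cong[OF u_split, of n] by (metis add_diff_cancel_left add_uminus_conv_diff diff_minus_eq_add minus_minus)
  then have "u = (\<lambda>k. \<Sum>p<N. c p * mode b (- 1 - int p) k)"
    by (auto simp: so_def si_def mode_def right_diff_distrib sum_subtractf)
  then show ?thesis by blast
qed

text \<open>If the combination vanishes, the outer and the inner sum of Green functions coincide and
  therefore decay in both directions. They would exhibit a combination of unit sequences in the
  range on such sequences, and uniqueness of division forces its coefficients to be 0.\<close>

lemma mode_independent:
  assumes b: "small b" and c: "\<And>k. (\<Sum>p<N. c p * mode b (- 1 - int p) k) = 0"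
  shows "\<forall>p<N. c p = 0"
proof -
  define so where "so = (\<lambda>n. \<Sum>p<N. c p * green_o b (- 1 - int p) n)"
  define si where "si = (\<lambda>n. \<Sum>p<N. c p * green_i b (- 1 - int p) n)"
  have so: "wb wo so" and Tso: "opT b so = (\<lambda>n. \<Sum>p<N. c p * delta (- 1 - int p) n)"
    unfolding so_def by (rule green_o_sum[OF b])+
  have si: "wb wi si" unfolding si_def by (rule green_i_sum(1)[OF b])
  have "so n = si n" for n
    using c[of n] by (simp add: so_def si_def mode_def right_diff_distrib sum_subtractf)
  then have "so = si" by auto
  with so si have "wb wn so" by (simp add: wb_wn)
  from wb_cmult[OF this, of "- 1"] have n: "wb wn (\<lambda>n. (- 1) * so n)" .
  have "opT b (\<lambda>n. (- 1) * so n) n + (\<Sum>p<N. c p * delta (- 1 - int p) n) = 0" for n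
    unfolding opT_cmult[OF wb_wx(2)[OF so]] Tso by simp
  from opT_unique_n[OF b n this] show ?thesis by blast
qed

section \<open>Shifts and reduction of modes\<close>

lemma shift_wb:
  assumes "moderate M w" "wb w y"
  shows "wb w (shift m y)"
proof -
  obtain B where B: "wbdd w B y" using assms by (auto simp: wb_def)
  have B0: "0 \<le> B" by (rule wbdd_nonneg[where w = w and n = 0, OF moderate_pos[OF assms(1)] B])
  have "cmod (y (n + m)) \<le> B * M m * w n" for n
    using wbddD[OF B, of "n + m"] mult_left_mono[OF moderate_le[OF assms(1), of n m] B0]
    by (simp add: mult.assoc)
  then show ?thesis by (intro wb_wbdd[of _ "B * M m"]) (simp add: wbdd_def shift_def)
qed

lemma small_shift: "small b \<Longrightarrow> small (shift m b)"
  unfolding small_def shift_def by blast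

lemma opT_shift: "opT (shift m b) (shift m y) = shift m (opT b y)"
  by (auto simp: opT_def conv_def shift_def add_ac)

lemma shift_delta: "shift m (delta a) = delta (a - m)"
  by (auto simp: shift_def delta_def)

text \<open>Uniqueness in each class: the shifted Green function solves the equation of the shifted
  potential with source a - m.\<close>

lemma mode_shift:
  assumes b: "small b"
  shows "shift m (mode b a) = mode (shift m b) (a - m)"
proof -
  have "green_i (shift m b) (a - m) = shift m (green_i b a)"
    using b by (intro green_i_eqI small_shift shift_wb[OF mod_i] green_i)
      (simp_all add: opT_shift green_i shift_delta)
  moreover have "green_o (shift m b) (a - m) = shift m (green_o b a)"
    using b by (intro green_o_eqI small_shift shift_wb[OF mod_o] green_o)
      (simp_all add: opT_shift green_o shift_delta)
  ultimately show ?thesis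
    by (auto simp: mode_def shift_def fun_eq_iff)
qed

text \<open>The quotient \<open>y\<close> lies in both growth classes, so it enters both Green
  functions and drops out of their difference; a mode depends on its source only modulo the range on
  doubly decaying sequences.\<close>

lemma mode_reduction:
  assumes b: "small b" and y: "wb wn y"
    and eq: "\<And>n. opT b y n + (\<Sum>p<N. c p * delta (- 1 - int p) n) = delta a n"
  shows "mode b a = (\<lambda>k. \<Sum>p<N. c p * mode b (- 1 - int p) k)"
proof -
  define so where "so = (\<lambda>n. \<Sum>p<N. c p * green_o b (- 1 - int p) n)"
  define si where "si = (\<lambda>n. \<Sum>p<N. c p * green_i b (- 1 - int p) n)"
  have yi: "wb wi y" and yo: "wb wo y" using y by (auto simp: wb_wn)
  have so: "wb wo so" and Tso: "opT b so = (\<lambda>n. \<Sum>p<N. c p * delta (- 1 - int p) n)"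
    unfolding so_def by (rule green_o_sum[OF b])+
  have si: "wb wi si" and Tsi: "opT b si = (\<lambda>n. \<Sum>p<N. c p * delta (- 1 - int p) n)"
    unfolding si_def by (rule green_i_sum[OF b])+
  have "green_o b a = (\<lambda>n. y n + so n)"
    by (rule green_o_eqI[OF b wb_add[OF yo so]])
      (simp add: opT_add[OF wb_wx(2)[OF yo] wb_wx(2)[OF so]] Tso eq)
  moreover have "green_i b a = (\<lambda>n. y n + si n)"
    by (rule green_i_eqI[OF b wb_add[OF yi si]])
      (simp add: opT_add[OF wb_wx(1)[OF yi] wb_wx(1)[OF si]] Tsi eq)
  ultimately show ?thesis
    by (auto simp: mode_def so_def si_def right_diff_distrib sum_subtractf)
qed

lemma center_shift: "u \<in> center b \<Longrightarrow> shift m u \<in> center (shift m b)"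
  unfolding center_def using shift_wb[OF moderate_wx] opT_shift[of m b u] by (auto simp: shift_def)

end

section \<open>Bounded analytic functions on the torus strip\<close>

text \<open>\<open>C_omega\<close> without extensionality, so that pointwise operations do not lead
  out of it.\<close>

definition hol_torus :: "real \<Rightarrow> (complex ^ 'd::finite \<Rightarrow> complex) \<Rightarrow> bool" where
  "hol_torus h f \<longleftrightarrow> holo_several f (torus_strip h) \<and> bounded (f ` torus_strip h) \<and>
     (\<forall>\<theta>\<in>torus_strip h. \<forall>j. f (\<theta> + axis j 1) = f \<theta>)"

section \<open>The strip and complex lines in it\<close>

lemma norm_vector_cmult:
  fixes v :: "complex ^ 'd::finite"
  shows "norm (c *s v) = cmod c * norm v"
  unfolding norm_vec_def by (simp add: norm_mult L2_set_right_distrib)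

lemma vector_cmult_simps:
  fixes v w :: "complex ^ 'd::finite"
  shows "(c + d) *s v = c *s v + d *s v" "0 *s v = 0" "1 *s v = v" "c *s (d *s v) = (c * d) *s v"
    "c *s (v + w) = c *s v + c *s w"
  by (simp_all add: Finite_Cartesian_Product.vec_eq_iff algebra_simps)

lemma bounded_linear_vector_cmult:
  fixes v :: "complex ^ 'd::finite"
  shows "bounded_linear (\<lambda>t. t *s v)"
  by (rule bounded_linear_intro[of _ "norm v"])
    (auto simp: Finite_Cartesian_Product.vec_eq_iff algebra_simps norm_vector_cmult)

lemma open_torus_strip: "open (torus_strip h :: (complex ^ 'd::finite) set)"
proof -
  have eq: "torus_strip h = (\<Inter>j::'d. {\<theta>. \<bar>Im (vec_nth \<theta> j)\<bar> < h})"
    by (auto simp: torus_strip_def)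
  show ?thesis
    unfolding eq by (intro open_INT finite ballI open_Collect_less continuous_intros)
qed

lemma torus_strip_axis: "\<theta> \<in> torus_strip h \<Longrightarrow> \<theta> + axis j 1 \<in> torus_strip h"
  by (auto simp: torus_strip_def axis_def)

lemma rot_in_torus_strip: "rot \<alpha> n \<theta> \<in> torus_strip h \<longleftrightarrow> \<theta> \<in> torus_strip h"
  by (simp add: torus_strip_def rot_def cvec_def)

lemma rot_rot: "rot \<alpha> m (rot \<alpha> n \<theta>) = rot \<alpha> (n + m) \<theta>"
  by (simp add: rot_def Finite_Cartesian_Product.vec_eq_iff algebra_simps)

lemma rot_0: "rot \<alpha> 0 \<theta> = \<theta>"
  by (simp add: rot_def Finite_Cartesian_Product.vec_eq_iff)

text \<open>Cauchy's inequality at radius R / 2 gives 1! * B / (R / 2) for the first derivative and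
  2! * B / (R / 2) ^ 2 for the second, which bounds the Taylor remainder. For R \<ge> 4 the discs of
  radius R / 2 around points of the closed unit disc stay inside the domain.\<close>

lemma cauchy_remainder:
  fixes \<phi> :: "complex \<Rightarrow> complex"
  assumes \<phi>: "\<phi> holomorphic_on ball 0 R" and B: "\<And>t. t \<in> ball 0 R \<Longrightarrow> cmod (\<phi> t) \<le> B"
  shows "0 < R \<Longrightarrow> cmod (deriv \<phi> 0) \<le> 2 * B / R"
    and "4 \<le> R \<Longrightarrow> cmod (\<phi> 1 - \<phi> 0 - deriv \<phi> 0) \<le> 8 * B / R\<^sup>2"
proof -
  have cont: "continuous_on S \<phi>" if "S \<subseteq> ball 0 R" for S
    using holomorphic_on_imp_continuous_on[OF \<phi>] continuous_on_subset that by blast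
  {
    assume R: "0 < R"
    have "cmod ((deriv ^^ 1) \<phi> 0) \<le> fact 1 * B / (R / 2) ^ 1"
    proof (rule Cauchy_inequality)
      show "\<phi> holomorphic_on ball 0 (R / 2)" using R by (intro holomorphic_on_subset[OF \<phi>]) auto
      show "continuous_on (cball 0 (R / 2)) \<phi>" using R by (intro cont) auto
    qed (use R in \<open>auto intro!: B\<close>)
    then show "cmod (deriv \<phi> 0) \<le> 2 * B / R" by (simp add: mult.commute)
  }
  {
    assume R: "4 \<le> R"
    have d2: "cmod ((deriv ^^ 2) \<phi> x) \<le> 8 * B / R\<^sup>2" if x: "x \<in> cball 0 1" for x
    proof -
      have sub: "cball x (R / 2) \<subseteq> ball 0 R"
      proof
        fix y assume "y \<in> cball x (R / 2)"
        then have "cmod (y - x) \<le> R / 2" by (simp add: dist_norm norm_minus_commute)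
        moreover have "cmod x \<le> 1" using x by simp
        moreover have "cmod y \<le> cmod (y - x) + cmod x" by (metis diff_add_cancel norm_triangle_ineq)
        ultimately show "y \<in> ball 0 R" using R by simp
      qed
      have "cmod ((deriv ^^ 2) \<phi> x) \<le> fact 2 * B / (R / 2) ^ 2"
      proof (rule Cauchy_inequality)
        show "\<phi> holomorphic_on ball x (R / 2)"
          using sub ball_subset_cball by (intro holomorphic_on_subset[OF \<phi>]) blast
        show "continuous_on (cball x (R / 2)) \<phi>" by (rule cont[OF sub])
        show "cmod (\<phi> y) \<le> B" if "cmod (x - y) = R / 2" for y
          using sub that by (intro B) (auto simp: dist_norm subset_iff)
      qed (use R in simp)
      then show ?thesis by (simp add: power_divide fact_2)
    qed
    have "cmod ((deriv ^^ 0) \<phi> 1 - (\<Sum>i\<le>1. (deriv ^^ i) \<phi> 0 * (1 - 0) ^ i / fact i))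
        \<le> 8 * B / R\<^sup>2 * cmod (1 - 0) ^ Suc 1 / fact 1"
    proof (rule complex_Taylor[of "cball 0 1"])
      fix i x assume x: "x \<in> cball (0::complex) 1" "i \<le> (1::nat)"
      then have "x \<in> ball 0 R" using R by simp
      moreover have "(deriv ^^ i) \<phi> holomorphic_on ball 0 R"
        by (intro holomorphic_higher_deriv \<phi>) simp
      ultimately have "((deriv ^^ i) \<phi> has_field_derivative deriv ((deriv ^^ i) \<phi>) x) (at x)"
        by (intro holomorphic_derivI[of _ "ball 0 R"]) auto
      then show "((deriv ^^ i) \<phi> has_field_derivative (deriv ^^ Suc i) \<phi> x) (at x within cball 0 1)"
        by (simp add: has_field_derivative_at_within)
    qed (use d2 in \<open>auto simp: numeral_2_eq_2\<close>)
    then show "cmod (\<phi> 1 - \<phi> 0 - deriv \<phi> 0) \<le> 8 * B / R\<^sup>2"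
      by (simp add: diff_diff_eq)
  }
qed

text \<open>One-variable estimates on the line \<theta> + t v, which stays in the ball up to |t| < R
  = \<rho> / |v|; the increment is reached at t = 1, and |v| \<le> \<rho> / 4 means R \<ge>
  4.\<close>

lemma cauchy_remainder_several:
  fixes f :: "complex ^ 'd::finite \<Rightarrow> complex"
  assumes \<rho>: "0 < \<rho>" "ball \<theta> \<rho> \<subseteq> A" and B: "\<And>x. x \<in> A \<Longrightarrow> cmod (f x) \<le> B"
    and diff: "\<And>x v. x \<in> A \<Longrightarrow> \<exists>d. ((\<lambda>t. f (x + t *s v)) has_field_derivative d) (at 0)"
    and D: "\<And>v. ((\<lambda>t. f (\<theta> + t *s v)) has_field_derivative D v) (at 0)"
  shows "cmod (D v) \<le> 2 * B / \<rho> * norm v"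
    and "norm v \<le> \<rho> / 4 \<Longrightarrow> cmod (f (\<theta> + v) - f \<theta> - D v) \<le> 8 * B / \<rho>\<^sup>2 * (norm v)\<^sup>2"
proof -
  have "cmod (D v) \<le> 2 * B / \<rho> * norm v \<and>
    (norm v \<le> \<rho> / 4 \<longrightarrow> cmod (f (\<theta> + v) - f \<theta> - D v) \<le> 8 * B / \<rho>\<^sup>2 * (norm v)\<^sup>2)"
  proof (cases "v = 0")
    case True
    have "((\<lambda>t. f (\<theta> + t *s 0)) has_field_derivative 0) (at 0)"
      by (simp add: Finite_Cartesian_Product.vec_eq_iff)
    with D[of 0] have "D 0 = 0" by (rule DERIV_unique)
    with True show ?thesis by simp
  next
    case False
    then have v: "0 < norm v" by simp
    define R where "R = \<rho> / norm v"
    have R: "0 < R" using \<rho> v by (simp add: R_def)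
    define \<phi> where "\<phi> t = f (\<theta> + t *s v)" for t
    have in_A: "\<theta> + t *s v \<in> A" if "t \<in> ball 0 R" for t
    proof -
      have "norm (t *s v) < \<rho>"
        using that v by (simp add: R_def norm_vector_cmult field_simps)
      then have "\<theta> + t *s v \<in> ball \<theta> \<rho>" by (simp add: dist_norm)
      then show ?thesis using \<rho> by blast
    qed
    have "\<phi> field_differentiable at t" if t: "t \<in> ball 0 R" for t
    proof -
      obtain d where "((\<lambda>s. f ((\<theta> + t *s v) + s *s v)) has_field_derivative d) (at 0)"
        using diff[OF in_A[OF t]] by blast
      moreover have "(\<theta> + t *s v) + s *s v = \<theta> + (s + t) *s v" for s
        by (simp add: Finite_Cartesian_Product.vec_eq_iff algebra_simps)
      ultimately have "((\<lambda>s. \<phi> (s + t)) has_field_derivative d) (at 0)"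
        by (simp add: \<phi>_def)
      then have "(\<phi> has_field_derivative d) (at t)"
        using DERIV_shift[of \<phi> d 0 t] by simp
      then show ?thesis by (auto simp: field_differentiable_def)
    qed
    then have hol: "\<phi> holomorphic_on ball 0 R"
      by (auto simp: holomorphic_on_def intro: field_differentiable_at_within)
    have bd: "cmod (\<phi> t) \<le> B" if "t \<in> ball 0 R" for t
      using B[OF in_A[OF that]] by (simp add: \<phi>_def)
    have "deriv \<phi> 0 = D v"
      using D[of v] DERIV_imp_deriv unfolding \<phi>_def by blast
    then have 1: "cmod (D v) \<le> 2 * B / R"
      and 2: "4 \<le> R \<Longrightarrow> cmod (\<phi> 1 - \<phi> 0 - D v) \<le> 8 * B / R\<^sup>2"
      using cauchy_remainder[OF hol bd] R by auto
    have "\<phi> 1 = f (\<theta> + v)" "\<phi> 0 = f \<theta>"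
      by (simp_all add: \<phi>_def vector_cmult_simps)
    moreover have "norm v \<le> \<rho> / 4 \<Longrightarrow> 4 \<le> R"
      using v \<rho> by (simp add: R_def field_simps)
    ultimately show ?thesis
      using 1 2 v by (auto simp: R_def power_divide)
  qed
  then show "cmod (D v) \<le> 2 * B / \<rho> * norm v"
    and "norm v \<le> \<rho> / 4 \<Longrightarrow> cmod (f (\<theta> + v) - f \<theta> - D v) \<le> 8 * B / \<rho>\<^sup>2 * (norm v)\<^sup>2"
    by blast+
qed

lemma has_derivative_line:
  fixes f :: "complex ^ 'd::finite \<Rightarrow> complex"
  assumes "(f has_derivative D) (at x)" "\<And>c v. D (c *s v) = c * D v"
  shows "((\<lambda>t. f (x + t *s v)) has_field_derivative D v) (at 0)"
proof -
  have "((\<lambda>t. x + t *s v) has_derivative (\<lambda>t. 0 + t *s v)) (at 0)"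
    by (intro has_derivative_add has_derivative_const bounded_linear_imp_has_derivative bounded_linear_vector_cmult)
  then have "((\<lambda>t. x + t *s v) has_derivative (\<lambda>t. t *s v)) (at 0)" by simp
  moreover have "(f has_derivative D) (at (x + 0 *s v))" using assms(1) by (simp add: vector_cmult_simps)
  ultimately have "((\<lambda>t. f (x + t *s v)) has_derivative (\<lambda>t. D (t *s v))) (at 0)"
    by (rule has_derivative_compose)
  moreover have "(\<lambda>t. D (t *s v)) = times (D v)"
    by (auto simp: assms(2) mult.commute)
  ultimately show ?thesis
    unfolding has_field_derivative_def by simp
qed

lemma holo_several_line:
  assumes "holo_several f A" "x \<in> A"
  shows "\<exists>d. ((\<lambda>t. f (x + t *s v)) has_field_derivative d) (at 0)"
  using assms has_derivative_line unfolding holo_several_def by blast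

text \<open>The quadratic Cauchy estimate along complex lines turns directional complex derivatives into a
  Frechet derivative, which is how holomorphy passes to uniform limits.\<close>

lemma holo_severalI:
  fixes f :: "complex ^ 'd::finite \<Rightarrow> complex"
  assumes A: "open A" and B: "\<And>x. x \<in> A \<Longrightarrow> cmod (f x) \<le> B"
    and D: "\<And>x v. x \<in> A \<Longrightarrow> ((\<lambda>t. f (x + t *s v)) has_field_derivative D x v) (at 0)"
    and add: "\<And>x v w. x \<in> A \<Longrightarrow> D x (v + w) = D x v + D x w"
    and cmult: "\<And>x c v. x \<in> A \<Longrightarrow> D x (c *s v) = c * D x v"
  shows "holo_several f A"
  unfolding holo_several_def
proof
  fix \<theta> assume \<theta>: "\<theta> \<in> A"
  obtain \<rho> where \<rho>: "0 < \<rho>" "ball \<theta> \<rho> \<subseteq> A" using A \<theta> open_contains_ball by blast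
  have diff: "\<exists>d. ((\<lambda>t. f (x + t *s v)) has_field_derivative d) (at 0)" if "x \<in> A" for x v
    using D[OF that] by blast
  have rem1: "cmod (D \<theta> v) \<le> 2 * B / \<rho> * norm v" for v
    by (rule cauchy_remainder_several(1)[OF \<rho> B diff D[OF \<theta>]])
  have rem2: "cmod (f (\<theta> + v) - f \<theta> - D \<theta> v) \<le> 8 * B / \<rho>\<^sup>2 * (norm v)\<^sup>2" if "norm v \<le> \<rho> / 4" for v
    by (rule cauchy_remainder_several(2)[OF \<rho> B diff D[OF \<theta>] that])
  have "(f has_derivative D \<theta>) (at \<theta>)"
    unfolding has_derivative_at_alt
  proof (intro conjI allI impI)
    have "D \<theta> (r *\<^sub>R v) = r *\<^sub>R D \<theta> v" for r v
    proof -
      have "r *\<^sub>R v = of_real r *s v" by (simp add: Finite_Cartesian_Product.vec_eq_iff) (simp add: scaleR_conv_of_real)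
      then show ?thesis by (simp add: cmult[OF \<theta>] scaleR_conv_of_real)
    qed
    then show "bounded_linear (D \<theta>)"
      using rem1 add[OF \<theta>] by (intro bounded_linear_intro[of _ "2 * B / \<rho>"]) (auto simp: mult.commute)
  next
    fix e :: real assume e: "0 < e"
    have B0: "0 \<le> B" using B[OF \<theta>] norm_ge_zero order_trans by blast
    define d where "d = min (\<rho> / 4) (e / (8 * B / \<rho>\<^sup>2 + 1))"
    have c: "0 < 8 * B / \<rho>\<^sup>2 + 1" using B0 \<rho> by (simp add: add_nonneg_pos)
    have "0 < d" using \<rho> e c by (simp add: d_def)
    moreover have "cmod (f y - f \<theta> - D \<theta> (y - \<theta>)) \<le> e * norm (y - \<theta>)" if y: "norm (y - \<theta>) < d" for y
    proof -
      have "cmod (f (\<theta> + (y - \<theta>)) - f \<theta> - D \<theta> (y - \<theta>)) \<le> 8 * B / \<rho>\<^sup>2 * (norm (y - \<theta>))\<^sup>2"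
        using y unfolding d_def min_less_iff_conj by (intro rem2) (rule less_imp_le, blast)
      also have "\<dots> \<le> (8 * B / \<rho>\<^sup>2 + 1) * norm (y - \<theta>) * norm (y - \<theta>)"
        by (simp add: power2_eq_square algebra_simps)
      also have "\<dots> \<le> e * norm (y - \<theta>)"
      proof (intro mult_right_mono norm_ge_zero)
        have "norm (y - \<theta>) < e / (8 * B / \<rho>\<^sup>2 + 1)"
          using y unfolding d_def min_less_iff_conj by blast
        then have "norm (y - \<theta>) * (8 * B / \<rho>\<^sup>2 + 1) < e"
          unfolding pos_less_divide_eq[OF c] .
        then show "(8 * B / \<rho>\<^sup>2 + 1) * norm (y - \<theta>) \<le> e"
          unfolding mult.commute[of "norm (y - \<theta>)"] by (rule less_imp_le)
      qed
      finally show ?thesis by simp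
    qed
    ultimately show "\<exists>d>0. \<forall>y. norm (y - \<theta>) < d \<longrightarrow> cmod (f y - f \<theta> - D \<theta> (y - \<theta>)) \<le> e * norm (y - \<theta>)"
      by blast
  qed
  with cmult[OF \<theta>] show "\<exists>D. (f has_derivative D) (at \<theta>) \<and> (\<forall>c v. D (c *s v) = c * D v)" by blast
qed

text \<open>On each complex line the one-variable theorem also gives convergence of the derivatives.
  Their limits inherit linearity in the direction, which is what \<open>holo_severalI\<close> asks
  for.\<close>

lemma holo_several_uniform_limit:
  fixes f :: "'i \<Rightarrow> complex ^ 'd::finite \<Rightarrow> complex"
  assumes A: "open A" and F: "F \<noteq> bot" and f: "\<And>i. holo_several (f i) A"
    and lim: "uniform_limit A f g F" and B: "\<And>x. x \<in> A \<Longrightarrow> cmod (g x) \<le> B"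
  shows "holo_several g A"
proof -
  have "\<exists>Df. \<forall>x\<in>A. (f i has_derivative Df x) (at x) \<and> (\<forall>c v. Df x (c *s v) = c * Df x v)" for i
    using f[of i] unfolding holo_several_def by (intro bchoice) auto
  then obtain Df where Df: "\<And>i x. x \<in> A \<Longrightarrow> (f i has_derivative Df i x) (at x)"
    "\<And>i x c v. x \<in> A \<Longrightarrow> Df i x (c *s v) = c * Df i x v" by metis
  have line: "((\<lambda>t. f i (x + t *s v)) has_field_derivative Df i x v) (at 0)" if "x \<in> A" for i x v
    using has_derivative_line[OF Df(1) Df(2)] that by blast
  have "\<exists>d. ((\<lambda>t. g (x + t *s v)) has_field_derivative d) (at 0) \<and> ((\<lambda>i. Df i x v) \<longlongrightarrow> d) F"
    if x: "x \<in> A" for x v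
  proof -
    obtain \<rho> where \<rho>: "0 < \<rho>" "ball x \<rho> \<subseteq> A" using A x open_contains_ball by blast
    \<comment> \<open>The added 1 covers the direction v = 0.\<close>
    define r where "r = \<rho> / (norm v + 1)"
    have nv: "0 < norm v + 1" by (simp add: add_nonneg_pos)
    have r: "0 < r" using \<rho> nv by (simp add: r_def)
    have in_A: "x + t *s v \<in> A" if "t \<in> cball 0 r" for t
    proof -
      have "norm (t *s v) \<le> r * norm v"
        using that by (auto simp: norm_vector_cmult intro: mult_right_mono)
      also have "\<dots> < r * (norm v + 1)" using r by simp
      also have "\<dots> = \<rho>" using nv by (simp add: r_def)
      finally have "x + t *s v \<in> ball x \<rho>" by (simp add: dist_norm)
      then show ?thesis using \<rho> by blast
    qed
    have dt: "((\<lambda>t. f i (x + t *s v)) has_field_derivative Df i (x + t *s v) v) (at t)" if t: "t \<in> cball 0 r" for i t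
    proof -
      have "((\<lambda>s. f i ((x + t *s v) + s *s v)) has_field_derivative Df i (x + t *s v) v) (at 0)"
        by (rule line[OF in_A[OF t]])
      moreover have "(x + t *s v) + s *s v = x + (s + t) *s v" for s
        by (simp add: Finite_Cartesian_Product.vec_eq_iff algebra_simps)
      ultimately show ?thesis
        using DERIV_shift[of "\<lambda>t. f i (x + t *s v)" _ 0 t] by simp
    qed
    have ul: "uniform_limit (cball 0 r) (\<lambda>i t. f i (x + t *s v)) (\<lambda>t. g (x + t *s v)) F"
    proof (rule uniform_limitI)
      fix e :: real assume "0 < e"
      from uniform_limitD[OF lim this]
      show "\<forall>\<^sub>F i in F. \<forall>t\<in>cball 0 r. dist (f i (x + t *s v)) (g (x + t *s v)) < e"
        by eventually_elim (use in_A in blast)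
    qed
    have cont: "continuous_on (cball 0 r) (\<lambda>t. f i (x + t *s v)) \<and>
        (\<forall>w\<in>ball 0 r. ((\<lambda>t. f i (x + t *s v)) has_field_derivative Df i (x + w *s v) v) (at w))" for i
      using dt by (auto intro!: DERIV_isCont continuous_at_imp_continuous_on)
    obtain g' where "\<And>w. w \<in> ball 0 r \<Longrightarrow> ((\<lambda>t. g (x + t *s v)) has_field_derivative g' w) (at w) \<and>
        ((\<lambda>i. Df i (x + w *s v) v) \<longlongrightarrow> g' w) F"
      using has_complex_derivative_uniform_limit[OF always_eventually[OF allI[OF cont]] ul F r] by blast
    from this[of 0] r show ?thesis by (auto simp: vector_cmult_simps)
  qed
  then obtain D where D: "\<And>x v. x \<in> A \<Longrightarrow> ((\<lambda>t. g (x + t *s v)) has_field_derivative D x v) (at 0)"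
    "\<And>x v. x \<in> A \<Longrightarrow> ((\<lambda>i. Df i x v) \<longlongrightarrow> D x v) F" by metis
  show ?thesis
  proof (rule holo_severalI[OF A B D(1)])
    fix x v w assume x: "x \<in> A"
    have "((\<lambda>i. Df i x v + Df i x w) \<longlongrightarrow> D x v + D x w) F"
      by (intro tendsto_add D(2) x)
    moreover have "Df i x (v + w) = Df i x v + Df i x w" for i
      using has_derivative_linear[OF Df(1)[OF x]] by (rule linear_add)
    ultimately show "D x (v + w) = D x v + D x w"
      using tendsto_unique[OF F D(2)[OF x, of "v + w"]] by simp
  next
    fix x c v assume x: "x \<in> A"
    have "((\<lambda>i. c * Df i x v) \<longlongrightarrow> c * D x v) F"
      by (intro tendsto_mult_left D(2) x)
    then show "D x (c *s v) = c * D x v"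
      using tendsto_unique[OF F D(2)[OF x, of "c *s v"]] by (simp add: Df(2)[OF x])
  qed
qed

lemma hol_torus_bound:
  assumes "hol_torus h f"
  shows "\<exists>B. \<forall>\<theta>\<in>torus_strip h. cmod (f \<theta>) \<le> B"
  using assms unfolding hol_torus_def bounded_iff by auto

lemma hol_torus_uniform_limit:
  assumes F: "F \<noteq> bot" and f: "\<And>i. hol_torus h (f i)" and lim: "uniform_limit (torus_strip h) f g F"
  shows "hol_torus h g"
proof -
  have "\<forall>\<^sub>F i in F. \<forall>x\<in>torus_strip h. dist (f i x) (g x) < 1"
    using uniform_limitD[OF lim, of 1] by simp
  then obtain i where i: "\<And>x. x \<in> torus_strip h \<Longrightarrow> dist (f i x) (g x) < 1"
    using eventually_happens'[OF F] by blast
  obtain B where B: "\<And>x. x \<in> torus_strip h \<Longrightarrow> cmod (f i x) \<le> B"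
    using hol_torus_bound[OF f] by blast
  have g: "cmod (g x) \<le> B + 1" if "x \<in> torus_strip h" for x
  proof -
    have "cmod (g x) \<le> cmod (f i x) + dist (f i x) (g x)"
      using norm_triangle_sub[of "g x" "f i x"] by (simp add: dist_norm norm_minus_commute)
    with i[OF that] B[OF that] show ?thesis by simp
  qed
  have "holo_several g (torus_strip h)"
    by (rule holo_several_uniform_limit[OF open_torus_strip F _ lim g]) (use f in \<open>simp add: hol_torus_def\<close>)
  moreover have "bounded (g ` torus_strip h)"
    using g by (auto simp: bounded_iff)
  moreover have "g (\<theta> + axis j 1) = g \<theta>" if "\<theta> \<in> torus_strip h" for \<theta> j
  proof (rule tendsto_unique[OF F])
    show "((\<lambda>i. f i \<theta>) \<longlongrightarrow> g \<theta>) F" by (rule tendsto_uniform_limitI[OF lim that])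
    have "((\<lambda>i. f i (\<theta> + axis j 1)) \<longlongrightarrow> g (\<theta> + axis j 1)) F"
      by (rule tendsto_uniform_limitI[OF lim torus_strip_axis[OF that]])
    then show "((\<lambda>i. f i \<theta>) \<longlongrightarrow> g (\<theta> + axis j 1)) F"
      using f that by (simp add: hol_torus_def)
  qed
  ultimately show ?thesis by (simp add: hol_torus_def)
qed

section \<open>Closure properties of analytic functions on the strip\<close>

lemma holo_several_const: "holo_several (\<lambda>_. c) A"
  unfolding holo_several_def by (auto intro!: exI[of _ "\<lambda>_. 0"])

lemma holo_several_add:
  assumes "holo_several f A" "holo_several g A"
  shows "holo_several (\<lambda>x. f x + g x) A"
  unfolding holo_several_def
proof
  fix \<theta> assume "\<theta> \<in> A"
  then obtain D E where "(f has_derivative D) (at \<theta>)" "\<forall>c v. D (c *s v) = c * D v"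
    "(g has_derivative E) (at \<theta>)" "\<forall>c v. E (c *s v) = c * E v"
    using assms unfolding holo_several_def by blast
  then show "\<exists>D. ((\<lambda>x. f x + g x) has_derivative D) (at \<theta>) \<and> (\<forall>c v. D (c *s v) = c * D v)"
    by (intro exI[of _ "\<lambda>v. D v + E v"]) (auto intro!: has_derivative_add simp: distrib_left)
qed

lemma holo_several_mult:
  assumes "holo_several f A" "holo_several g A"
  shows "holo_several (\<lambda>x. f x * g x) A"
  unfolding holo_several_def
proof
  fix \<theta> assume "\<theta> \<in> A"
  then obtain D E where "(f has_derivative D) (at \<theta>)" "\<forall>c v. D (c *s v) = c * D v"
    "(g has_derivative E) (at \<theta>)" "\<forall>c v. E (c *s v) = c * E v"
    using assms unfolding holo_several_def by blast
  then show "\<exists>D. ((\<lambda>x. f x * g x) has_derivative D) (at \<theta>) \<and> (\<forall>c v. D (c *s v) = c * D v)"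
    by (intro exI[of _ "\<lambda>v. f \<theta> * E v + D v * g \<theta>"] conjI has_derivative_mult) (simp_all add: algebra_simps)
qed

lemma hol_torus_const: "hol_torus h (\<lambda>_. c)"
  unfolding hol_torus_def by (auto intro: holo_several_const finite_imp_bounded simp: image_constant_conv)

lemma hol_torus_add: "hol_torus h f \<Longrightarrow> hol_torus h g \<Longrightarrow> hol_torus h (\<lambda>x. f x + g x)"
  unfolding hol_torus_def by (auto intro: holo_several_add bounded_plus_comp)

lemma hol_torus_mult:
  assumes "hol_torus h f" "hol_torus h g"
  shows "hol_torus h (\<lambda>x. f x * g x)"
proof -
  obtain B C where B: "\<And>x. x \<in> torus_strip h \<Longrightarrow> cmod (f x) \<le> B" "\<And>x. x \<in> torus_strip h \<Longrightarrow> cmod (g x) \<le> C"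
    using hol_torus_bound assms by metis
  have "cmod (f x * g x) \<le> B * C" if "x \<in> torus_strip h" for x
    unfolding norm_mult using B[OF that] by (intro mult_mono) (auto intro: order_trans[OF norm_ge_zero])
  then have "bounded ((\<lambda>x. f x * g x) ` torus_strip h)"
    unfolding bounded_iff by blast
  with assms show ?thesis by (simp add: hol_torus_def holo_several_mult)
qed

lemma hol_torus_uniform_algebra: "uniform_algebra (torus_strip h) (hol_torus h)"
proof
  show "hol_torus h g" if "\<And>j::nat. hol_torus h (f j)" "uniform_limit (torus_strip h) f g sequentially" for f g
    by (rule hol_torus_uniform_limit[OF _ that]) simp
qed (blast intro: hol_torus_const hol_torus_add hol_torus_mult hol_torus_uniform_limit)+

lemma hol_torus_rot:
  fixes f :: "complex ^ 'd::finite \<Rightarrow> complex" and \<alpha> :: "real ^ 'd"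
  assumes "hol_torus h f"
  shows "hol_torus h (\<lambda>\<theta>. f (rot \<alpha> n \<theta>))"
proof -
  have "holo_several (\<lambda>\<theta>. f (rot \<alpha> n \<theta>)) (torus_strip h)"
    unfolding holo_several_def
  proof
    fix \<theta> :: "complex ^ 'd" assume "\<theta> \<in> torus_strip h"
    then have "rot \<alpha> n \<theta> \<in> torus_strip h" by (simp add: rot_in_torus_strip)
    then obtain D where D: "(f has_derivative D) (at (rot \<alpha> n \<theta>))" "\<forall>c v. D (c *s v) = c * D v"
      using assms unfolding hol_torus_def holo_several_def by blast
    have "(rot \<alpha> n has_derivative (\<lambda>v. v + 0)) (at \<theta>)"
      unfolding rot_def[abs_def] by (intro has_derivative_add has_derivative_ident has_derivative_const)
    then have "((\<lambda>\<theta>. f (rot \<alpha> n \<theta>)) has_derivative D) (at \<theta>)"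
      using has_derivative_compose[of "rot \<alpha> n" _ \<theta> UNIV f D] D(1) by simp
    with D(2) show "\<exists>D. ((\<lambda>\<theta>. f (rot \<alpha> n \<theta>)) has_derivative D) (at \<theta>) \<and> (\<forall>c v. D (c *s v) = c * D v)"
      by blast
  qed
  moreover have "bounded ((\<lambda>\<theta>. f (rot \<alpha> n \<theta>)) ` torus_strip h)"
    by (rule bounded_subset[of "f ` torus_strip h"])
      (use assms in \<open>auto simp: hol_torus_def rot_in_torus_strip\<close>)
  moreover have "f (rot \<alpha> n (\<theta> + axis j 1)) = f (rot \<alpha> n \<theta>)" if "\<theta> \<in> torus_strip h" for \<theta> :: "complex ^ 'd" and j
  proof -
    have "rot \<alpha> n (\<theta> + axis j 1) = rot \<alpha> n \<theta> + axis j 1" by (simp add: rot_def)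
    then show ?thesis using assms that by (simp add: hol_torus_def rot_in_torus_strip)
  qed
  ultimately show ?thesis by (simp add: hol_torus_def)
qed

lemma C_omega_hol_torus: "f \<in> C_omega h \<Longrightarrow> hol_torus h f"
  by (simp add: C_omega_def hol_torus_def)

lemma hol_torus_C_omega:
  assumes "hol_torus h f"
  shows "(\<lambda>\<theta>\<in>torus_strip h. f \<theta>) \<in> C_omega h"
proof -
  have "holo_several (\<lambda>\<theta>\<in>torus_strip h. f \<theta>) (torus_strip h)"
    unfolding holo_several_def
  proof
    fix \<theta> :: "complex ^ 'a" assume \<theta>: "\<theta> \<in> torus_strip h"
    then obtain D where D: "(f has_derivative D) (at \<theta>)" "\<forall>c v. D (c *s v) = c * D v"
      using assms unfolding hol_torus_def holo_several_def by blast
    have "((\<lambda>\<theta>\<in>torus_strip h. f \<theta>) has_derivative D) (at \<theta>)"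
      by (rule has_derivative_transform_within_open[OF D(1) open_torus_strip \<theta>]) simp
    with D(2) show "\<exists>D. ((\<lambda>\<theta>\<in>torus_strip h. f \<theta>) has_derivative D) (at \<theta>) \<and> (\<forall>c v. D (c *s v) = c * D v)"
      by blast
  qed
  moreover have "bounded ((\<lambda>\<theta>\<in>torus_strip h. f \<theta>) ` torus_strip h)"
    using assms by (simp add: hol_torus_def cong: image_cong)
  ultimately show ?thesis
    using assms by (simp add: C_omega_def hol_torus_def torus_strip_axis)
qed

section \<open>Analytic maps into the sequence space\<close>

lemma seq_norm_le:
  assumes w: "(\<lambda>k. w k * exp (- \<xi> * \<bar>real_of_int k\<bar>)) summable_on UNIV" and u: "\<And>k. cmod (u k) \<le> C * w k"
  shows "u \<in> seq_space \<xi>"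
    and "seq_norm \<xi> u \<le> C * (\<Sum>\<^sub>\<infinity>k. w k * exp (- \<xi> * \<bar>real_of_int k\<bar>))"
proof -
  have sm: "(\<lambda>k. C * (w k * exp (- \<xi> * \<bar>real_of_int k\<bar>))) summable_on UNIV"
    by (intro summable_on_cmult_right w)
  have le: "cmod (u k) * exp (- \<xi> * \<bar>real_of_int k\<bar>) \<le> C * (w k * exp (- \<xi> * \<bar>real_of_int k\<bar>))" for k
    using mult_right_mono[OF u[of k], of "exp (- \<xi> * \<bar>real_of_int k\<bar>)"] by (simp add: mult.assoc)
  have su: "(\<lambda>k. cmod (u k) * exp (- \<xi> * \<bar>real_of_int k\<bar>)) summable_on UNIV"
    by (rule summable_on_comparison_test[OF sm le]) simp
  then show "u \<in> seq_space \<xi>" by (simp add: seq_space_def)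
  have "seq_norm \<xi> u \<le> (\<Sum>\<^sub>\<infinity>k. C * (w k * exp (- \<xi> * \<bar>real_of_int k\<bar>)))"
    unfolding seq_norm_def by (intro infsum_mono su sm le)
  then show "seq_norm \<xi> u \<le> C * (\<Sum>\<^sub>\<infinity>k. w k * exp (- \<xi> * \<bar>real_of_int k\<bar>))"
    by (simp add: infsum_cmult_right')
qed

text \<open>The Cauchy estimates for coordinate k carry the weight w k and a radius independent of
  k. Derivatives and quadratic remainders are therefore summable, and holomorphy of the coordinates
  becomes Frechet differentiability in the sequence norm.\<close>

lemma C_omega_seqI:
  fixes U :: "complex ^ 'd::finite \<Rightarrow> int \<Rightarrow> complex"
  assumes U: "\<And>k. hol_torus h (\<lambda>\<theta>. U \<theta> k)"
    and bd: "\<And>\<theta> k. \<theta> \<in> torus_strip h \<Longrightarrow> cmod (U \<theta> k) \<le> B * w k"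
    and w: "(\<lambda>k. w k * exp (- \<xi> * \<bar>real_of_int k\<bar>)) summable_on UNIV"
  shows "U \<in> C_omega_seq h \<xi>"
proof -
  define S where "S = (\<Sum>\<^sub>\<infinity>k. w k * exp (- \<xi> * \<bar>real_of_int k\<bar>))"
  have seq: "u \<in> seq_space \<xi> \<and> seq_norm \<xi> u \<le> C * S" if "\<And>k. cmod (u k) \<le> C * w k" for u C
    using seq_norm_le[OF w that] by (simp add: S_def)
  have deriv: "\<exists>D. (\<forall>v. D v \<in> seq_space \<xi>) \<and> (\<forall>v w n. D (v + w) n = D v n + D w n) \<and>
      (\<forall>c v n. D (c *s v) n = c * D v n) \<and>
      (\<forall>e>0. \<exists>\<delta>>0. \<forall>v. norm v < \<delta> \<longrightarrow> \<theta> + v \<in> torus_strip h \<and>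
         seq_norm \<xi> (\<lambda>n. U (\<theta> + v) n - U \<theta> n - D v n) \<le> e * norm v)"
    if \<theta>: "\<theta> \<in> torus_strip h" for \<theta>
  proof -
    obtain \<rho> where \<rho>: "0 < \<rho>" "ball \<theta> \<rho> \<subseteq> torus_strip h"
      using open_torus_strip \<theta> open_contains_ball by blast
    have "\<exists>D. ((\<lambda>\<theta>. U \<theta> k) has_derivative D) (at \<theta>) \<and> (\<forall>c v. D (c *s v) = c * D v)" for k
      using U[of k] \<theta> unfolding hol_torus_def holo_several_def by blast
    then obtain D' where D': "\<And>k. ((\<lambda>\<theta>. U \<theta> k) has_derivative D' k) (at \<theta>)"
      "\<And>k c v. D' k (c *s v) = c * D' k v" by metis
    have diff: "\<exists>d. ((\<lambda>t. U (x + t *s v) k) has_field_derivative d) (at 0)" if "x \<in> torus_strip h" for x v k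
      using holo_several_line[of "\<lambda>\<theta>. U \<theta> k", OF _ that] U by (simp add: hol_torus_def)
    have rem1: "cmod (D' k v) \<le> 2 * (B * w k) / \<rho> * norm v" for k v
      by (rule cauchy_remainder_several(1)[OF \<rho> bd diff has_derivative_line[OF D'(1) D'(2)]])
    have rem2: "cmod (U (\<theta> + v) k - U \<theta> k - D' k v) \<le> 8 * (B * w k) / \<rho>\<^sup>2 * (norm v)\<^sup>2"
      if "norm v \<le> \<rho> / 4" for k v
      by (rule cauchy_remainder_several(2)[OF \<rho> bd diff has_derivative_line[OF D'(1) D'(2)] that])
    define D where "D v k = D' k v" for v k
    have "D v \<in> seq_space \<xi>" for v
      using seq[of "D v" "2 * B / \<rho> * norm v"] rem1 by (simp add: D_def mult_ac)
    moreover have "D (v + w) n = D v n + D w n" for v w n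
      unfolding D_def using has_derivative_linear[OF D'(1)] by (rule linear_add)
    moreover have "D (c *s v) n = c * D v n" for c v n
      unfolding D_def by (rule D'(2))
    moreover have "\<exists>\<delta>>0. \<forall>v. norm v < \<delta> \<longrightarrow> \<theta> + v \<in> torus_strip h \<and>
         seq_norm \<xi> (\<lambda>n. U (\<theta> + v) n - U \<theta> n - D v n) \<le> e * norm v" if e: "0 < e" for e :: real
    proof -
      \<comment> \<open>The absolute value and the 1 keep K positive whatever the sign of B *
        S.\<close>
      define K where "K = \<bar>8 * B / \<rho>\<^sup>2 * S\<bar> + 1"
      have K: "0 < K" by (simp add: K_def add_nonneg_pos)
      define \<delta> where "\<delta> = min (\<rho> / 4) (e / K)"
      have "0 < \<delta>" using \<rho> e K by (simp add: \<delta>_def)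
      moreover have "\<theta> + v \<in> torus_strip h \<and> seq_norm \<xi> (\<lambda>n. U (\<theta> + v) n - U \<theta> n - D v n) \<le> e * norm v"
        if v: "norm v < \<delta>" for v
      proof
        have v4: "norm v \<le> \<rho> / 4" using v by (simp add: \<delta>_def)
        then have "\<theta> + v \<in> ball \<theta> \<rho>" using \<rho> by (simp add: dist_norm)
        then show "\<theta> + v \<in> torus_strip h" using \<rho> by blast
        have "seq_norm \<xi> (\<lambda>n. U (\<theta> + v) n - U \<theta> n - D v n) \<le> 8 * B / \<rho>\<^sup>2 * (norm v)\<^sup>2 * S"
          using seq[of "\<lambda>n. U (\<theta> + v) n - U \<theta> n - D v n" "8 * B / \<rho>\<^sup>2 * (norm v)\<^sup>2"] rem2[OF v4]
          by (simp add: D_def mult_ac)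
        also have "\<dots> = (8 * B / \<rho>\<^sup>2 * S) * norm v * norm v" by (simp add: power2_eq_square)
        also have "\<dots> \<le> K * norm v * norm v"
        proof (intro mult_right_mono norm_ge_zero)
          show "8 * B / \<rho>\<^sup>2 * S \<le> K" unfolding K_def by linarith
        qed
        also have "\<dots> \<le> e * norm v"
          using v K by (intro mult_right_mono) (auto simp: \<delta>_def pos_less_divide_eq mult.commute less_imp_le)
        finally show "seq_norm \<xi> (\<lambda>n. U (\<theta> + v) n - U \<theta> n - D v n) \<le> e * norm v" .
      qed
      ultimately show ?thesis by blast
    qed
    ultimately show ?thesis by (intro exI[of _ D]) blast
  qed
  show ?thesis
    unfolding C_omega_seq_def mem_Collect_eq
  proof (intro conjI ballI allI deriv)
    show "U \<theta> \<in> seq_space \<xi>" if "\<theta> \<in> torus_strip h" for \<theta>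
      using seq bd that by blast
    show "bdd_above ((\<lambda>\<theta>. seq_norm \<xi> (U \<theta>)) ` torus_strip h)"
      using seq bd by (intro bdd_aboveI2[of _ _ "B * S"]) blast
    show "U (\<theta> + axis j 1) = U \<theta>" if "\<theta> \<in> torus_strip h" for \<theta> j
      using U that by (auto simp: hol_torus_def)
  qed
qed

section \<open>The operators on one circle\<close>

lemma continuous_on_uniform_algebra: "uniform_algebra S (continuous_on S :: (complex \<Rightarrow> complex) \<Rightarrow> bool)"
proof
  show "continuous_on S g" if "\<And>j::nat. continuous_on S (f j)" "uniform_limit S f g sequentially" for f g
    by (rule uniform_limit_theorem[OF always_eventually]) (use that in auto)
  show "continuous_on S g" if "F \<noteq> bot" "\<And>A. continuous_on S (f A)" "uniform_limit S f g F"
    for F :: "int set filter" and f g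
    by (rule uniform_limit_theorem[OF always_eventually]) (use that in auto)
qed (auto intro: continuous_intros)

text \<open>A single circle |z| = \<open>r\<close> on which the symbol \<open>v\<close> has the
  inverse \<open>q\<close> and the perturbation is small relative to it; used for \<open>rm\<close>
  and for \<open>rp\<close>.\<close>

locale circle_inverse =
  fixes r :: real and v q :: "int \<Rightarrow> complex" and h E \<epsilon> \<beta> :: real
    and V :: "complex \<Rightarrow> complex" and W :: "complex ^ 'd::finite \<Rightarrow> complex" and \<alpha> :: "real ^ 'd"
  assumes r: "0 < r"
    and v_summable: "(\<lambda>k. cmod (v k) * r powi k) summable_on UNIV"
    and q_summable: "(\<lambda>k. cmod (q k) * r powi k) summable_on UNIV"
    and vq: "\<And>m. ((\<lambda>j. v j * q (m - j)) has_sum (if m = 0 then 1 else 0)) UNIV"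
    and qv: "\<And>m. ((\<lambda>j. q j * v (m - j)) has_sum (if m = 0 then 1 else 0)) UNIV"
    and fourier: "\<And>k. fourier_coeff V k = v k + (if k = 0 then of_real E else 0)"
    and W: "hol_torus h W"
    and \<beta>: "\<And>\<theta>. \<theta> \<in> torus_strip h \<Longrightarrow> cmod (of_real \<epsilon> * W \<theta>) \<le> \<beta>" "0 \<le> \<beta>"
    and small: "(\<Sum>\<^sub>\<infinity>k. cmod (q k) * r powi k) * \<beta> < 1"
begin

abbreviation "wr \<equiv> \<lambda>n::int. r powi n"

text \<open>The minus sign matches the form conv v y - b y, so that the potential appears as +
  \<epsilon> W.\<close>

definition pot :: "complex ^ 'd \<Rightarrow> int \<Rightarrow> complex" where
  "pot \<theta> n = - (of_real \<epsilon> * W (rot \<alpha> n \<theta>))"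

lemmas mod_r = moderate_powi[OF r]

lemma pot_bound: "\<theta> \<in> torus_strip h \<Longrightarrow> cmod (pot \<theta> n) \<le> \<beta>"
  using \<beta>(1)[of "rot \<alpha> n \<theta>"] by (simp add: pot_def rot_in_torus_strip)

lemma hol_pot: "hol_torus h (\<lambda>\<theta>. pot \<theta> n)"
proof -
  have "hol_torus h (\<lambda>\<theta>. - of_real \<epsilon> * W (rot \<alpha> n \<theta>))"
    by (intro hol_torus_mult hol_torus_const hol_torus_rot W)
  then show ?thesis by (simp add: pot_def)
qed

lemma pot_rot: "pot (rot \<alpha> m \<theta>) n = pot \<theta> (n + m)"
  by (simp add: pot_def rot_rot add.commute)

lemma solution_eq:
  assumes \<theta>: "\<theta> \<in> torus_strip h" and y: "wbdd wr B y" and z: "wbdd wr B' z"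
    and eq: "\<And>n. conv v y n - pot \<theta> n * y n = conv v z n - pot \<theta> n * z n"
  shows "y = z"
proof -
  have "(\<lambda>n. y n - z n) = (\<lambda>_. 0)"
  proof (rule inverse_perturbed_unique[where b = "pot \<theta>", OF mod_r v_summable q_summable qv pot_bound[OF \<theta>] \<beta>(2) small])
    show "wbdd wr (B + B') (\<lambda>n. y n - z n)" by (rule wbdd_diff[OF y z])
    show "conv v (\<lambda>n. y n - z n) n - pot \<theta> n * (y n - z n) = 0" for n
      using eq[of n] unfolding bounded_op_diff[OF conv_bounded_op[OF mod_r v_summable] y z]
      by (simp add: algebra_simps)
  qed
  then show ?thesis by (simp add: fun_eq_iff)
qed

lemma fourier_summable: "(\<lambda>k. cmod (fourier_coeff V k) * r powi k) summable_on UNIV"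
proof -
  have "(\<lambda>k. cmod (if k = 0 then of_real E else 0 :: complex) * r powi k) summable_on {0}"
    by (intro summable_on_finite) auto
  then have "(\<lambda>k. cmod (if k = 0 then of_real E else 0 :: complex) * r powi k) summable_on UNIV"
    by (rule summable_on_cong_neutral[THEN iffD1, rotated 3]) auto
  from summable_on_add[OF v_summable this] show ?thesis
  proof (rule summable_on_comparison_test)
    fix k :: int
    show "cmod (fourier_coeff V k) * r powi k
        \<le> cmod (v k) * r powi k + cmod (if k = 0 then of_real E else 0) * r powi k"
      unfolding fourier distrib_right[symmetric] using r
      by (intro mult_right_mono norm_triangle_ineq) simp
  qed (use r in simp)
qed

lemma conv_fourier:
  assumes "wbdd wr B y"
  shows "conv (fourier_coeff V) y n = conv v y n + of_real E * y n"
proof -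
  have "((\<lambda>k. (if k = 0 then of_real E else 0) * y (n + k)) has_sum of_real E * y n) UNIV"
    by (rule has_sum_finite_neutralI[of "{0}"]) auto
  from has_sum_add[OF conv_has_sum[OF mod_r v_summable assms] this]
  show ?thesis
    unfolding conv_def[of "fourier_coeff V"] fourier by (intro infsumI) (simp add: distrib_right)
qed

text \<open>Sampling f along the orbit of \<theta> with the factor z powi n intertwines
  \<open>D_op\<close> with the long-range operator minus E, and for bounded f and |z| = r the result
  has the weight of the circle.\<close>

definition wave :: "complex \<Rightarrow> (complex ^ 'd \<Rightarrow> complex) \<Rightarrow> complex ^ 'd \<Rightarrow> int \<Rightarrow> complex" where
  "wave z f \<theta> n = z powi n * f (rot \<alpha> n \<theta>)"

lemma wave_wbdd:
  assumes "hol_torus h f" "cmod z = r"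
  shows "\<exists>B\<ge>0. \<forall>\<theta>\<in>torus_strip h. wbdd wr B (wave z f \<theta>)"
proof -
  obtain B where B: "\<And>\<theta>. \<theta> \<in> torus_strip h \<Longrightarrow> cmod (f \<theta>) \<le> B"
    using hol_torus_bound[OF assms(1)] by blast
  have "wbdd wr (max 0 B) (wave z f \<theta>)" if "\<theta> \<in> torus_strip h" for \<theta>
    unfolding wbdd_def
  proof
    fix n
    have "cmod (f (rot \<alpha> n \<theta>)) \<le> max 0 B"
      using B[of "rot \<alpha> n \<theta>"] that by (simp add: rot_in_torus_strip)
    then have "r powi n * cmod (f (rot \<alpha> n \<theta>)) \<le> r powi n * max 0 B"
      using r by (intro mult_left_mono) auto
    then show "cmod (wave z f \<theta> n) \<le> max 0 B * r powi n"
      by (simp add: wave_def norm_mult norm_power_int assms(2) mult.commute)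
  qed
  then show ?thesis by (intro exI[of _ "max 0 B"]) auto
qed

lemma D_op_wave:
  assumes f: "hol_torus h f" and z: "cmod z = r" and \<theta>: "\<theta> \<in> torus_strip h"
  shows "conv v (wave z f \<theta>) n - pot \<theta> n * wave z f \<theta> n = z powi n * D_op h V W E \<alpha> \<epsilon> z f (rot \<alpha> n \<theta>)"
proof -
  have z0: "z \<noteq> 0" using z r by auto
  obtain B where B: "wbdd wr B (wave z f \<theta>)" using wave_wbdd[OF f z] \<theta> by blast
  have "conv (fourier_coeff V) (wave z f \<theta>) n
      = z powi n * (\<Sum>\<^sub>\<infinity>j. fourier_coeff V j * z powi j * f (rot \<alpha> j (rot \<alpha> n \<theta>)))"
    unfolding conv_def infsum_cmult_right'[symmetric]
    by (intro infsum_cong) (simp add: wave_def rot_rot power_int_add z0 mult_ac)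
  with conv_fourier[OF B, of n] show ?thesis
    using \<theta> by (simp add: D_op_def rot_in_torus_strip wave_def pot_def algebra_simps)
qed

lemma D_op_C_omega:
  assumes f: "f \<in> C_omega h" and z: "cmod z = r"
  shows "D_op h V W E \<alpha> \<epsilon> z f \<in> C_omega h"
proof -
  interpret uniform_algebra "torus_strip h :: (complex ^ 'd) set" "hol_torus h"
    by (rule hol_torus_uniform_algebra)
  have hf: "hol_torus h f" by (rule C_omega_hol_torus[OF f])
  obtain B where B: "\<And>\<theta>. \<theta> \<in> torus_strip h \<Longrightarrow> cmod (f \<theta>) \<le> B"
    using hol_torus_bound[OF hf] by blast
  have s: "hol_torus h (\<lambda>\<theta>. \<Sum>\<^sub>\<infinity>j. fourier_coeff V j * z powi j * f (rot \<alpha> j \<theta>))"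
  proof (rule infsum)
    show "hol_torus h (\<lambda>\<theta>. fourier_coeff V j * z powi j * f (rot \<alpha> j \<theta>))" for j
      by (intro hol_torus_mult hol_torus_const hol_torus_rot hf)
    show "(\<lambda>j. cmod (fourier_coeff V j) * r powi j * B) summable_on UNIV"
      by (intro summable_on_cmult_left fourier_summable)
    show "cmod (fourier_coeff V j * z powi j * f (rot \<alpha> j \<theta>)) \<le> cmod (fourier_coeff V j) * r powi j * B"
      if "\<theta> \<in> torus_strip h" for j \<theta>
      using B[of "rot \<alpha> j \<theta>"] that r
      by (simp add: norm_mult norm_power_int z rot_in_torus_strip mult_left_mono)
  qed
  have "hol_torus h (\<lambda>\<theta>. (\<Sum>\<^sub>\<infinity>j. fourier_coeff V j * z powi j * f (rot \<alpha> j \<theta>))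
        - of_real E * f \<theta> + of_real \<epsilon> * W \<theta> * f \<theta>)"
    by (intro add diff mult const s hf W)
  from hol_torus_C_omega[OF this] show ?thesis by (simp add: D_op_def)
qed

text \<open>Injectivity is uniqueness for the sequence equation at each \<theta>. For surjectivity
  the sequence solutions y \<theta> also have to fit together along orbits, so that they are the
  waves of a single function.\<close>

lemma D_op_bij:
  assumes z: "cmod z = r"
  shows "bij_betw (D_op h V W E \<alpha> \<epsilon> z) (C_omega h) (C_omega h)"
  unfolding bij_betw_def
proof
  show "inj_on (D_op h V W E \<alpha> \<epsilon> z) (C_omega h)"
  proof (rule inj_onI)
    fix f g assume f: "f \<in> C_omega h" and g: "g \<in> C_omega h"
      and eq: "D_op h V W E \<alpha> \<epsilon> z f = D_op h V W E \<alpha> \<epsilon> z g"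
    note hf = C_omega_hol_torus[OF f] and hg = C_omega_hol_torus[OF g]
    have "f \<theta> = g \<theta>" if \<theta>: "\<theta> \<in> torus_strip h" for \<theta>
    proof -
      obtain B B' where "wbdd wr B (wave z f \<theta>)" "wbdd wr B' (wave z g \<theta>)"
        using wave_wbdd[OF hf z] wave_wbdd[OF hg z] \<theta> by blast
      then have "wave z f \<theta> = wave z g \<theta>"
        by (rule solution_eq[OF \<theta>]) (simp add: D_op_wave[OF hf z \<theta>] D_op_wave[OF hg z \<theta>] eq)
      then have "wave z f \<theta> 0 = wave z g \<theta> 0" by simp
      then show ?thesis by (simp add: wave_def rot_0)
    qed
    moreover have "f \<in> extensional (torus_strip h)" "g \<in> extensional (torus_strip h)"
      using f g by (auto simp: C_omega_def)
    ultimately show "f = g" by (intro extensionalityI) auto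
  qed
  have "g \<in> D_op h V W E \<alpha> \<epsilon> z ` C_omega h" if g: "g \<in> C_omega h" for g
  proof -
    interpret uniform_algebra "torus_strip h :: (complex ^ 'd) set" "hol_torus h"
      by (rule hol_torus_uniform_algebra)
    have z0: "z \<noteq> 0" using z r by auto
    have hg: "hol_torus h g" by (rule C_omega_hol_torus[OF g])
    obtain B where B: "0 \<le> B" "\<And>\<theta>. \<theta> \<in> torus_strip h \<Longrightarrow> wbdd wr B (wave z g \<theta>)"
      using wave_wbdd[OF hg z] by blast
    have "family wr B (wave z g)"
      unfolding family_def wave_def[abs_def]
      using B(2)[unfolded wave_def[abs_def]] by (intro conjI allI hol_torus_mult hol_torus_const hol_torus_rot hg ballI)
    from inverse_perturbed_solution[where b = pot, OF mod_r v_summable q_summable vq hol_pot pot_bound \<beta>(2) small this B(1)]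
    obtain y B' where y: "family wr B' y"
      and yeq: "\<And>\<theta> n. \<theta> \<in> torus_strip h \<Longrightarrow> conv v (y \<theta>) n - pot \<theta> n * y \<theta> n = wave z g \<theta> n" by blast
    define f where "f = (\<lambda>\<theta>. y \<theta> 0)"
    have hf: "hol_torus h f" using y by (simp add: family_def f_def)
    \<comment> \<open>Both z powi m times the solution at \<theta> + m \<alpha> and the solution at
      \<theta> shifted by m solve the same equation at \<theta> + m \<alpha>, so they agree; the
      entry at 0 is the covariance sought.\<close>
    have cov: "wave z f \<theta> m = y \<theta> m" if \<theta>: "\<theta> \<in> torus_strip h" for \<theta> m
    proof -
      have \<theta>': "rot \<alpha> m \<theta> \<in> torus_strip h" using \<theta> by (simp add: rot_in_torus_strip)
      have y1: "wbdd wr (cmod (z powi m) * B') (\<lambda>n. z powi m * y (rot \<alpha> m \<theta>) n)"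
        using y \<theta>' by (intro wbdd_cmult) (simp add: family_def)
      have "cmod (y \<theta> (n + m)) \<le> B' * r powi m * r powi n" for n
        using wbddD[of wr B' "y \<theta>" "n + m"] y \<theta> r by (simp add: family_def power_int_add mult_ac)
      then have y2: "wbdd wr (B' * r powi m) (\<lambda>n. y \<theta> (n + m))" by (simp add: wbdd_def)
      have "(\<lambda>n. z powi m * y (rot \<alpha> m \<theta>) n) = (\<lambda>n. y \<theta> (n + m))"
      proof (rule solution_eq[OF \<theta>' y1 y2])
        fix n
        have "conv v (\<lambda>n. z powi m * y (rot \<alpha> m \<theta>) n) n - pot (rot \<alpha> m \<theta>) n * (z powi m * y (rot \<alpha> m \<theta>) n)
            = z powi m * wave z g (rot \<alpha> m \<theta>) n"
          unfolding yeq[OF \<theta>', symmetric] conv_def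
          by (simp add: infsum_cmult_right' mult.left_commute[of _ "z powi m"] right_diff_distrib)
        also have "\<dots> = wave z g \<theta> (n + m)"
          by (simp add: wave_def rot_rot power_int_add z0 add.commute mult_ac)
        also have "\<dots> = conv v (\<lambda>n. y \<theta> (n + m)) n - pot (rot \<alpha> m \<theta>) n * y \<theta> (n + m)"
          unfolding yeq[OF \<theta>, symmetric] pot_rot conv_def by (simp add: add_ac)
        finally show "conv v (\<lambda>n. z powi m * y (rot \<alpha> m \<theta>) n) n - pot (rot \<alpha> m \<theta>) n * (z powi m * y (rot \<alpha> m \<theta>) n)
          = conv v (\<lambda>n. y \<theta> (n + m)) n - pot (rot \<alpha> m \<theta>) n * y \<theta> (n + m)" .
      qed
      from fun_cong[OF this, of 0] show ?thesis by (simp add: wave_def f_def)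
    qed
    have "D_op h V W E \<alpha> \<epsilon> z f \<theta> = g \<theta>" if \<theta>: "\<theta> \<in> torus_strip h" for \<theta>
    proof -
      have "wave z f \<theta> = y \<theta>" using cov[OF \<theta>] by auto
      with D_op_wave[OF hf z \<theta>, of 0] yeq[OF \<theta>, of 0] show ?thesis
        by (simp add: rot_0 wave_def)
    qed
    moreover have "D_op h V W E \<alpha> \<epsilon> z (\<lambda>\<theta>\<in>torus_strip h. f \<theta>) \<theta> = D_op h V W E \<alpha> \<epsilon> z f \<theta>" for \<theta>
      by (auto simp: D_op_def rot_in_torus_strip)
    ultimately have pt: "D_op h V W E \<alpha> \<epsilon> z (\<lambda>\<theta>\<in>torus_strip h. f \<theta>) \<theta> = g \<theta>"
      if "\<theta> \<in> torus_strip h" for \<theta> using that by presburger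
    have "D_op h V W E \<alpha> \<epsilon> z (\<lambda>\<theta>\<in>torus_strip h. f \<theta>) = g"
    proof (rule extensionalityI[OF _ _ pt])
      show "D_op h V W E \<alpha> \<epsilon> z (\<lambda>\<theta>\<in>torus_strip h. f \<theta>) \<in> extensional (torus_strip h)"
        unfolding D_op_def by (rule restrict_extensional)
    qed (use g in \<open>simp add: C_omega_def\<close>)
    then show ?thesis using hol_torus_C_omega[OF hf] by blast
  qed
  then show "D_op h V W E \<alpha> \<epsilon> z ` C_omega h = C_omega h"
    using D_op_C_omega[OF _ z] by blast
qed

section \<open>The functions \<open>g_fun\<close> and their contour integrals\<close>

lemma g_fun_properties:
  assumes z: "cmod z = r"
  shows "hol_torus h (g_fun h V W E \<alpha> \<epsilon> z)"
    and "\<theta> \<in> torus_strip h \<Longrightarrow> D_op h V W E \<alpha> \<epsilon> z (g_fun h V W E \<alpha> \<epsilon> z) \<theta> = 1"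
proof -
  have one: "(\<lambda>\<theta>\<in>torus_strip h. 1) \<in> D_op h V W E \<alpha> \<epsilon> z ` C_omega h"
    using D_op_bij[OF z] hol_torus_C_omega[OF hol_torus_const[of h 1]] by (simp add: bij_betw_def)
  show "hol_torus h (g_fun h V W E \<alpha> \<epsilon> z)"
    unfolding g_fun_def by (intro C_omega_hol_torus inv_into_into one)
  show "D_op h V W E \<alpha> \<epsilon> z (g_fun h V W E \<alpha> \<epsilon> z) \<theta> = 1" if "\<theta> \<in> torus_strip h"
    unfolding g_fun_def f_inv_into_f[OF one] using that by simp
qed

definition gwave :: "complex ^ 'd \<Rightarrow> complex \<Rightarrow> int \<Rightarrow> complex" where
  "gwave \<theta> z = wave z (g_fun h V W E \<alpha> \<epsilon> z) \<theta>"

lemma gwave_equation: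
  assumes "cmod z = r" "\<theta> \<in> torus_strip h"
  shows "conv v (gwave \<theta> z) n - pot \<theta> n * gwave \<theta> z n = z powi n"
  unfolding gwave_def D_op_wave[OF g_fun_properties(1)[OF assms(1)] assms]
  using g_fun_properties(2)[OF assms(1)] assms(2) by (simp add: rot_in_torus_strip)

text \<open>\<open>g_fun\<close> is chosen by \<open>inv_into\<close> separately for each z.
  Continuity in z and a common bound come from solving the equation with z as parameter and
  comparing by uniqueness.\<close>

lemma gwave_regular:
  assumes \<theta>: "\<theta> \<in> torus_strip h"
  shows "\<exists>B. (\<forall>z. cmod z = r \<longrightarrow> wbdd wr B (gwave \<theta> z)) \<and> (\<forall>n. continuous_on (sphere 0 r) (\<lambda>z. gwave \<theta> z n))"
proof -
  interpret uniform_algebra "sphere (0::complex) r" "continuous_on (sphere 0 r)"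
    by (rule continuous_on_uniform_algebra)
  have "family wr 1 (\<lambda>z n. z powi n)"
    unfolding family_def wbdd_def using r by (auto intro!: continuous_intros simp: norm_power_int)
  from inverse_perturbed_solution[where b = "\<lambda>_. pot \<theta>", OF mod_r v_summable q_summable vq const pot_bound[OF \<theta>] \<beta>(2) small this]
  obtain y B where y: "family wr B y"
    and yeq: "\<And>z n. z \<in> sphere 0 r \<Longrightarrow> conv v (y z) n - pot \<theta> n * y z n = z powi n" by auto
  have eq: "y z = gwave \<theta> z" if z: "z \<in> sphere 0 r" for z
  proof -
    have z': "cmod z = r" using z by simp
    obtain B' where B': "wbdd wr B' (gwave \<theta> z)"
      using wave_wbdd[OF g_fun_properties(1)[OF z'] z'] \<theta> unfolding gwave_def by blast
    have "wbdd wr B (y z)" using y z by (simp add: family_def)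
    then show ?thesis
      by (rule solution_eq[OF \<theta> _ B']) (simp add: yeq[OF z] gwave_equation[OF z' \<theta>])
  qed
  have "continuous_on (sphere 0 r) (\<lambda>z. gwave \<theta> z n)" for n
    by (rule cong[of "\<lambda>z. y z n"]) (use y eq in \<open>auto simp: family_def\<close>)
  moreover have "wbdd wr B (gwave \<theta> z)" if "cmod z = r" for z
  proof -
    have z: "z \<in> sphere 0 r" using that by simp
    have "wbdd wr B (y z)" using y z unfolding family_def by blast
    then show ?thesis unfolding eq[OF z] .
  qed
  ultimately show ?thesis by blast
qed

text \<open>For r = \<open>rp\<close> and r = \<open>rm\<close> these are the two parts of
  \<open>center_frame\<close>.\<close>

definition green :: "nat \<Rightarrow> complex ^ 'd \<Rightarrow> int \<Rightarrow> complex" where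
  "green p \<theta> k = contour_integral (circlepath 0 r)
     (\<lambda>z. z powi (k + int p) * g_fun h V W E \<alpha> \<epsilon> z (rot \<alpha> k \<theta>)) / (2 * of_real pi * \<i>)"

lemma green_eq:
  "green p \<theta> k = contour_integral (circlepath 0 r) (\<lambda>z. z powi int p * gwave \<theta> z k) / (2 * of_real pi * \<i>)"
proof -
  have "contour_integral (circlepath 0 r) (\<lambda>z. z powi (k + int p) * g_fun h V W E \<alpha> \<epsilon> z (rot \<alpha> k \<theta>))
      = contour_integral (circlepath 0 r) (\<lambda>z. z powi int p * gwave \<theta> z k)"
  proof (rule contour_integral_cong)
    fix z assume "z \<in> path_image (circlepath 0 r)"
    then have "z \<noteq> 0" using r by auto
    then show "z powi (k + int p) * g_fun h V W E \<alpha> \<epsilon> z (rot \<alpha> k \<theta>) = z powi int p * gwave \<theta> z k"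
      by (simp add: gwave_def wave_def power_int_add)
  qed simp
  then show ?thesis by (simp add: green_def)
qed

lemma green_wbdd:
  assumes \<theta>: "\<theta> \<in> torus_strip h"
  shows "\<exists>B. wbdd wr B (green p \<theta>)"
proof -
  obtain B where B: "\<And>z. cmod z = r \<Longrightarrow> wbdd wr B (gwave \<theta> z)"
    and cont: "\<And>n. continuous_on (sphere 0 r) (\<lambda>z. gwave \<theta> z n)" using gwave_regular[OF \<theta>] by blast
  have "cmod (green p \<theta> k) \<le> (r ^ p * B * r) * r powi k" for k
  proof -
    have int: "(\<lambda>z. z powi int p * gwave \<theta> z k) contour_integrable_on circlepath 0 r"
      using r cont by (intro contour_integrable_continuous_circlepath continuous_intros) auto
    have bd: "cmod (z powi int p * gwave \<theta> z k) \<le> r ^ p * (B * r powi k)" if "cmod z = r" for z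
      using wbddD[OF B[OF that], of k] that r by (simp add: norm_mult norm_power mult_left_mono)
    have "cmod (of_real r) = r" using r by simp
    from bd[OF this] have "0 \<le> r ^ p * (B * r powi k)" using norm_ge_zero order_trans by blast
    then have "cmod (contour_integral (circlepath 0 r) (\<lambda>z. z powi int p * gwave \<theta> z k)) \<le> r ^ p * (B * r powi k) * (2 * pi * r)"
      using r bd by (intro has_contour_integral_bound_circlepath[OF has_contour_integral_integral[OF int]]) auto
    then show ?thesis
      unfolding green_eq by (simp add: norm_divide norm_mult field_simps)
  qed
  then show ?thesis unfolding wbdd_def by blast
qed

text \<open>The equation of \<open>gwave\<close>, with right side z powi n, is integrated against z
  powi p; the integral of z powi (n + p) vanishes unless n = - 1 - p, which produces the unit source
  there.\<close>

lemma green_equation: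
  assumes \<theta>: "\<theta> \<in> torus_strip h"
  shows "conv v (green p \<theta>) n - pot \<theta> n * green p \<theta> n = delta (- 1 - int p) n"
proof -
  obtain B where B: "\<And>z. cmod z = r \<Longrightarrow> wbdd wr B (gwave \<theta> z)"
    and cont: "\<And>n. continuous_on (sphere 0 r) (\<lambda>z. gwave \<theta> z n)" using gwave_regular[OF \<theta>] by blast
  let ?I = "contour_integral (circlepath 0 r)"
  have int: "(\<lambda>z. z powi int p * gwave \<theta> z k) contour_integrable_on circlepath 0 r" for k
    using r cont by (intro contour_integrable_continuous_circlepath continuous_intros) auto
  have G: "?I (\<lambda>z. z powi int p * gwave \<theta> z k) = 2 * of_real pi * \<i> * green p \<theta> k" for k
    unfolding green_eq by simp
  have "((\<lambda>k. ?I (\<lambda>z. v k * (z powi int p * gwave \<theta> z (n + k)))) has_sum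
      ?I (\<lambda>z. z powi int p * conv v (gwave \<theta> z) n)) UNIV"
  proof (rule has_sum_contour_integral_circlepath[OF r])
    show "continuous_on (sphere 0 r) (\<lambda>z. v k * (z powi int p * gwave \<theta> z (n + k)))" for k
      using r cont by (intro continuous_intros) auto
    show "(\<lambda>k. r ^ p * (B * r powi n * (cmod (v k) * r powi k))) summable_on UNIV"
      by (intro summable_on_cmult_right v_summable)
    show "cmod (v k * (z powi int p * gwave \<theta> z (n + k))) \<le> r ^ p * (B * r powi n * (cmod (v k) * r powi k))"
      if "z \<in> sphere 0 r" for k z
    proof -
      have z: "cmod z = r" using that by simp
      have "cmod (v k * (z powi int p * gwave \<theta> z (n + k))) = r ^ p * cmod (v k * gwave \<theta> z (n + k))"
        by (simp add: norm_mult norm_power z)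
      also have "\<dots> \<le> r ^ p * (B * r powi n * (cmod (v k) * r powi k))"
        using r by (intro mult_left_mono conv_term_bound[OF mod_r B[OF z]]) auto
      finally show ?thesis .
    qed
    show "((\<lambda>k. v k * (z powi int p * gwave \<theta> z (n + k))) has_sum z powi int p * conv v (gwave \<theta> z) n) UNIV"
      if "z \<in> sphere 0 r" for z
      using has_sum_cmult_right[OF conv_has_sum[OF mod_r v_summable B], of z "z powi int p" n] that
      by (simp add: mult.left_commute)
  qed
  moreover have "?I (\<lambda>z. v k * (z powi int p * gwave \<theta> z (n + k))) = 2 * of_real pi * \<i> * (v k * green p \<theta> (n + k))" for k
    using contour_integral_lmul[OF int, of "v k" "n + k"] G[of "n + k"] by simp
  ultimately have s1: "((\<lambda>k. 2 * of_real pi * \<i> * (v k * green p \<theta> (n + k))) has_sum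
      ?I (\<lambda>z. z powi int p * conv v (gwave \<theta> z) n)) UNIV" by simp
  obtain B' where B': "wbdd wr B' (green p \<theta>)" using green_wbdd[OF \<theta>] by blast
  have s2: "((\<lambda>k. 2 * of_real pi * \<i> * (v k * green p \<theta> (n + k))) has_sum
      2 * of_real pi * \<i> * conv v (green p \<theta>) n) UNIV"
    by (rule has_sum_cmult_right[OF conv_has_sum[OF mod_r v_summable B']])
  have 1: "2 * of_real pi * \<i> * conv v (green p \<theta>) n = ?I (\<lambda>z. z powi int p * conv v (gwave \<theta> z) n)"
    by (rule has_sum_unique[OF s2 s1])
  have "?I (\<lambda>z. z powi int p * conv v (gwave \<theta> z) n)
      = ?I (\<lambda>z. z powi (n + int p) + pot \<theta> n * (z powi int p * gwave \<theta> z n))"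
  proof (rule contour_integral_cong)
    fix z assume "z \<in> path_image (circlepath 0 r)"
    then have z: "cmod z = r" "z \<noteq> 0" using r by auto
    have "conv v (gwave \<theta> z) n = z powi n + pot \<theta> n * gwave \<theta> z n"
      using gwave_equation[OF z(1) \<theta>, of n] by (simp add: algebra_simps)
    then show "z powi int p * conv v (gwave \<theta> z) n = z powi (n + int p) + pot \<theta> n * (z powi int p * gwave \<theta> z n)"
      using z by (simp add: power_int_add algebra_simps)
  qed simp
  also have "\<dots> = ?I (\<lambda>z. z powi (n + int p)) + ?I (\<lambda>z. pot \<theta> n * (z powi int p * gwave \<theta> z n))"
    using r by (intro contour_integral_add contour_integrable_lmul int
        contour_integrable_continuous_circlepath continuous_intros) auto
  also have "?I (\<lambda>z. pot \<theta> n * (z powi int p * gwave \<theta> z n)) = 2 * of_real pi * \<i> * (pot \<theta> n * green p \<theta> n)"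
    using contour_integral_lmul[OF int, of "pot \<theta> n" n] G[of n] by simp
  also have "?I (\<lambda>z. z powi (n + int p)) = 2 * of_real pi * \<i> * delta (- 1 - int p) n"
    using contour_integral_powi[OF r, of "n + int p"] by (auto simp: delta_def)
  finally have "2 * of_real pi * \<i> * conv v (green p \<theta>) n
      = 2 * of_real pi * \<i> * (delta (- 1 - int p) n + pot \<theta> n * green p \<theta> n)"
    unfolding 1 by (simp add: distrib_left)
  then have "conv v (green p \<theta>) n = delta (- 1 - int p) n + pot \<theta> n * green p \<theta> n" by simp
  then show ?thesis by simp
qed

text \<open>The unit-source equation, solved with \<theta> as parameter, has an analytic and
  uniformly bounded solution, which uniqueness identifies with the contour integral.\<close>

lemma green_holomorphic:
  "(\<forall>k. hol_torus h (\<lambda>\<theta>. green p \<theta> k)) \<and> (\<exists>B\<ge>0. \<forall>\<theta>\<in>torus_strip h. wbdd wr B (green p \<theta>))"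
proof -
  interpret uniform_algebra "torus_strip h :: (complex ^ 'd) set" "hol_torus h"
    by (rule hol_torus_uniform_algebra)
  have d: "wbdd wr (1 / wr (- 1 - int p)) (delta (- 1 - int p))"
    using r by (intro delta_wbdd[where w = wr]) simp
  have "family wr (1 / wr (- 1 - int p)) (\<lambda>_. delta (- 1 - int p))"
    unfolding family_def by (auto intro: const d)
  from inverse_perturbed_solution[where b = pot, OF mod_r v_summable q_summable vq hol_pot pot_bound \<beta>(2) small this]
  obtain y B where y: "family wr B y" and yeq: "\<And>\<theta> n. \<theta> \<in> torus_strip h \<Longrightarrow>
      conv v (y \<theta>) n - pot \<theta> n * y \<theta> n = delta (- 1 - int p) n" using r by auto
  have eq: "y \<theta> = green p \<theta>" if \<theta>: "\<theta> \<in> torus_strip h" for \<theta>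
  proof -
    obtain B' where B': "wbdd wr B' (green p \<theta>)" using green_wbdd[OF \<theta>] by blast
    have "wbdd wr B (y \<theta>)" using y \<theta> by (simp add: family_def)
    then show ?thesis
      by (rule solution_eq[OF \<theta> _ B']) (simp add: yeq[OF \<theta>] green_equation[OF \<theta>])
  qed
  have "hol_torus h (\<lambda>\<theta>. green p \<theta> k)" for k
    by (rule cong[of "\<lambda>\<theta>. y \<theta> k"]) (use y eq in \<open>auto simp: family_def\<close>)
  moreover have "wbdd wr (max 0 B) (green p \<theta>)" if "\<theta> \<in> torus_strip h" for \<theta>
    by (rule wbdd_mono[of _ B]) (use y eq[OF that] that r in \<open>auto simp: family_def\<close>)
  ultimately show ?thesis by (intro conjI allI exI[of _ "max 0 B"]) auto
qed

end

section \<open>The center frame and the cocycle\<close>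

lemma weight_exp_summable:
  assumes r: "0 < rm" "rm < 1" "1 < rp" and \<xi>: "exp (- \<xi>) < rm" "rp < exp \<xi>"
  shows "(\<lambda>k. wmax rm rp k * exp (- \<xi> * \<bar>real_of_int k\<bar>)) summable_on UNIV"
proof -
  define q where "q = max (rp * exp (- \<xi>)) (inverse rm * exp (- \<xi>))"
  have "rp * exp (- \<xi>) < 1"
    using \<xi>(2) by (simp add: exp_minus divide_simps flip: divide_inverse)
  moreover have "inverse rm * exp (- \<xi>) < 1"
    using \<xi>(1) r by (simp add: field_simps)
  ultimately have q: "0 \<le> q" "q < 1" using r by (auto simp: q_def le_max_iff_disj)
  show ?thesis
  proof (rule summable_on_comparison_test[OF summable_on_int_geometric[OF q]])
    fix k :: int
    have e: "exp (- \<xi> * \<bar>real_of_int k\<bar>) = exp (- \<xi>) ^ nat \<bar>k\<bar>"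
      by (simp add: exp_of_nat_mult[symmetric] mult.commute)
    show "wmax rm rp k * exp (- \<xi> * \<bar>real_of_int k\<bar>) \<le> q ^ nat \<bar>k\<bar>"
    proof (cases "0 \<le> k")
      case True
      then have "wmax rm rp k * exp (- \<xi> * \<bar>real_of_int k\<bar>) = (rp * exp (- \<xi>)) ^ nat \<bar>k\<bar>"
        unfolding e using r by (simp add: wmax_nonneg_index power_mult_distrib power_int_def)
      also have "\<dots> \<le> q ^ nat \<bar>k\<bar>"
        using r by (intro power_mono) (auto simp: q_def)
      finally show ?thesis .
    next
      case False
      then have "wmax rm rp k * exp (- \<xi> * \<bar>real_of_int k\<bar>) = (inverse rm * exp (- \<xi>)) ^ nat \<bar>k\<bar>"
        unfolding e using r by (simp add: wmax_neg_index power_mult_distrib power_int_def)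
      also have "\<dots> \<le> q ^ nat \<bar>k\<bar>"
        using r by (intro power_mono) (auto simp: q_def)
      finally show ?thesis .
    qed
    show "0 \<le> wmax rm rp k * exp (- \<xi> * \<bar>real_of_int k\<bar>)"
      using r by (intro mult_nonneg_nonneg) (auto simp: wmax_def le_max_iff_disj)
  qed
qed

text \<open>\<open>u n\<close> is the entry at 0 of the sequence shifted by n, and there the weight
  is 1.\<close>

lemma norm_le_seq_norm:
  assumes u: "u \<in> seq_space \<xi>" and \<xi>: "0 \<le> \<xi>"
  shows "cmod (u n) \<le> seq_norm \<xi> (shift n u)"
proof -
  have u': "(\<lambda>k. cmod (u k) * exp (- \<xi> * \<bar>real_of_int k\<bar>)) summable_on UNIV"
    using u by (simp add: seq_space_def)
  have "(\<lambda>k. cmod (u (k + n)) * exp (- \<xi> * \<bar>real_of_int (k + n)\<bar>)) summable_on UNIV"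
    using summable_on_reindex_bij_witness[of UNIV "\<lambda>k. k - n" "\<lambda>k. k + n" UNIV
        "\<lambda>k. cmod (u k) * exp (- \<xi> * \<bar>real_of_int k\<bar>)"] u' by simp
  then have "(\<lambda>k. exp (\<xi> * \<bar>real_of_int n\<bar>) * (cmod (u (k + n)) * exp (- \<xi> * \<bar>real_of_int (k + n)\<bar>))) summable_on UNIV"
    by (rule summable_on_cmult_right)
  \<comment> \<open>Summability of the shifted sequence must be established, since
    \<open>infsum\<close> would otherwise default to 0 and bound nothing.\<close>
  then have s: "(\<lambda>k. cmod (shift n u k) * exp (- \<xi> * \<bar>real_of_int k\<bar>)) summable_on UNIV"
  proof (rule summable_on_comparison_test)
    fix k :: int
    have "\<bar>real_of_int (k + n)\<bar> \<le> \<bar>real_of_int n\<bar> + \<bar>real_of_int k\<bar>" by simp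
    from mult_left_mono[OF this \<xi>]
    have "exp (- \<xi> * \<bar>real_of_int k\<bar>) \<le> exp (\<xi> * \<bar>real_of_int n\<bar> + - \<xi> * \<bar>real_of_int (k + n)\<bar>)"
      by (simp add: distrib_left)
    from mult_left_mono[OF this[unfolded exp_add], of "cmod (u (k + n))"]
    show "cmod (shift n u k) * exp (- \<xi> * \<bar>real_of_int k\<bar>)
        \<le> exp (\<xi> * \<bar>real_of_int n\<bar>) * (cmod (u (k + n)) * exp (- \<xi> * \<bar>real_of_int (k + n)\<bar>))"
      by (simp only: shift_def norm_ge_zero simp_thms mult_ac)
  qed simp
  have "(\<Sum>k\<in>{0}. cmod (shift n u k) * exp (- \<xi> * \<bar>real_of_int k\<bar>)) \<le> seq_norm \<xi> (shift n u)"
    unfolding seq_norm_def by (rule finite_sum_le_infsum[OF s]) auto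
  then show ?thesis by (simp add: shift_def)
qed

lemma mat_norm_le:
  assumes "A \<in> carrier_mat n n" "B \<in> carrier_mat n n" "0 \<le> \<kappa>"
    "\<And>i j. i < n \<Longrightarrow> j < n \<Longrightarrow> cmod (A $$ (i, j) - B $$ (i, j)) \<le> \<kappa>"
  shows "mat_norm (A - B) \<le> real n * \<kappa>"
proof -
  have "(\<Sum>i<n. \<Sum>j<n. (cmod ((A - B) $$ (i, j)))\<^sup>2) \<le> (\<Sum>i<n. \<Sum>j<n. \<kappa>\<^sup>2)"
    using assms by (intro sum_mono power_mono) auto
  also have "\<dots> = (real n * \<kappa>)\<^sup>2" by (simp add: power_mult_distrib power2_eq_square)
  finally have "mat_norm (A - B) \<le> sqrt ((real n * \<kappa>)\<^sup>2)"
    using assms(1,2) unfolding mat_norm_def by (intro real_sqrt_le_mono) auto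
  then show ?thesis using assms(3) by simp
qed

text \<open>The form of multiplication by z modulo a monic polynomial of degree N: the shift raises
  the frame index by one, and only the image of the last vector has to be reduced.\<close>

definition companion :: "nat \<Rightarrow> (nat \<Rightarrow> complex) \<Rightarrow> complex mat" where
  "companion N c = mat N N (\<lambda>(q, p). if Suc p < N then (if q = Suc p then 1 else 0) else c q)"

locale torus_symbol = symbol rm rp v h hinv ri ro \<zeta>s
  for rm rp v h hinv ri ro \<zeta>s +
  fixes hh \<xi> E \<epsilon> \<beta> :: real
    and V :: "complex \<Rightarrow> complex" and W :: "complex ^ 'd::finite \<Rightarrow> complex" and \<alpha> :: "real ^ 'd"
  assumes fourier: "\<And>k. fourier_coeff V k = v k + (if k = 0 then of_real E else 0)"
    and W: "hol_torus hh W"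
    and \<beta>: "\<And>\<theta>. \<theta> \<in> torus_strip hh \<Longrightarrow> cmod (of_real \<epsilon> * W \<theta>) \<le> \<beta>" "small_bound \<beta>"
    and \<xi>: "0 < \<xi>" "exp (- \<xi>) < rm" "rp < exp \<xi>"
begin

sublocale inner: circle_inverse rm v ri hh E \<epsilon> \<beta> V W \<alpha>
  using rm v_summable_i ri_summable v_ri ri_v fourier W \<beta>
  by unfold_locales (auto simp: small_bound_def bound_i_def)

sublocale outer: circle_inverse rp v ro hh E \<epsilon> \<beta> V W \<alpha>
  using rp_pos v_summable_o ro_summable v_ro ro_v fourier W \<beta>
  by unfold_locales (auto simp: small_bound_def bound_o_def)

abbreviation "pot \<equiv> inner.pot"
abbreviation "frame \<equiv> center_frame hh rm rp V W E \<alpha> \<epsilon>"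
abbreviation "fiber \<equiv> center_fiber \<xi> rm rp V W E \<alpha> \<epsilon>"

lemma pot_small: "\<theta> \<in> torus_strip hh \<Longrightarrow> small (pot \<theta>)"
  unfolding small_def using \<beta>(2) inner.pot_bound by blast

lemma shift_pot: "shift m (pot \<theta>) = pot (rot \<alpha> m \<theta>)"
  by (auto simp: shift_def inner.pot_rot)

lemma frame_green: "frame p \<theta> k = outer.green p \<theta> k - inner.green p \<theta> k"
  unfolding center_frame_def outer.green_def inner.green_def Let_def by (rule diff_divide_distrib)

text \<open>Uniqueness identifies the two contour integrals with the abstract Green functions; the
  frame index p belongs to the source - 1 - p.\<close>

lemma frame_mode:
  assumes \<theta>: "\<theta> \<in> torus_strip hh"
  shows "frame p \<theta> = mode (pot \<theta>) (- 1 - int p)"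
proof -
  obtain B where "wbdd wi B (inner.green p \<theta>)" using inner.green_wbdd[OF \<theta>] by blast
  then have "green_i (pot \<theta>) (- 1 - int p) = inner.green p \<theta>"
    using inner.green_equation[OF \<theta>] 
    by (intro green_i_eqI pot_small \<theta> wb_wbdd) (auto simp: opT_def)
  moreover obtain B where "wbdd wo B (outer.green p \<theta>)" using outer.green_wbdd[OF \<theta>] by blast
  then have "green_o (pot \<theta>) (- 1 - int p) = outer.green p \<theta>"
    using outer.green_equation[OF \<theta>]
    by (intro green_o_eqI pot_small \<theta> wb_wbdd) (auto simp: opT_def)
  ultimately show ?thesis by (auto simp: mode_def frame_green)
qed

lemma operator_opT:
  assumes "wb wx u"
  shows "long_range_op V W \<alpha> \<epsilon> \<theta> u n = opT (pot \<theta>) u n + of_real E * u n"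
proof -
  obtain B where B: "wbdd wx B u" using assms by (auto simp: wb_def)
  have "((\<lambda>k. (if k = 0 then of_real E else 0) * u (n + k)) has_sum of_real E * u n) UNIV"
    by (rule has_sum_finite_neutralI[of "{0}"]) auto
  from has_sum_add[OF conv_has_sum[OF moderate_wx v_summable B] this]
  have "(\<Sum>\<^sub>\<infinity>k. fourier_coeff V k * u (n + k)) = conv v u n + of_real E * u n"
    unfolding fourier by (intro infsumI) (simp add: distrib_right)
  then show ?thesis
    by (simp add: long_range_op_def opT_def inner.pot_def)
qed

text \<open>One direction reads pointwise growth off the norms of shifts by
  \<open>norm_le_seq_norm\<close>. The other uses that \<open>wmax\<close> is submultiplicative and
  summable against exp (- \<xi> |k|), because rp < exp \<xi> and exp (- \<xi>) < rm.\<close>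

lemma fiber_center: "fiber \<theta> = center (pot \<theta>)"
proof (intro equalityI subsetI)
  fix u assume u: "u \<in> fiber \<theta>"
  then have us: "u \<in> seq_space \<xi>" and eq: "long_range_op V W \<alpha> \<epsilon> \<theta> u = (\<lambda>n. of_real E * u n)"
    by (auto simp: center_fiber_def solution_fiber_def)
  obtain C where C: "\<And>n::nat. rp powi (- int n) * seq_norm \<xi> (shift (int n) u) \<le> C"
    using u by (auto simp: center_fiber_def bdd_above_def)
  obtain C' where C': "\<And>n::nat. rm ^ n * seq_norm \<xi> (shift (- int n) u) \<le> C'"
    using u by (auto simp: center_fiber_def bdd_above_def)
  have "cmod (u n) \<le> max C C' * wx n" for n
  proof (cases "0 \<le> n")
    case True
    then obtain m where m: "n = int m" using nonneg_int_cases by blast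
    have "rp powi (- int m) * cmod (u n) \<le> C"
    proof (rule order_trans[OF _ C[of m]])
      show "rp powi (- int m) * cmod (u n) \<le> rp powi (- int m) * seq_norm \<xi> (shift (int m) u)"
        unfolding m using \<xi>(1) rp by (intro mult_left_mono norm_le_seq_norm[OF us]) auto
    qed
    then have "cmod (u n) \<le> C * rp ^ m"
      using rp by (simp add: power_int_minus field_simps)
    also have "\<dots> \<le> max C C' * rp ^ m" using rp by (intro mult_right_mono) auto
    finally show ?thesis using True rm rp by (simp add: wmax_nonneg_index m)
  next
    case False
    then obtain m where m: "n = - int m" by (metis int_cases2 of_nat_0_le_iff)
    have "rm ^ m * cmod (u n) \<le> C'"
    proof (rule order_trans[OF _ C'[of m]])
      show "rm ^ m * cmod (u n) \<le> rm ^ m * seq_norm \<xi> (shift (- int m) u)"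
        unfolding m using \<xi>(1) rm by (intro mult_left_mono norm_le_seq_norm[OF us]) auto
    qed
    then have "cmod (u n) \<le> C' * rm powi n"
      using rm by (simp add: m power_int_minus field_simps)
    also have "\<dots> \<le> max C C' * rm powi n" using rm by (intro mult_right_mono) auto
    finally show ?thesis using False rm rp by (simp add: wmax_neg_index)
  qed
  then have wb: "wb wx u" by (intro wb_wbdd[of _ "max C C'"]) (simp add: wbdd_def)
  have "opT (pot \<theta>) u n = 0" for n
    using operator_opT[OF wb, of \<theta> n] fun_cong[OF eq, of n] by simp
  with wb show "u \<in> center (pot \<theta>)" by (auto simp: center_def)
next
  fix u assume u: "u \<in> center (pot \<theta>)"
  then have wb: "wb wx u" and eq: "opT (pot \<theta>) u = (\<lambda>_. 0)" by (auto simp: center_def)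
  obtain B where B: "wbdd wx B u" using wb by (auto simp: wb_def)
  have B0: "0 \<le> B" by (rule wbdd_nonneg[where w = wx and n = 0, OF wx_pos B])
  note S = weight_exp_summable[OF rm rp \<xi>(2,3)]
  define S where "S = (\<Sum>\<^sub>\<infinity>k. wx k * exp (- \<xi> * \<bar>real_of_int k\<bar>))"
  have sh: "cmod (shift m u k) \<le> B * wx m * wx k" for m k
    using wbddD[OF B, of "m + k"] mult_left_mono[OF moderate_le[OF moderate_wx, of m k] B0]
    by (simp add: shift_def add.commute mult_ac)
  have n: "seq_norm \<xi> (shift m u) \<le> B * wx m * S" for m
    unfolding S_def by (rule seq_norm_le(2)[OF S sh])
  have "rp powi (- int n) * seq_norm \<xi> (shift (int n) u) \<le> B * S" for n
  proof -
    have "rp powi (- int n) * seq_norm \<xi> (shift (int n) u) \<le> rp powi (- int n) * (B * wx (int n) * S)"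
      using rp by (intro mult_left_mono n) auto
    also have "\<dots> = B * S" using rm rp by (simp add: wmax_nonneg_index power_int_minus)
    finally show ?thesis .
  qed
  moreover have "rm ^ n * seq_norm \<xi> (shift (- int n) u) \<le> B * S" for n
  proof -
    \<comment> \<open>\<open>wmax_neg_index\<close> leaves out n = 0, where both powers are
      1.\<close>
    have w: "wx (- int n) = rm powi (- int n)"
    proof (cases "n = 0")
      case False
      then show ?thesis using rm rp by (intro wmax_neg_index) auto
    qed (simp add: wmax_def)
    have "rm ^ n * seq_norm \<xi> (shift (- int n) u) \<le> rm ^ n * (B * wx (- int n) * S)"
      using rm by (intro mult_left_mono n) auto
    also have "\<dots> = B * S" unfolding w using rm by (simp add: power_int_minus)
    finally show ?thesis .
  qed
  moreover have "u \<in> seq_space \<xi>"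
    by (rule seq_norm_le(1)[OF S]) (rule wbddD[OF B])
  moreover have "long_range_op V W \<alpha> \<epsilon> \<theta> u = (\<lambda>n. of_real E * u n)"
    using operator_opT[OF wb] eq by auto
  ultimately show "u \<in> fiber \<theta>"
    by (auto simp: center_fiber_def solution_fiber_def intro!: bdd_aboveI2[of _ _ "B * S"])
qed

lemma frame_C_omega_seq: "frame p \<in> C_omega_seq hh \<xi>"
proof -
  obtain B where B: "0 \<le> B" "\<And>\<theta>. \<theta> \<in> torus_strip hh \<Longrightarrow> wbdd wi B (inner.green p \<theta>)"
    using inner.green_holomorphic by blast
  obtain B' where B': "0 \<le> B'" "\<And>\<theta>. \<theta> \<in> torus_strip hh \<Longrightarrow> wbdd wo B' (outer.green p \<theta>)"
    using outer.green_holomorphic by blast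
  interpret alg: uniform_algebra "torus_strip hh :: (complex ^ 'd) set" "hol_torus hh"
    by (rule hol_torus_uniform_algebra)
  show ?thesis
  proof (rule C_omega_seqI[where w = wx and B = "B' + B"])
    show "hol_torus hh (\<lambda>\<theta>. frame p \<theta> k)" for k
      unfolding frame_green using inner.green_holomorphic outer.green_holomorphic by (intro alg.diff) auto
    show "cmod (frame p \<theta> k) \<le> (B' + B) * wx k" if \<theta>: "\<theta> \<in> torus_strip hh" for \<theta> k
    proof -
      have "wbdd wx (B' + B) (\<lambda>k. outer.green p \<theta> k - inner.green p \<theta> k)"
        by (intro wbdd_diff wbdd_weight_mono[OF B'(2)[OF \<theta>] B'(1) wx_ge(2)]
            wbdd_weight_mono[OF B(2)[OF \<theta>] B(1) wx_ge(1)])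
      then show ?thesis unfolding frame_green by (rule wbddD)
    qed
    show "(\<lambda>k. wx k * exp (- \<xi> * \<bar>real_of_int k\<bar>)) summable_on UNIV"
      by (rule weight_exp_summable[OF rm rp \<xi>(2,3)])
  qed
qed

section \<open>Frame property and center cocycle\<close>

lemma frame_independent:
  assumes "\<theta> \<in> torus_strip hh" "\<And>k. (\<Sum>p<N. c p * frame p \<theta> k) = 0"
  shows "\<forall>p<N. c p = 0"
  using mode_independent[OF pot_small[OF assms(1)], of c] assms(2) by (simp add: frame_mode[OF assms(1)])

lemma frame_span:
  assumes "\<theta> \<in> torus_strip hh" "u \<in> center (pot \<theta>)"
  shows "\<exists>c. u = (\<lambda>k. \<Sum>p<N. c p * frame p \<theta> k)"
  using mode_span[OF pot_small[OF assms(1)] assms(2)] by (simp add: frame_mode[OF assms(1)])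

lemma frame_holomorphic: "holomorphic_frame hh \<xi> fiber N frame"
  unfolding holomorphic_frame_def
proof (intro conjI allI impI ballI frame_C_omega_seq)
  fix \<theta> :: "complex ^ 'd" assume \<theta>: "\<theta> \<in> torus_strip hh"
  show "frame p \<theta> \<in> fiber \<theta>" for p
    unfolding fiber_center frame_mode[OF \<theta>] by (rule mode_center[OF pot_small[OF \<theta>]])
  show "\<exists>c. u = (\<lambda>k. \<Sum>p<N. c p * frame p \<theta> k)" if "u \<in> fiber \<theta>" for u
    using frame_span[OF \<theta>] that by (simp add: fiber_center)
  show "c p = 0" if "\<forall>k. (\<Sum>p<N. c p * frame p \<theta> k) = 0" "p < N" for c p
    using frame_independent[OF \<theta>, of c] that by blast
qed

text \<open>The shift sends the last frame vector to the mode with source - 1 - N, and dividing that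
  source with remainder gives its coordinates. They differ from those without potential by the
  remainder of \<open>pot\<close> times the solution, which is O(\<beta>). No sign of K is assumed,
  hence its absolute value.\<close>

lemma last_column:
  assumes K: "\<And>f B p. wbdd wn B f \<Longrightarrow> cmod (remainder \<zeta>s f p) \<le> K * B" and half: "quot_bound * \<beta> \<le> 1 / 2"
  shows "\<exists>c. (\<forall>p. hol_torus hh (\<lambda>\<theta>. c \<theta> p)) \<and>
    (\<forall>\<theta>\<in>torus_strip hh. mode (pot \<theta>) (- 1 - int N) = (\<lambda>k. \<Sum>p<N. c \<theta> p * frame p \<theta> k)) \<and>
    (\<forall>\<theta>\<in>torus_strip hh. \<forall>p. cmod (c \<theta> p - remainder \<zeta>s (delta (- 1 - int N)) p)
        \<le> \<bar>K\<bar> * (\<beta> * (2 * quot_bound / wn (- 1 - int N))))"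
proof -
  interpret symbol_algebra rm rp v h hinv ri ro \<zeta>s "torus_strip hh :: (complex ^ 'd) set" "hol_torus hh"
    by (intro symbol_algebra.intro hol_torus_uniform_algebra) unfold_locales
  let ?a = "- 1 - int N"
  define B where "B = 1 / wn ?a"
  have B0: "0 \<le> B" using wn_pos[of ?a] by (simp add: B_def)
  have d: "wbdd wn B (delta ?a)" unfolding B_def by (rule delta_wbdd[where w = wn, OF wn_pos])
  have fam: "family wn B (\<lambda>_. delta ?a)" unfolding family_def using d by (auto intro: const)
  have \<beta>': "0 \<le> \<beta>" "quot_bound * \<beta> < 1" using \<beta>(2) by (auto simp: small_bound_def)
  obtain y where y: "family wn (quot_bound * B / (1 - quot_bound * \<beta>)) y"
    and P: "\<And>p. hol_torus hh (\<lambda>\<theta>. remainder \<zeta>s (\<lambda>n. delta ?a n + pot \<theta> n * y \<theta> n) p)"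
    and eq: "\<And>\<theta> n. \<theta> \<in> torus_strip hh \<Longrightarrow> conv v (y \<theta>) n - pot \<theta> n * y \<theta> n
        + (\<Sum>p<N. remainder \<zeta>s (\<lambda>n. delta ?a n + pot \<theta> n * y \<theta> n) p * delta (- 1 - int p) n) = delta ?a n"
    using perturbed_quot_solution[where b = pot, OF inner.hol_pot inner.pot_bound \<beta>' fam B0] by blast
  define c where "c \<theta> p = remainder \<zeta>s (\<lambda>n. delta ?a n + pot \<theta> n * y \<theta> n) p" for \<theta> p
  have "mode (pot \<theta>) ?a = (\<lambda>k. \<Sum>p<N. c \<theta> p * frame p \<theta> k)" if \<theta>: "\<theta> \<in> torus_strip hh" for \<theta>
  proof -
    have "wb wn (y \<theta>)" using y \<theta> unfolding family_def wb_def by blast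
    from mode_reduction[OF pot_small[OF \<theta>] this, of "c \<theta>" ?a] eq[OF \<theta>] show ?thesis
      by (simp add: opT_def c_def frame_mode[OF \<theta>])
  qed
  moreover have "cmod (c \<theta> p - remainder \<zeta>s (delta ?a) p) \<le> \<bar>K\<bar> * (\<beta> * (2 * quot_bound / wn ?a))"
    if \<theta>: "\<theta> \<in> torus_strip hh" for \<theta> p
  proof -
    have qb: "0 \<le> quot_bound" by (rule bounded_opD(1)[OF quot_bounded])
    \<comment> \<open>By \<open>half\<close> the Neumann factor is at most 2, so the final estimate
      is linear in \<beta>.\<close>
    have "quot_bound * B / (1 - quot_bound * \<beta>) \<le> quot_bound * B / (1 / 2)"
      using half qb B0 by (intro divide_left_mono) auto
    then have le: "quot_bound * B / (1 - quot_bound * \<beta>) \<le> 2 * quot_bound * B" by simp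
    have yb: "wbdd wn (2 * quot_bound * B) (y \<theta>)"
      using y \<theta> wn_pos by (intro wbdd_mono[OF _ le]) (auto simp: family_def less_imp_le)
    have py: "wbdd wn (\<beta> * (2 * quot_bound * B)) (\<lambda>n. pot \<theta> n * y \<theta> n)"
      by (rule wbdd_mult[OF inner.pot_bound[OF \<theta>] \<beta>'(1) yb])
    have "c \<theta> p - remainder \<zeta>s (delta ?a) p = remainder \<zeta>s (\<lambda>n. pot \<theta> n * y \<theta> n) p"
      unfolding c_def remainder_add[OF roots d py] by simp
    then have "cmod (c \<theta> p - remainder \<zeta>s (delta ?a) p) \<le> K * (\<beta> * (2 * quot_bound * B))"
      using K[OF py] by simp
    also have "\<dots> \<le> \<bar>K\<bar> * (\<beta> * (2 * quot_bound * B))"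
      using \<beta>'(1) qb B0 by (intro mult_right_mono) auto
    finally show ?thesis by (simp add: B_def)
  qed
  moreover have "hol_torus hh (\<lambda>\<theta>. c \<theta> p)" for p
    unfolding c_def by (rule P)
  ultimately show ?thesis by (intro exI[of _ c] conjI) blast+
qed

lemma cocycle_rel_companion:
  assumes \<theta>: "\<theta> \<in> torus_strip hh"
    and c: "mode (pot (rot \<alpha> 1 \<theta>)) (- 1 - int N) = (\<lambda>k. \<Sum>p<N. c p * frame p (rot \<alpha> 1 \<theta>) k)"
  shows "cocycle_rel \<alpha> N frame \<theta> (companion N c)"
  unfolding cocycle_rel_def
proof (intro conjI allI impI)
  have \<theta>': "rot \<alpha> 1 \<theta> \<in> torus_strip hh" using \<theta> by (simp add: rot_in_torus_strip)
  show "companion N c \<in> carrier_mat N N" by (simp add: companion_def)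
  fix p assume p: "p < N"
  have sh: "shift 1 (frame p \<theta>) = mode (pot (rot \<alpha> 1 \<theta>)) (- 1 - int (Suc p))"
    unfolding frame_mode[OF \<theta>] mode_shift[OF pot_small[OF \<theta>]] shift_pot by simp
  show "shift 1 (frame p \<theta>) = (\<lambda>k. \<Sum>q<N. frame q (rot \<alpha> 1 \<theta>) k * companion N c $$ (q, p))"
  proof (cases "Suc p < N")
    case True
    have "(\<Sum>q<N. frame q (rot \<alpha> 1 \<theta>) k * companion N c $$ (q, p))
        = (\<Sum>q<N. if q = Suc p then frame q (rot \<alpha> 1 \<theta>) k else 0)" for k
      using p True by (intro sum.cong) (auto simp: companion_def)
    with True show ?thesis unfolding sh frame_mode[OF \<theta>', symmetric] by simp
  next
    case False
    then have "Suc p = N" using p by simp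
    then show ?thesis
      unfolding sh using c p by (auto simp: companion_def mult.commute intro!: sum.cong)
  qed
qed

lemma cocycle_rel_unique:
  assumes \<theta>: "\<theta> \<in> torus_strip hh" and C: "cocycle_rel \<alpha> N frame \<theta> C" "cocycle_rel \<alpha> N frame \<theta> C'"
  shows "C = C'"
proof (rule eq_matI)
  have \<theta>': "rot \<alpha> 1 \<theta> \<in> torus_strip hh" using \<theta> by (simp add: rot_in_torus_strip)
  show "dim_row C = dim_row C'" "dim_col C = dim_col C'" using C by (auto simp: cocycle_rel_def)
  fix i j assume "i < dim_row C'" "j < dim_col C'"
  then have ij: "i < N" "j < N" using C by (auto simp: cocycle_rel_def)
  have "shift 1 (frame j \<theta>) = (\<lambda>k. \<Sum>q<N. frame q (rot \<alpha> 1 \<theta>) k * C $$ (q, j))"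
    using C(1) ij unfolding cocycle_rel_def by blast
  moreover have "shift 1 (frame j \<theta>) = (\<lambda>k. \<Sum>q<N. frame q (rot \<alpha> 1 \<theta>) k * C' $$ (q, j))"
    using C(2) ij unfolding cocycle_rel_def by blast
  ultimately have eq: "(\<Sum>q<N. frame q (rot \<alpha> 1 \<theta>) k * C $$ (q, j))
      - (\<Sum>q<N. frame q (rot \<alpha> 1 \<theta>) k * C' $$ (q, j)) = 0" for k
    by (simp only: fun_eq_iff right_minus_eq)
  have "(\<Sum>q<N. (C $$ (q, j) - C' $$ (q, j)) * frame q (rot \<alpha> 1 \<theta>) k) = 0" for k
    unfolding eq[of k, symmetric] sum_subtractf[symmetric] by (simp only: left_diff_distrib mult.commute)
  from frame_independent[OF \<theta>' this] ij show "C $$ (i, j) = C' $$ (i, j)" by auto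
qed

text \<open>The backward shift maps the fiber over \<theta> + \<alpha> into that over \<theta>. Its
  matrix in the two frames is a right inverse, and for square matrices this is an inverse.\<close>

lemma cocycle_invertible:
  assumes \<theta>: "\<theta> \<in> torus_strip hh" and C: "cocycle_rel \<alpha> N frame \<theta> C"
  shows "invertible_mat C"
proof -
  let ?\<theta>' = "rot \<alpha> 1 \<theta>"
  have \<theta>': "?\<theta>' \<in> torus_strip hh" using \<theta> by (simp add: rot_in_torus_strip)
  have cC: "C \<in> carrier_mat N N" using C by (simp add: cocycle_rel_def)
  have "\<exists>c. shift (- 1) (frame q ?\<theta>') = (\<lambda>k. \<Sum>p<N. c p * frame p \<theta> k)" for q
  proof (rule frame_span[OF \<theta>])
    have "shift (- 1) (frame q ?\<theta>') \<in> center (shift (- 1) (pot ?\<theta>'))"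
      unfolding frame_mode[OF \<theta>'] by (intro center_shift mode_center pot_small \<theta>')
    then show "shift (- 1) (frame q ?\<theta>') \<in> center (pot \<theta>)"
      unfolding shift_pot rot_rot by (simp add: rot_0)
  qed
  then obtain b where b: "\<And>q. shift (- 1) (frame q ?\<theta>') = (\<lambda>k. \<Sum>p<N. b q p * frame p \<theta> k)" by metis
  define B where "B = mat N N (\<lambda>(p, q). b q p)"
  have cB: "B \<in> carrier_mat N N" by (simp add: B_def)
  have "C * B = 1\<^sub>m N"
  proof (rule eq_matI)
    fix i j assume "i < dim_row (1\<^sub>m N :: complex mat)" "j < dim_col (1\<^sub>m N :: complex mat)"
    then have ij: "i < N" "j < N" by auto
    have "frame j ?\<theta>' k = (\<Sum>i<N. (\<Sum>p<N. C $$ (i, p) * b j p) * frame i ?\<theta>' k)" for k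
    proof -
      have "frame j ?\<theta>' k = shift (- 1) (frame j ?\<theta>') (k + 1)" by (simp add: shift_def)
      also have "\<dots> = (\<Sum>p<N. b j p * frame p \<theta> (k + 1))" unfolding b ..
      also have "\<dots> = (\<Sum>p<N. b j p * (\<Sum>i<N. frame i ?\<theta>' k * C $$ (i, p)))"
      proof (rule sum.cong[OF refl])
        fix p assume "p \<in> {..<N}"
        then have "shift 1 (frame p \<theta>) k = (\<Sum>i<N. frame i ?\<theta>' k * C $$ (i, p))"
          using C by (simp add: cocycle_rel_def)
        then show "b j p * frame p \<theta> (k + 1) = b j p * (\<Sum>i<N. frame i ?\<theta>' k * C $$ (i, p))"
          by (simp add: shift_def)
      qed
      also have "\<dots> = (\<Sum>p<N. \<Sum>i<N. C $$ (i, p) * b j p * frame i ?\<theta>' k)"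
        by (simp add: sum_distrib_left mult_ac)
      also have "\<dots> = (\<Sum>i<N. (\<Sum>p<N. C $$ (i, p) * b j p) * frame i ?\<theta>' k)"
        by (subst sum.swap) (simp add: sum_distrib_right)
      finally show ?thesis .
    qed
    moreover have "frame j ?\<theta>' k = (\<Sum>i<N. (if i = j then 1 else 0) * frame i ?\<theta>' k)" for k
    proof -
      have "(\<Sum>i<N. (if i = j then 1 else 0) * frame i ?\<theta>' k) = (\<Sum>i<N. if i = j then frame i ?\<theta>' k else 0)"
        by (intro sum.cong) auto
      then show ?thesis using ij by simp
    qed
    ultimately have "(\<Sum>i<N. ((\<Sum>p<N. C $$ (i, p) * b j p) - (if i = j then 1 else 0)) * frame i ?\<theta>' k) = 0" for k
      unfolding left_diff_distrib sum_subtractf by (metis right_minus_eq)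
    from frame_independent[OF \<theta>' this] ij have "(\<Sum>p<N. C $$ (i, p) * b j p) = (if i = j then 1 else 0)" by auto
    moreover have "(C * B) $$ (i, j) = (\<Sum>p<N. C $$ (i, p) * b j p)"
      using cC ij by (simp add: B_def scalar_prod_def lessThan_atLeast0)
    ultimately show "(C * B) $$ (i, j) = 1\<^sub>m N $$ (i, j)" using ij by simp
  qed (use cC cB in auto)
  moreover from mat_mult_left_right_inverse[OF cC cB this] have "B * C = 1\<^sub>m N" .
  ultimately show ?thesis
    using cC cB unfolding invertible_mat_def inverts_mat_def by auto
qed

lemma center_cocycle_eq:
  assumes "\<theta> \<in> torus_strip hh" "cocycle_rel \<alpha> N frame \<theta> C" "2 * half_zeros V E = N"
  shows "center_cocycle hh rm rp V W E \<alpha> \<epsilon> \<theta> = C"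
  unfolding center_cocycle_def assms(3)
  by (rule the_equality) (fact assms(2), rule cocycle_rel_unique[OF assms(1) _ assms(2)])

text \<open>In the last claim the potential vanishes and the error bound forces equality; this
  identifies the companion matrix of the remainders as the constant cocycle at \<epsilon> =
  0.\<close>

lemma cocycle_summary:
  assumes K: "\<And>f B p. wbdd wn B f \<Longrightarrow> cmod (remainder \<zeta>s f p) \<le> K * B" and half: "quot_bound * \<beta> \<le> 1 / 2"
    and N: "2 * half_zeros V E = N" and hh: "0 < hh"
  shows "\<forall>\<theta>\<in>torus_strip hh. \<exists>!C. cocycle_rel \<alpha> N frame \<theta> C"
    and "center_cocycle hh rm rp V W E \<alpha> \<epsilon> \<in> C_omega_GL hh N"
    and "\<theta> \<in> torus_strip hh \<Longrightarrow> mat_norm (center_cocycle hh rm rp V W E \<alpha> \<epsilon> \<theta>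
          - companion N (remainder \<zeta>s (delta (- 1 - int N))))
        \<le> real N * (\<bar>K\<bar> * (\<beta> * (2 * quot_bound / wn (- 1 - int N))))"
    and "\<theta> \<in> torus_strip hh \<Longrightarrow> \<beta> = 0 \<Longrightarrow> center_cocycle hh rm rp V W E \<alpha> \<epsilon> \<theta>
          = companion N (remainder \<zeta>s (delta (- 1 - int N)))"
proof -
  obtain c where c: "\<And>p. hol_torus hh (\<lambda>\<theta>. c \<theta> p)"
    and red: "\<And>\<theta>. \<theta> \<in> torus_strip hh \<Longrightarrow>
        mode (pot \<theta>) (- 1 - int N) = (\<lambda>k. \<Sum>p<N. c \<theta> p * frame p \<theta> k)"
    and bd: "\<And>\<theta> p. \<theta> \<in> torus_strip hh \<Longrightarrow> cmod (c \<theta> p - remainder \<zeta>s (delta (- 1 - int N)) p)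
        \<le> \<bar>K\<bar> * (\<beta> * (2 * quot_bound / wn (- 1 - int N)))"
    using last_column[OF K half] by blast
  have rel: "cocycle_rel \<alpha> N frame \<theta> (companion N (c (rot \<alpha> 1 \<theta>)))" if "\<theta> \<in> torus_strip hh" for \<theta>
    using that by (intro cocycle_rel_companion red) (simp_all add: rot_in_torus_strip)
  have eq: "center_cocycle hh rm rp V W E \<alpha> \<epsilon> \<theta> = companion N (c (rot \<alpha> 1 \<theta>))"
    if "\<theta> \<in> torus_strip hh" for \<theta>
    by (rule center_cocycle_eq[OF that rel[OF that] N])
  show "\<forall>\<theta>\<in>torus_strip hh. \<exists>!C. cocycle_rel \<alpha> N frame \<theta> C"
    using rel cocycle_rel_unique by blast
  show "center_cocycle hh rm rp V W E \<alpha> \<epsilon> \<in> C_omega_GL hh N"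
    unfolding C_omega_GL_def mem_Collect_eq
  proof (intro conjI ballI allI impI)
    fix \<theta> :: "complex ^ 'd" assume \<theta>: "\<theta> \<in> torus_strip hh"
    show "center_cocycle hh rm rp V W E \<alpha> \<epsilon> \<theta> \<in> carrier_mat N N"
      unfolding eq[OF \<theta>] by (simp add: companion_def)
    show "invertible_mat (center_cocycle hh rm rp V W E \<alpha> \<epsilon> \<theta>)"
      unfolding eq[OF \<theta>] by (rule cocycle_invertible[OF \<theta> rel[OF \<theta>]])
  next
    fix i j assume ij: "i < N" "j < N"
    define f where "f \<theta> = (if Suc j < N then (if i = Suc j then 1 else 0) else c (rot \<alpha> 1 \<theta>) i)" for \<theta>
    have "hol_torus hh f"
      unfolding f_def using hol_torus_rot[OF c]
      by (cases "Suc j < N") (simp_all add: hol_torus_const)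
    from hol_torus_C_omega[OF this]
    have "(\<lambda>\<theta>\<in>torus_strip hh. f \<theta>) \<in> C_omega hh" .
    moreover have "(\<lambda>\<theta>\<in>torus_strip hh. center_cocycle hh rm rp V W E \<alpha> \<epsilon> \<theta> $$ (i, j))
        = (\<lambda>\<theta>\<in>torus_strip hh. f \<theta>)"
      using ij by (intro restrict_ext) (simp add: eq companion_def f_def)
    ultimately show "(\<lambda>\<theta>\<in>torus_strip hh. center_cocycle hh rm rp V W E \<alpha> \<epsilon> \<theta> $$ (i, j)) \<in> C_omega hh"
      by simp
  qed
  have qb: "0 \<le> quot_bound" by (rule bounded_opD(1)[OF quot_bounded])
  have \<kappa>: "0 \<le> \<bar>K\<bar> * (\<beta> * (2 * quot_bound / wn (- 1 - int N)))"
    using qb \<beta>(2) wn_pos[of "- 1 - int N"] by (auto simp: small_bound_def)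
  have entries: "cmod (companion N (c (rot \<alpha> 1 \<theta>)) $$ (i, j)
        - companion N (remainder \<zeta>s (delta (- 1 - int N))) $$ (i, j))
      \<le> \<bar>K\<bar> * (\<beta> * (2 * quot_bound / wn (- 1 - int N)))"
    if "\<theta> \<in> torus_strip hh" "i < N" "j < N" for \<theta> i j
    using that bd[of "rot \<alpha> 1 \<theta>" i] \<kappa> by (auto simp: companion_def rot_in_torus_strip)
  show "mat_norm (center_cocycle hh rm rp V W E \<alpha> \<epsilon> \<theta>
          - companion N (remainder \<zeta>s (delta (- 1 - int N))))
        \<le> real N * (\<bar>K\<bar> * (\<beta> * (2 * quot_bound / wn (- 1 - int N))))" if "\<theta> \<in> torus_strip hh"
    unfolding eq[OF that]
    by (rule mat_norm_le[OF _ _ \<kappa>]) (use entries[OF that] in \<open>simp_all add: companion_def\<close>)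
  show "center_cocycle hh rm rp V W E \<alpha> \<epsilon> \<theta> = companion N (remainder \<zeta>s (delta (- 1 - int N)))"
    if "\<theta> \<in> torus_strip hh" "\<beta> = 0"
    unfolding eq[OF that(1)]
    by (rule eq_matI) (use entries[OF that(1)] that(2) in \<open>auto simp: companion_def\<close>)
qed

end

text \<open>The bounds use W only through its supremum \<open>\<omega>\<close> on the strip, which
  the rotation preserves; therefore one \<epsilon>0 serves all \<alpha>.\<close>

lemma (in symbol) center_bundle:
  fixes W :: "complex ^ 'd::finite \<Rightarrow> complex" and V :: "complex \<Rightarrow> complex" and hh \<xi> E :: real
  assumes fourier: "\<And>k. fourier_coeff V k = v k + (if k = 0 then of_real E else 0)"
    and W: "hol_torus hh W" and hh: "0 < hh"
    and \<xi>: "0 < \<xi>" "exp (- \<xi>) < rm" "rp < exp \<xi>"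
    and N: "2 * half_zeros V E = N"
  shows "\<exists>\<epsilon>0>0. \<forall>\<alpha> :: real ^ 'd.
    (\<forall>\<epsilon>::real. \<bar>\<epsilon>\<bar> < \<epsilon>0 \<longrightarrow>
       (\<forall>z. cmod z = rm \<or> cmod z = rp \<longrightarrow>
          bij_betw (D_op hh V W E \<alpha> \<epsilon> z) (C_omega hh) (C_omega hh)) \<and>
       holomorphic_frame hh \<xi> (center_fiber \<xi> rm rp V W E \<alpha> \<epsilon>) N (center_frame hh rm rp V W E \<alpha> \<epsilon>) \<and>
       (\<forall>\<theta>\<in>torus_strip hh. \<exists>!C. cocycle_rel \<alpha> N (center_frame hh rm rp V W E \<alpha> \<epsilon>) \<theta> C) \<and>
       center_cocycle hh rm rp V W E \<alpha> \<epsilon> \<in> C_omega_GL hh N) \<and>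
    (\<exists>C0. (\<forall>\<theta>\<in>torus_strip hh. center_cocycle hh rm rp V W E \<alpha> 0 \<theta> = C0) \<and>
       (\<exists>K. \<forall>\<epsilon>. \<bar>\<epsilon>\<bar> < \<epsilon>0 \<longrightarrow>
          mat_sup_norm hh (\<lambda>\<theta>. center_cocycle hh rm rp V W E \<alpha> \<epsilon> \<theta> - C0) \<le> K * \<bar>\<epsilon>\<bar>))"
proof -
  obtain \<omega> where \<omega>: "\<And>\<theta>. \<theta> \<in> torus_strip hh \<Longrightarrow> cmod (W \<theta>) \<le> \<omega>"
    using hol_torus_bound[OF W] by blast
  have zero: "0 \<in> torus_strip hh" using hh by (simp add: torus_strip_def)
  have \<omega>0: "0 \<le> \<omega>" using \<omega>[OF zero] norm_ge_zero order_trans by blast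
  obtain K where K: "\<And>f B p. wbdd wn B f \<Longrightarrow> cmod (remainder \<zeta>s f p) \<le> K * B"
    using remainder_bound[OF roots] by blast
  have qb: "0 \<le> quot_bound" by (rule bounded_opD(1)[OF quot_bounded])
  have bi: "0 \<le> bound_i" unfolding bound_i_def by (rule bounded_opD(1)[OF conv_bounded_op[OF mod_i ri_summable]])
  have bo: "0 \<le> bound_o" unfolding bound_o_def by (rule bounded_opD(1)[OF conv_bounded_op[OF mod_o ro_summable]])
  define M where "M = bound_i + bound_o + quot_bound + 1"
  have M: "0 < M" "bound_i \<le> M" "bound_o \<le> M" "quot_bound \<le> M" using qb bi bo by (auto simp: M_def)
  \<comment> \<open>\<open>M\<close> dominates the norms of the three inverses, and the 1 added to
    \<open>\<omega>\<close> keeps the denominator positive when W = 0. The factor 2 gives k *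
    |\<epsilon>| * \<omega> \<le> 1 / 2, the margin that the estimate of the last column asks
    for.\<close>
  define \<epsilon>0 where "\<epsilon>0 = 1 / (2 * M * (\<omega> + 1))"
  have \<epsilon>0: "0 < \<epsilon>0" using M \<omega>0 by (simp add: \<epsilon>0_def)
  have half: "k * (\<bar>\<epsilon>\<bar> * \<omega>) \<le> 1 / 2" if "\<bar>\<epsilon>\<bar> < \<epsilon>0" "0 \<le> k" "k \<le> M" for \<epsilon> k
  proof -
    have "k * (\<bar>\<epsilon>\<bar> * \<omega>) \<le> M * (\<epsilon>0 * (\<omega> + 1))"
      using that M \<omega>0 by (intro mult_mono) auto
    also have "\<dots> = 1 / 2" using M \<omega>0 by (simp add: \<epsilon>0_def)
    finally show ?thesis .
  qed
  have ts: "torus_symbol rm rp v h hinv ri ro \<zeta>s hh \<xi> E \<epsilon> (\<bar>\<epsilon>\<bar> * \<omega>) V W"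
    if "\<bar>\<epsilon>\<bar> < \<epsilon>0" for \<epsilon>
  proof unfold_locales
    show "small_bound (\<bar>\<epsilon>\<bar> * \<omega>)"
      using half[OF that bi M(2)] half[OF that bo M(3)] half[OF that qb M(4)] \<omega>0
      by (simp add: small_bound_def)
    show "cmod (of_real \<epsilon> * W \<theta>) \<le> \<bar>\<epsilon>\<bar> * \<omega>" if "\<theta> \<in> torus_strip hh" for \<theta>
      using \<omega>[OF that] by (simp add: norm_mult mult_left_mono)
  qed (fact fourier W \<xi>)+
  define C0 where "C0 = companion N (remainder \<zeta>s (delta (- 1 - int N)))"
  define K' where "K' = real N * (\<bar>K\<bar> * (\<omega> * (2 * quot_bound / wn (- 1 - int N))))"
  show ?thesis
  proof (rule exI[of _ \<epsilon>0], intro conjI allI impI \<epsilon>0 exI[of _ C0] exI[of _ K'] ballI)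
    fix \<alpha> :: "real ^ 'd" and \<epsilon> :: real assume \<epsilon>: "\<bar>\<epsilon>\<bar> < \<epsilon>0"
    interpret T: torus_symbol rm rp v h hinv ri ro \<zeta>s hh \<xi> E \<epsilon> "\<bar>\<epsilon>\<bar> * \<omega>" V W \<alpha> by (rule ts[OF \<epsilon>])
    show "bij_betw (D_op hh V W E \<alpha> \<epsilon> z) (C_omega hh) (C_omega hh)" if "cmod z = rm \<or> cmod z = rp" for z
      using that T.inner.D_op_bij T.outer.D_op_bij by blast
    show "holomorphic_frame hh \<xi> (center_fiber \<xi> rm rp V W E \<alpha> \<epsilon>) N (center_frame hh rm rp V W E \<alpha> \<epsilon>)"
      by (rule T.frame_holomorphic)
    show "\<exists>!C. cocycle_rel \<alpha> N (center_frame hh rm rp V W E \<alpha> \<epsilon>) \<theta> C" if "\<theta> \<in> torus_strip hh" for \<theta>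
      using T.cocycle_summary(1)[OF K half[OF \<epsilon> qb M(4)] N hh] that by blast
    show "center_cocycle hh rm rp V W E \<alpha> \<epsilon> \<in> C_omega_GL hh N" by (rule T.cocycle_summary(2)[OF K half[OF \<epsilon> qb M(4)] N hh])
    have "mat_norm (center_cocycle hh rm rp V W E \<alpha> \<epsilon> \<theta> - C0) \<le> K' * \<bar>\<epsilon>\<bar>" if "\<theta> \<in> torus_strip hh" for \<theta>
      using T.cocycle_summary(3)[OF K half[OF \<epsilon> qb M(4)] N hh that] by (simp add: C0_def K'_def mult_ac)
    then show "mat_sup_norm hh (\<lambda>\<theta>. center_cocycle hh rm rp V W E \<alpha> \<epsilon> \<theta> - C0) \<le> K' * \<bar>\<epsilon>\<bar>"
      unfolding mat_sup_norm_def using zero by (intro cSUP_least) auto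
  next
    fix \<alpha> :: "real ^ 'd" and \<theta> :: "complex ^ 'd" assume \<theta>: "\<theta> \<in> torus_strip hh"
    have \<epsilon>: "\<bar>0\<bar> < \<epsilon>0" using \<epsilon>0 by simp
    interpret T: torus_symbol rm rp v h hinv ri ro \<zeta>s hh \<xi> E 0 "\<bar>0\<bar> * \<omega>" V W \<alpha> by (rule ts[OF \<epsilon>])
    have z: "\<bar>0 :: real\<bar> * \<omega> = 0" by (simp only: abs_zero mult_zero_left)
    show "center_cocycle hh rm rp V W E \<alpha> 0 \<theta> = C0"
      unfolding C0_def by (rule T.cocycle_summary(4)[OF K half[OF \<epsilon> qb M(4)] N hh \<theta> z])
  qed
qed

section \<open>Factorization of the symbol\<close>

text \<open>Near \<open>a\<close> the cofactor is \<open>zor_poly\<close>, elsewhere it is f w / (w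
  - a) ^ n; the two agree on a punctured disc and glue.\<close>

lemma holomorphic_factor_zero:
  assumes f: "f holomorphic_on S" and S: "open S" "connected S" "a \<in> S" and nz: "\<exists>w\<in>S. f w \<noteq> 0"
  shows "\<exists>n G. G holomorphic_on S \<and> G a \<noteq> 0 \<and> (\<forall>w\<in>S. f w = (w - a) ^ n * G w)"
proof -
  define n where "n = nat (zorder f a)"
  obtain r where r: "0 < r" "cball a r \<subseteq> S" "zor_poly f a holomorphic_on cball a r"
    and fac: "\<And>w. w \<in> cball a r \<Longrightarrow> f w = zor_poly f a w * (w - a) ^ n \<and> zor_poly f a w \<noteq> 0"
    using zorder_exist_zero[OF f S nz] unfolding n_def by blast
  define G where "G w = (if w = a then zor_poly f a a else f w / (w - a) ^ n)" for w
  have eq: "G w = zor_poly f a w" if "w \<in> cball a r" for w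
    using fac[OF that] by (simp add: G_def)
  have "G holomorphic_on ball a r"
    by (rule holomorphic_transform[OF holomorphic_on_subset[OF r(3) ball_subset_cball]]) (use eq in simp)
  moreover have "G holomorphic_on S - {a}"
  proof (rule holomorphic_transform)
    show "(\<lambda>w. f w / (w - a) ^ n) holomorphic_on S - {a}"
      by (intro holomorphic_intros holomorphic_on_subset[OF f]) auto
  qed (simp add: G_def)
  ultimately have "G holomorphic_on ball a r \<union> (S - {a})"
    using S by (intro holomorphic_on_Un) (auto intro: open_delete)
  moreover have "ball a r \<union> (S - {a}) = S" using r S by (auto simp: subset_iff)
  ultimately have "G holomorphic_on S" by simp
  moreover have "G a \<noteq> 0" using fac[of a] r by (simp add: G_def)
  moreover have "f w = (w - a) ^ n * G w" if "w \<in> S" for w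
    using fac[of a] r by (auto simp: G_def)
  ultimately show ?thesis by blast
qed

text \<open>The list repeats each zero by multiplicity. The product over the zeros already split off
  does not vanish at the new one, so the exponent found for the cofactor is the order of f
  itself.\<close>

lemma holomorphic_factor_zeros:
  assumes f: "f holomorphic_on S" and S: "open S" "connected S" and nz: "\<exists>w\<in>S. f w \<noteq> 0"
    and Z: "finite Z" "Z \<subseteq> S" "\<And>z. z \<in> Z \<Longrightarrow> f z = 0"
  shows "\<exists>\<zeta>s H. set \<zeta>s \<subseteq> Z \<and> H holomorphic_on S \<and> (\<forall>z\<in>Z. H z \<noteq> 0) \<and>
    (\<forall>w\<in>S. f w = (\<Prod>\<zeta>\<leftarrow>\<zeta>s. w - \<zeta>) * H w) \<and> int (length \<zeta>s) = (\<Sum>z\<in>Z. zorder f z)"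
  using Z
proof (induction Z rule: finite_induct)
  case empty
  show ?case using f by (intro exI[of _ "[]"] exI[of _ f]) simp
next
  case (insert a Z)
  then obtain \<zeta>s H where IH: "set \<zeta>s \<subseteq> Z" "H holomorphic_on S" "\<And>z. z \<in> Z \<Longrightarrow> H z \<noteq> 0"
    "\<And>w. w \<in> S \<Longrightarrow> f w = (\<Prod>\<zeta>\<leftarrow>\<zeta>s. w - \<zeta>) * H w" "int (length \<zeta>s) = (\<Sum>z\<in>Z. zorder f z)"
    by auto
  have a: "a \<in> S" using insert by auto
  have "\<exists>w\<in>S. H w \<noteq> 0" using nz IH(4) by fastforce
  from holomorphic_factor_zero[OF IH(2) S a this]
  obtain n G where G: "G holomorphic_on S" "G a \<noteq> 0" "\<And>w. w \<in> S \<Longrightarrow> H w = (w - a) ^ n * G w" by blast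
  define Q where "Q w = (\<Prod>\<zeta>\<leftarrow>\<zeta>s. w - \<zeta>)" for w
  have Qhol: "Q holomorphic_on S"
    unfolding Q_def by (induction \<zeta>s) (auto intro!: holomorphic_intros)
  have "Q a \<noteq> 0"
    using IH(1) insert.hyps by (auto simp: Q_def prod_list_zero_iff)
  have "zorder f a = int n"
  proof (rule zorder_eqI[OF S(1) a])
    show "(\<lambda>w. Q w * G w) holomorphic_on S" by (intro holomorphic_intros Qhol G)
    show "Q a * G a \<noteq> 0" using \<open>Q a \<noteq> 0\<close> G(2) by simp
    show "f w = Q w * G w * (w - a) powi int n" if "w \<in> S" for w
      using IH(4)[OF that] G(3)[OF that] by (simp add: Q_def mult_ac)
  qed
  moreover have "f w = (\<Prod>\<zeta>\<leftarrow>replicate n a @ \<zeta>s. w - \<zeta>) * G w" if "w \<in> S" for w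
    using IH(4)[OF that] G(3)[OF that] by (simp add: mult_ac map_replicate)
  moreover have "G z \<noteq> 0" if "z \<in> insert a Z" for z
    using that G(2) G(3)[of z] IH(3)[of z] insert.prems by auto
  ultimately show ?case
    using IH(1,5) G(1) insert.hyps
    by (intro exI[of _ "replicate n a @ \<zeta>s"] exI[of _ G]) auto
qed

lemma cis_diff: "cis t - cis a = 2 * \<i> * of_real (sin ((t - a) / 2)) * cis ((t + a) / 2)"
proof -
  have "cis t = cis ((t + a) / 2) * cis ((t - a) / 2)" "cis a = cis ((t + a) / 2) * cis (- ((t - a) / 2))"
    by (simp_all add: cis_mult field_simps)
  moreover have "cis d - cis (- d) = 2 * \<i> * of_real (sin d)" for d
    by (simp add: complex_eq_iff)
  ultimately show ?thesis
    by (metis (no_types, opaque_lifting) mult.commute right_diff_distrib)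
qed

text \<open>On the circle each z - \<zeta> is 2 i times a real sine times a phase with half the
  angle; these half angles make the parity of the number of factors visible as a sign after one
  turn.\<close>

lemma prod_list_cis_diff:
  assumes "\<forall>\<zeta>\<in>set \<zeta>s. cmod \<zeta> = 1"
  shows "(\<Prod>\<zeta>\<leftarrow>\<zeta>s. cis t - \<zeta>) = of_real (\<Prod>\<zeta>\<leftarrow>\<zeta>s. sin ((t - Arg \<zeta>) / 2))
    * ((2 * \<i>) ^ length \<zeta>s * cis ((real (length \<zeta>s) * t + (\<Sum>\<zeta>\<leftarrow>\<zeta>s. Arg \<zeta>)) / 2))"
  using assms
proof (induction \<zeta>s)
  case (Cons \<zeta> \<zeta>s)
  have "\<zeta> = cis (Arg \<zeta>)"
    using Cons.prems by (metis list.set_intros(1) cis_Arg mult_1 of_real_1 rcis_cmod_Arg rcis_def)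
  then have z: "cis t - \<zeta> = 2 * \<i> * of_real (sin ((t - Arg \<zeta>) / 2)) * cis ((t + Arg \<zeta>) / 2)"
    using cis_diff[of t "Arg \<zeta>"] by simp
  have c: "cis ((real (length (\<zeta> # \<zeta>s)) * t + (\<Sum>\<zeta>\<leftarrow>\<zeta> # \<zeta>s. Arg \<zeta>)) / 2)
      = cis ((t + Arg \<zeta>) / 2) * cis ((real (length \<zeta>s) * t + (\<Sum>\<zeta>\<leftarrow>\<zeta>s. Arg \<zeta>)) / 2)"
    by (simp add: cis_mult add_divide_distrib algebra_simps)
  show ?case
    unfolding c using Cons by (simp add: z mult_ac)
qed simp

text \<open>After dividing a real function on the circle by the sines belonging to its zeros there remains a
  continuous real function without zeros, which changes by the factor \<open>(-1) ^ N\<close> around the circle.\<close>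

lemma even_circle_zeros:
  assumes \<zeta>s: "\<forall>\<zeta>\<in>set \<zeta>s. cmod \<zeta> = 1"
    and H: "continuous_on (sphere 0 1) H" "\<And>z. cmod z = 1 \<Longrightarrow> H z \<noteq> 0"
    and real: "\<And>z. cmod z = 1 \<Longrightarrow> (\<Prod>\<zeta>\<leftarrow>\<zeta>s. z - \<zeta>) * H z \<in> \<real>"
  shows "even (length \<zeta>s)"
proof (rule ccontr)
  assume odd: "odd (length \<zeta>s)"
  define N where "N = length \<zeta>s"
  define A where "A = (\<Sum>\<zeta>\<leftarrow>\<zeta>s. Arg \<zeta>)"
  define P where "P t = (\<Prod>\<zeta>\<leftarrow>\<zeta>s. sin ((t - Arg \<zeta>) / 2))" for t
  define s where "s t = (2 * \<i>) ^ N * cis ((real N * t + A) / 2) * H (cis t)" for t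
  have s_cont: "continuous_on UNIV s"
    unfolding s_def
    by (intro continuous_intros continuous_on_compose2[OF H(1)]) auto
  have s_nz: "s t \<noteq> 0" for t using H(2)[of "cis t"] by (simp add: s_def)
  have Ps: "of_real (P t) * s t \<in> \<real>" for t
    using real[of "cis t"] unfolding prod_list_cis_diff[OF \<zeta>s] by (simp add: P_def s_def N_def A_def mult_ac)
  have P0: "countable {t. P t = 0}"
  proof -
    have "{t. P t = 0} \<subseteq> (\<Union>\<zeta>\<in>set \<zeta>s. range (\<lambda>n::int. 2 * pi * of_int n + Arg \<zeta>))"
    proof
      fix t assume "t \<in> {t. P t = 0}"
      then obtain \<zeta> where \<zeta>: "\<zeta> \<in> set \<zeta>s" "sin ((t - Arg \<zeta>) / 2) = 0"
        by (auto simp: P_def prod_list_zero_iff)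
      then obtain n :: int where "(t - Arg \<zeta>) / 2 = of_int n * pi" by (auto simp: sin_zero_iff_int2)
      then have "t = 2 * pi * of_int n + Arg \<zeta>" by (simp add: field_simps)
      with \<zeta>(1) show "t \<in> (\<Union>\<zeta>\<in>set \<zeta>s. range (\<lambda>n::int. 2 * pi * of_int n + Arg \<zeta>))" by blast
    qed
    moreover have "countable (\<Union>\<zeta>\<in>set \<zeta>s. range (\<lambda>n::int. 2 * pi * of_int n + Arg \<zeta>))"
      by (rule countable_UN[OF countable_finite[OF finite_set]]) (rule countable_image, simp)
    ultimately show ?thesis by (rule countable_subset)
  qed
  \<comment> \<open>Where P is not 0 the function \<open>s\<close> is real. A nonempty open set on
    which it is not real cannot consist of the countably many zeros of P alone.\<close>
  have s_real: "Im (s t) = 0" for t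
  proof (rule ccontr)
    assume "Im (s t) \<noteq> 0"
    then have ne: "{t. Im (s t) \<noteq> 0} \<noteq> {}" by blast
    have "open {t. Im (s t) \<noteq> 0}"
      by (intro open_Collect_neq continuous_on_Im s_cont continuous_on_const)
    from open_minus_countable[OF P0 ne this] obtain u where "Im (s u) \<noteq> 0" "P u \<noteq> 0" by blast
    moreover have "Im (of_real (P u) * s u) = 0" using Ps[of u] complex_is_Real_iff by blast
    ultimately show False by simp
  qed
  have "cis (2 * pi) = 1" by (simp add: complex_eq_iff)
  moreover have "cis ((real N * (2 * pi) + A) / 2) = cis (real N * pi) * cis (A / 2)"
    by (simp add: cis_mult add_divide_distrib)
  \<comment> \<open>A full turn adds N pi to the phase in \<open>s\<close>; for odd N the sign flips
    and the intermediate value theorem produces a zero.\<close>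
  moreover have "cis (real N * pi) = - 1"
    using odd unfolding N_def by (simp add: complex_eq_iff)
  ultimately have "s (2 * pi) = - s 0" by (simp add: s_def)
  then have "Re (s (2 * pi)) = - Re (s 0)" by simp
  moreover have "continuous_on {0..2 * pi} (\<lambda>t. Re (s t))"
    by (intro continuous_on_Re continuous_on_subset[OF s_cont]) auto
  ultimately have "\<exists>t. Re (s t) = 0"
    using IVT'[of "\<lambda>t. Re (s t)" 0 0 "2 * pi"] IVT2'[of "\<lambda>t. Re (s t)" "2 * pi" 0 0]
    by (cases "Re (s 0) \<le> 0") auto
  then show False using s_nz s_real by (auto simp: complex_eq_iff)
qed

text \<open>Compactness of the closed annulus gives an e-neighbourhood free of zeros. A point of the
  larger annulus is compared with its radial projection onto the closed one, at distance less than
  e.\<close>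

lemma annulus_nonzero_neighbourhood:
  assumes f: "continuous_on (open_annulus r1 r2) f" and r: "0 \<le> r1" "r1 < a" "a \<le> b" "b < r2"
    and nz: "\<And>z. a \<le> cmod z \<Longrightarrow> cmod z \<le> b \<Longrightarrow> f z \<noteq> (0::complex)"
  shows "\<exists>s1 s2. 0 \<le> s1 \<and> r1 \<le> s1 \<and> s1 < a \<and> b < s2 \<and> s2 \<le> r2 \<and> (\<forall>z\<in>open_annulus s1 s2. f z \<noteq> 0)"
proof -
  define U where "U = open_annulus r1 r2 \<inter> f -` (- {0})"
  define K where "K = {z. a \<le> cmod z \<and> cmod z \<le> b}"
  have "open U"
    unfolding U_def by (rule continuous_open_preimage[OF f open_open_annulus]) auto
  moreover have "compact K"
  proof -
    have "K = cball 0 b - ball 0 a" by (auto simp: K_def)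
    then show ?thesis by (simp add: compact_diff)
  qed
  moreover have "K \<subseteq> U" using nz r by (auto simp: K_def U_def open_annulus_def)
  ultimately obtain e where e: "0 < e" "(\<Union>x\<in>K. ball x e) \<subseteq> U"
    using compact_subset_open_imp_ball_epsilon_subset by blast
  have "f z \<noteq> 0" if z: "z \<in> open_annulus (max r1 (a - e)) (min r2 (b + e))" for z
  proof -
    define c where "c = max a (min b (cmod z))"
    have z0: "0 < cmod z" using z r by (auto simp: open_annulus_def)
    have "a - e < cmod z" "cmod z < b + e" using z by (auto simp: open_annulus_def)
    then have c: "a \<le> c" "c \<le> b" "\<bar>c - cmod z\<bar> < e"
      using r e(1) unfolding c_def max_def min_def by (auto simp: abs_less_iff)
    define x where "x = of_real (c / cmod z) * z"
    have "cmod x = c" using z0 c r by (simp add: x_def norm_mult del: of_real_divide)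
    then have "x \<in> K" using c by (simp add: K_def)
    have "x - z = of_real ((c - cmod z) / cmod z) * z"
      using z0 by (simp add: x_def field_simps)
    then have "cmod (x - z) = \<bar>c - cmod z\<bar>"
      using z0 by (simp add: norm_mult del: of_real_divide)
    then have "z \<in> ball x e" using c by (simp add: dist_norm)
    with e(2) \<open>x \<in> K\<close> have "z \<in> U" by blast
    then show ?thesis by (simp add: U_def)
  qed
  then show ?thesis
    using r e by (intro exI[of _ "max r1 (a - e)"] exI[of _ "min r2 (b + e)"]) auto
qed

section \<open>Laurent coefficients of the factored symbol\<close>

lemma laurent_coeff_cong:
  assumes "0 < r" "\<And>z. cmod z = r \<Longrightarrow> f z = g z"
  shows "laurent_coeff f r n = laurent_coeff g r n"
proof -
  have "contour_integral (circlepath 0 r) (\<lambda>w. f w * w powi (- n - 1))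
      = contour_integral (circlepath 0 r) (\<lambda>w. g w * w powi (- n - 1))"
    by (rule contour_integral_cong) (use assms in auto)
  then show ?thesis by (simp add: laurent_coeff_def)
qed

lemma laurent_coeff_linear:
  assumes r: "0 < r" and f: "continuous_on (sphere 0 r) f" and g: "continuous_on (sphere 0 r) g"
  shows "laurent_coeff (\<lambda>z. f z - c * g z) r n = laurent_coeff f r n - c * laurent_coeff g r n"
proof -
  have f': "(\<lambda>w. f w * w powi (- n - 1)) contour_integrable_on circlepath 0 r"
    using r by (intro contour_integrable_continuous_circlepath continuous_intros) (auto intro: continuous_on_subset[OF f])
  have g': "(\<lambda>w. g w * w powi (- n - 1)) contour_integrable_on circlepath 0 r"
    using r by (intro contour_integrable_continuous_circlepath continuous_intros) (auto intro: continuous_on_subset[OF g])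
  have "contour_integral (circlepath 0 r) (\<lambda>w. (f w - c * g w) * w powi (- n - 1))
      = contour_integral (circlepath 0 r) (\<lambda>w. f w * w powi (- n - 1) - c * (g w * w powi (- n - 1)))"
    by (simp add: left_diff_distrib mult.assoc)
  also have "\<dots> = contour_integral (circlepath 0 r) (\<lambda>w. f w * w powi (- n - 1))
      - c * contour_integral (circlepath 0 r) (\<lambda>w. g w * w powi (- n - 1))"
    using contour_integral_diff[OF f' contour_integrable_lmul[OF g', of c]] contour_integral_lmul[OF g', of c] by simp
  finally show ?thesis by (simp add: laurent_coeff_def diff_divide_distrib)
qed

lemma laurent_coeff_shift:
  assumes "0 < r"
  shows "laurent_coeff (\<lambda>z. z * f z) r n = laurent_coeff f r (n - 1)"
proof -
  have "contour_integral (circlepath 0 r) (\<lambda>w. w * f w * w powi (- n - 1))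
      = contour_integral (circlepath 0 r) (\<lambda>w. f w * w powi (- (n - 1) - 1))"
  proof (rule contour_integral_cong)
    fix w assume "w \<in> path_image (circlepath 0 r)"
    then have "w \<noteq> 0" using assms by auto
    then have "w powi (- n - 1) * w = w powi (- n)" by (simp add: power_int_diff)
    then show "w * f w * w powi (- n - 1) = f w * w powi (- (n - 1) - 1)" by (simp add: mult_ac)
  qed simp
  then show ?thesis by (simp add: laurent_coeff_def)
qed

lemma laurent_coeff_inverse:
  assumes f: "f holomorphic_on open_annulus r1 r2" and g: "g holomorphic_on open_annulus r1 r2"
    and r: "0 \<le> r1" "r1 < r" "r < r2" and fg: "\<And>z. cmod z = r \<Longrightarrow> f z * g z = 1"
  shows "((\<lambda>j. laurent_coeff f r j * laurent_coeff g r (m - j)) has_sum (if m = 0 then 1 else 0)) UNIV"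
proof -
  have sub: "sphere 0 r \<subseteq> open_annulus r1 r2" using r by (auto simp: open_annulus_def)
  have "continuous_on (sphere 0 r) g"
    using g sub holomorphic_on_imp_continuous_on continuous_on_subset by blast
  from laurent_coeff_mult[OF f this r, of m]
  have "((\<lambda>k. laurent_coeff f r k * laurent_coeff g r (m - k)) has_sum
      laurent_coeff (\<lambda>z. f z * g z) r m) UNIV" .
  moreover have "laurent_coeff (\<lambda>z. f z * g z) r m = laurent_coeff (\<lambda>_. 1) r m"
    using r fg by (intro laurent_coeff_cong) auto
  ultimately show ?thesis using laurent_coeff_const[of r 1 m] r by simp
qed

text \<open>A factor z - \<zeta> turns the coefficients c k into c (k - 1) - \<zeta> c k, which is
  \<open>sdiff \<zeta>\<close> applied after the convolution.\<close>

lemma (in radii) conv_laurent_factor: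
  assumes H: "H holomorphic_on open_annulus r1 r2" and r: "0 \<le> r1" "r1 < rm" "rp < r2" and y: "wbdd wn B y"
  shows "conv (laurent_coeff (\<lambda>z. (\<Prod>\<zeta>\<leftarrow>\<zeta>s. z - \<zeta>) * H z) 1) y = foldr sdiff \<zeta>s (conv (laurent_coeff H 1) y)"
proof (induction \<zeta>s)
  case (Cons \<zeta> \<zeta>s)
  define F where "F z = (\<Prod>\<zeta>\<leftarrow>\<zeta>s. z - \<zeta>) * H z" for z
  have "(\<lambda>z. \<Prod>\<zeta>\<leftarrow>\<zeta>s. z - \<zeta>) holomorphic_on open_annulus r1 r2"
    by (induction \<zeta>s) (auto intro!: holomorphic_intros)
  then have F: "F holomorphic_on open_annulus r1 r2"
    unfolding F_def by (intro holomorphic_intros H)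
  have sub: "sphere 0 1 \<subseteq> open_annulus r1 r2" using r rm rp by (auto simp: open_annulus_def)
  have cF: "continuous_on (sphere 0 1) F"
    using F sub holomorphic_on_imp_continuous_on continuous_on_subset by blast
  have sF: "(\<lambda>k. cmod (laurent_coeff F 1 k) * wx k) summable_on UNIV"
    unfolding wmax_def using r rm rp by (intro laurent_coeff_summable[OF F]) auto
  have "laurent_coeff (\<lambda>z. (\<Prod>\<zeta>\<leftarrow>\<zeta> # \<zeta>s. z - \<zeta>) * H z) 1 k
      = laurent_coeff F 1 (k - 1) - \<zeta> * laurent_coeff F 1 k" for k
  proof -
    have "laurent_coeff (\<lambda>z. (\<Prod>\<zeta>\<leftarrow>\<zeta> # \<zeta>s. z - \<zeta>) * H z) 1 k = laurent_coeff (\<lambda>z. z * F z - \<zeta> * F z) 1 k"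
      by (rule arg_cong[where f = "\<lambda>f. laurent_coeff f 1 k"]) (auto simp: F_def algebra_simps)
    also have "\<dots> = laurent_coeff (\<lambda>z. z * F z) 1 k - \<zeta> * laurent_coeff F 1 k"
      by (rule laurent_coeff_linear) (auto intro!: continuous_intros cF)
    finally show ?thesis by (simp add: laurent_coeff_shift)
  qed
  then have "conv (laurent_coeff (\<lambda>z. (\<Prod>\<zeta>\<leftarrow>\<zeta> # \<zeta>s. z - \<zeta>) * H z) 1) y
      = conv (\<lambda>k. laurent_coeff F 1 (k - 1) - \<zeta> * laurent_coeff F 1 k) y" by presburger
  also have "\<dots> = sdiff \<zeta> (conv (laurent_coeff F 1) y)"
    by (rule sdiff_conv[OF moderate_wn sF y, symmetric])
  also have "conv (laurent_coeff F 1) y = foldr sdiff \<zeta>s (conv (laurent_coeff H 1) y)"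
    unfolding F_def by (rule Cons.IH)
  finally show ?case by simp
qed simp

lemma annulus_eq: "annulus h = open_annulus (exp (- h)) (exp h)"
  by (auto simp: annulus_def open_annulus_def)

lemma connected_open_annulus: "connected (open_annulus r1 r2)"
  using connected_annulus(1)[of r1 "0 :: complex" r2] by (simp add: open_annulus_def)

text \<open>The clause on \<open>D_op\<close> makes \<open>inv_into\<close> in \<open>g_fun\<close>
  a genuine inverse, and the unique existence of C makes \<open>THE\<close> in
  \<open>center_cocycle\<close> meaningful. Non-constancy of V makes the zeros on the circle finite
  in number; its reality makes that number even, so that \<open>2 * half_zeros V E\<close> equals it
  in spite of the integer division.\<close>

theorem corollary1p1:
  fixes V :: "complex \<Rightarrow> complex"
    and W :: "complex ^ 'd::finite \<Rightarrow> complex"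
    and E h \<xi> rm rp :: real
  assumes \<xi>: "0 < \<xi>" "\<xi> < h"
    and V_analytic: "V holomorphic_on annulus h"
    and V_real: "\<And>z. cmod z = 1 \<Longrightarrow> V z \<in> \<real>"
    and V_nonconst: "\<not> V constant_on sphere 0 1"
    and W_analytic: "W \<in> C_omega h"
    and W_real: "\<And>x :: real ^ 'd. W (cvec x) \<in> \<real>"
    and radii: "exp (- \<xi>) < rm" "rm < 1" "1 < rp" "rp < exp \<xi>"
    and only_zeros: "\<And>z. \<lbrakk>rm \<le> cmod z; cmod z \<le> rp; V z - of_real E = 0\<rbrakk> \<Longrightarrow> cmod z = 1"
  shows "\<exists>\<epsilon>0>0. \<forall>\<alpha> :: real ^ 'd.
    (\<forall>\<epsilon>::real. \<bar>\<epsilon>\<bar> < \<epsilon>0 \<longrightarrow>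
       (\<forall>z. cmod z = rm \<or> cmod z = rp \<longrightarrow>
          bij_betw (D_op h V W E \<alpha> \<epsilon> z) (C_omega h) (C_omega h)) \<and>
       holomorphic_frame h \<xi> (center_fiber \<xi> rm rp V W E \<alpha> \<epsilon>) (2 * half_zeros V E)
         (center_frame h rm rp V W E \<alpha> \<epsilon>) \<and>
       (\<forall>\<theta>\<in>torus_strip h.
          \<exists>!C. cocycle_rel \<alpha> (2 * half_zeros V E) (center_frame h rm rp V W E \<alpha> \<epsilon>) \<theta> C) \<and>
       center_cocycle h rm rp V W E \<alpha> \<epsilon> \<in> C_omega_GL h (2 * half_zeros V E)) \<and>
    (\<exists>C0. (\<forall>\<theta>\<in>torus_strip h. center_cocycle h rm rp V W E \<alpha> 0 \<theta> = C0) \<and>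
       (\<exists>K. \<forall>\<epsilon>. \<bar>\<epsilon>\<bar> < \<epsilon>0 \<longrightarrow>
          mat_sup_norm h (\<lambda>\<theta>. center_cocycle h rm rp V W E \<alpha> \<epsilon> \<theta> - C0) \<le> K * \<bar>\<epsilon>\<bar>))"
proof -
  define r1 where "r1 = exp (- h)"
  define r2 where "r2 = exp h"
  have A: "annulus h = open_annulus r1 r2" by (simp add: annulus_eq r1_def r2_def)
  have r1_\<xi>: "r1 < exp (- \<xi>)" and r2_\<xi>: "exp \<xi> < r2" using \<xi> by (simp_all add: r1_def r2_def)
  have r: "0 \<le> r1" "r1 < rm" "rm < 1" "1 < rp" "rp < r2" "0 < rm" "0 < rp"
    using radii r1_\<xi> r2_\<xi> exp_gt_zero[of "- \<xi>"] exp_gt_zero[of "- h"] unfolding r1_def by linarith+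
  interpret radii rm rp using r by unfold_locales auto
  define L where "L z = V z - of_real E" for z
  have L: "L holomorphic_on open_annulus r1 r2"
    unfolding L_def using V_analytic by (intro holomorphic_intros) (simp add: A)
  have sphere_sub: "sphere 0 1 \<subseteq> open_annulus r1 r2" using r by (auto simp: open_annulus_def)
  have L_nonconst: "\<not> L constant_on open_annulus r1 r2"
  proof
    assume "L constant_on open_annulus r1 r2"
    then obtain c where "\<And>z. z \<in> open_annulus r1 r2 \<Longrightarrow> V z - of_real E = c"
      unfolding constant_on_def L_def by blast
    then have "V z = c + of_real E" if "z \<in> sphere 0 1" for z
      using sphere_sub that by (auto simp: diff_eq_eq)
    then have "V constant_on sphere 0 1" unfolding constant_on_def by blast
    with V_nonconst show False by simp
  qed
  define Z where "Z = {z. cmod z = 1 \<and> V z = of_real E}"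
  have Z: "finite Z" "Z \<subseteq> open_annulus r1 r2" "\<And>z. z \<in> Z \<Longrightarrow> L z = 0"
  proof -
    have "finite {z \<in> sphere 0 1. L z = 0}"
      by (rule holomorphic_compact_finite_zeros[OF L open_open_annulus connected_open_annulus _ sphere_sub L_nonconst]) simp
    moreover have "{z \<in> sphere 0 1. L z = 0} = Z" by (auto simp: Z_def L_def)
    ultimately show "finite Z" by simp
  qed (use sphere_sub in \<open>auto simp: Z_def L_def\<close>)
  have "\<exists>w\<in>open_annulus r1 r2. L w \<noteq> 0"
    using L_nonconst unfolding constant_on_def by metis
  from holomorphic_factor_zeros[OF L open_open_annulus connected_open_annulus this Z]
  obtain \<zeta>s H where set_\<zeta>s: "set \<zeta>s \<subseteq> Z" and H: "H holomorphic_on open_annulus r1 r2"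
    and HZ: "\<And>z. z \<in> Z \<Longrightarrow> H z \<noteq> 0"
    and fac: "\<And>w. w \<in> open_annulus r1 r2 \<Longrightarrow> L w = (\<Prod>\<zeta>\<leftarrow>\<zeta>s. w - \<zeta>) * H w"
    and len: "int (length \<zeta>s) = (\<Sum>z\<in>Z. zorder L z)" by blast
  have roots: "\<forall>\<zeta>\<in>set \<zeta>s. cmod \<zeta> = 1" using set_\<zeta>s by (auto simp: Z_def)
  have in_A: "z \<in> open_annulus r1 r2" if "rm \<le> cmod z" "cmod z \<le> rp" for z
    using that r by (auto simp: open_annulus_def)
  have H_nz: "H z \<noteq> 0" if z: "rm \<le> cmod z" "cmod z \<le> rp" for z
  proof (cases "L z = 0")
    case True
    then have "z \<in> Z" using only_zeros[OF z] by (auto simp: Z_def L_def)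
    then show ?thesis by (rule HZ)
  next
    case False
    then show ?thesis using fac[OF in_A[OF z]] by auto
  qed
  have even: "even (length \<zeta>s)"
  proof (rule even_circle_zeros[OF roots])
    show "continuous_on (sphere 0 1) H"
      using H sphere_sub holomorphic_on_imp_continuous_on continuous_on_subset by blast
    show "H z \<noteq> 0" if "cmod z = 1" for z using H_nz that r by simp
    show "(\<Prod>\<zeta>\<leftarrow>\<zeta>s. z - \<zeta>) * H z \<in> \<real>" if "cmod z = 1" for z
    proof -
      have "(\<Prod>\<zeta>\<leftarrow>\<zeta>s. z - \<zeta>) * H z = L z" using fac[of z] sphere_sub that by auto
      then show ?thesis using V_real[OF that] by (simp add: L_def)
    qed
  qed
  have "circle_zeros V E = length \<zeta>s"
    using len unfolding circle_zeros_def Z_def L_def[abs_def] by simp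
  then have N: "2 * half_zeros V E = length \<zeta>s" using even by (simp add: half_zeros_def)
  \<comment> \<open>Summing the coefficients of 1 / H against both weights requires holomorphy
    slightly beyond the two circles.\<close>
  obtain s1 s2 where s: "0 \<le> s1" "r1 \<le> s1" "s1 < rm" "rp < s2" "s2 \<le> r2"
    "\<And>z. z \<in> open_annulus s1 s2 \<Longrightarrow> H z \<noteq> 0"
    using annulus_nonzero_neighbourhood[OF holomorphic_on_imp_continuous_on[OF H], of rm rp] H_nz r by auto
  have "open_annulus s1 s2 \<subseteq> open_annulus r1 r2" using s by (auto simp: open_annulus_def)
  then have H': "H holomorphic_on open_annulus s1 s2" by (rule holomorphic_on_subset[OF H])
  then have Hinv: "(\<lambda>z. 1 / H z) holomorphic_on open_annulus s1 s2"
    using s by (intro holomorphic_intros) auto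
  \<comment> \<open>Each of the two circles is free of zeros of V - E, so the reciprocal is
    holomorphic in a thin annulus around it. The coefficients of V - E may be taken at any radius,
    while those of the reciprocal belong to their circle.\<close>
  have circle: "\<exists>q. (\<lambda>k. cmod (q k) * \<rho> powi k) summable_on UNIV \<and>
      (\<forall>m. ((\<lambda>j. laurent_coeff L 1 j * q (m - j)) has_sum (if m = 0 then 1 else 0)) UNIV) \<and>
      (\<forall>m. ((\<lambda>j. q j * laurent_coeff L 1 (m - j)) has_sum (if m = 0 then 1 else 0)) UNIV)"
    if \<rho>: "\<rho> = rm \<or> \<rho> = rp" for \<rho>
  proof -
    have \<rho>r: "r1 < \<rho>" "\<rho> < r2" "0 < \<rho>" "rm \<le> \<rho>" "\<rho> \<le> rp" "\<rho> \<noteq> 1" using \<rho> r by auto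
    have "L z \<noteq> 0" if "\<rho> \<le> cmod z" "cmod z \<le> \<rho>" for z
      using only_zeros[of z] that \<rho>r by (auto simp: L_def)
    then obtain t1 t2 where t: "0 \<le> t1" "r1 \<le> t1" "t1 < \<rho>" "\<rho> < t2" "t2 \<le> r2"
      "\<And>z. z \<in> open_annulus t1 t2 \<Longrightarrow> L z \<noteq> 0"
      using annulus_nonzero_neighbourhood[OF holomorphic_on_imp_continuous_on[OF L], of \<rho> \<rho>] \<rho>r r by auto
    have "open_annulus t1 t2 \<subseteq> open_annulus r1 r2" using t by (auto simp: open_annulus_def)
    then have L': "L holomorphic_on open_annulus t1 t2" by (rule holomorphic_on_subset[OF L])
    then have Linv: "(\<lambda>z. 1 / L z) holomorphic_on open_annulus t1 t2"
      using t by (intro holomorphic_intros) auto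
    have nz: "L z \<noteq> 0" if "cmod z = \<rho>" for z using t that by (auto simp: open_annulus_def)
    have v: "laurent_coeff L 1 k = laurent_coeff L \<rho> k" for k
      using r \<rho>r by (intro laurent_coeff_radius[OF L]) auto
    show ?thesis
      unfolding v
    proof (intro exI[of _ "laurent_coeff (\<lambda>z. 1 / L z) \<rho>"] conjI allI)
      show "(\<lambda>k. cmod (laurent_coeff (\<lambda>z. 1 / L z) \<rho> k) * \<rho> powi k) summable_on UNIV"
        using laurent_coeff_summable[OF Linv, of \<rho> \<rho> \<rho>] t by simp
      show "((\<lambda>j. laurent_coeff L \<rho> j * laurent_coeff (\<lambda>z. 1 / L z) \<rho> (m - j)) has_sum (if m = 0 then 1 else 0)) UNIV" for m
        by (rule laurent_coeff_inverse[OF L' Linv t(1,3,4)]) (use nz in simp)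
      show "((\<lambda>j. laurent_coeff (\<lambda>z. 1 / L z) \<rho> j * laurent_coeff L \<rho> (m - j)) has_sum (if m = 0 then 1 else 0)) UNIV" for m
        by (rule laurent_coeff_inverse[OF Linv L' t(1,3,4)]) (use nz in simp)
    qed
  qed
  obtain ri where ri: "(\<lambda>k. cmod (ri k) * rm powi k) summable_on UNIV"
    "\<And>m. ((\<lambda>j. laurent_coeff L 1 j * ri (m - j)) has_sum (if m = 0 then 1 else 0)) UNIV"
    "\<And>m. ((\<lambda>j. ri j * laurent_coeff L 1 (m - j)) has_sum (if m = 0 then 1 else 0)) UNIV"
    using circle[of rm] by blast
  obtain ro where ro: "(\<lambda>k. cmod (ro k) * rp powi k) summable_on UNIV"
    "\<And>m. ((\<lambda>j. laurent_coeff L 1 j * ro (m - j)) has_sum (if m = 0 then 1 else 0)) UNIV"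
    "\<And>m. ((\<lambda>j. ro j * laurent_coeff L 1 (m - j)) has_sum (if m = 0 then 1 else 0)) UNIV"
    using circle[of rp] by blast
  interpret symbol rm rp "laurent_coeff L 1" "laurent_coeff H 1" "laurent_coeff (\<lambda>z. 1 / H z) 1" ri ro \<zeta>s
  proof
    show "\<forall>\<zeta>\<in>set \<zeta>s. cmod \<zeta> = 1" by (rule roots)
    show "(\<lambda>k. cmod (laurent_coeff L 1 k) * wx k) summable_on UNIV"
      unfolding wmax_def using r by (intro laurent_coeff_summable[OF L]) auto
    show "(\<lambda>k. cmod (laurent_coeff H 1 k) * wx k) summable_on UNIV"
      unfolding wmax_def using r by (intro laurent_coeff_summable[OF H]) auto
    show "(\<lambda>k. cmod (laurent_coeff (\<lambda>z. 1 / H z) 1 k) * wx k) summable_on UNIV"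
      unfolding wmax_def using r s by (intro laurent_coeff_summable[OF Hinv]) auto
    show "conv (laurent_coeff L 1) y = foldr sdiff \<zeta>s (conv (laurent_coeff H 1) y)" if "wbdd wn B y" for y B
    proof -
      have "laurent_coeff L 1 k = laurent_coeff (\<lambda>z. (\<Prod>\<zeta>\<leftarrow>\<zeta>s. z - \<zeta>) * H z) 1 k" for k
        using sphere_sub by (intro laurent_coeff_cong fac) auto
      then have "laurent_coeff L 1 = laurent_coeff (\<lambda>z. (\<Prod>\<zeta>\<leftarrow>\<zeta>s. z - \<zeta>) * H z) 1" by (rule ext)
      then show ?thesis using conv_laurent_factor[OF H r(1,2,5) that, of \<zeta>s] by simp
    qed
    have "H z * (1 / H z) = 1" "1 / H z * H z = 1" if "cmod z = 1" for z
      using H_nz[of z] that r by auto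
    then show "((\<lambda>j. laurent_coeff H 1 j * laurent_coeff (\<lambda>z. 1 / H z) 1 (m - j)) has_sum (if m = 0 then 1 else 0)) UNIV"
      "((\<lambda>j. laurent_coeff (\<lambda>z. 1 / H z) 1 j * laurent_coeff H 1 (m - j)) has_sum (if m = 0 then 1 else 0)) UNIV" for m
      using s r by (intro laurent_coeff_inverse[OF H' Hinv] laurent_coeff_inverse[OF Hinv H']; simp)+
  qed (fact ri ro)+
  have "fourier_coeff V k = laurent_coeff L 1 k + (if k = 0 then of_real E else 0)" for k
  proof -
    have cV: "continuous_on (sphere 0 1) V"
      using V_analytic sphere_sub holomorphic_on_imp_continuous_on continuous_on_subset unfolding A by blast
    have "laurent_coeff L 1 k = laurent_coeff V 1 k - of_real E * laurent_coeff (\<lambda>_. 1) 1 k"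
      using laurent_coeff_linear[of 1 V "\<lambda>_. 1" "of_real E" k, OF _ cV continuous_on_const] by (simp add: L_def[abs_def])
    then show ?thesis by (simp add: fourier_coeff_eq_laurent_coeff laurent_coeff_const)
  qed
  from center_bundle[OF this C_omega_hol_torus[OF W_analytic] _ \<xi>(1) radii(1,4) N]
  show ?thesis unfolding N using \<xi> by simp
qed

end
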